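(* Let $k\ge 2$ and $n\geq 3$ be integers with $(k-1)(n-1)>2$. Let $(\lambda_1,\ldots,\lambda_{n-2})\in\mathcal{P}_n$, let $C^k(\lambda_1,\ldots,\lambda_{n-2})\subset\mathbb{P}^n$ be the associated generalized Fermat curve of type $(k,n)$ with generalized Fermat group $H$, and let $F\subset C^k(\lambda_1,\ldots,\lambda_{n-2})$ be the set of fixed points of non-trivial elements of $H$. If $p\in F$ and $w(p)$ denotes the Weierstrass weight of $p$, then $$\widehat{w}(p):=\frac{1}{24}(k-1)\,(k^{n-1}-2)\,(k^{n}+k^{n-1}-12)\;\leq\; w(p).$$ Moreover, there exists a dense open subset of $\mathcal{F}(k,n)$ where equality holds, i.e. such that for every generalized Fermat curve whose class lies in this subset, $w(p)=\widehat{w}(p)$ for the points $p\in F$.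
   Context: Let $\mathcal{P}_n:=\{(\lambda_1,\ldots,\lambda_{n-2})\in(\mathbb{C}\setminus\{0,1\})^{n-2}\mid \lambda_i\neq\lambda_j \text{ for } i\ne j\}$. For $(\lambda_1,\ldots,\lambda_{n-2})\in\mathcal{P}_n$, the generalized Fermat curve of type $(k,n)$ is the smooth projective curve $$C^k(\lambda_1,\ldots,\lambda_{n-2}):=\{x_0^k+x_1^k+x_2^k=0,\ \lambda_1x_0^k+x_1^k+x_3^k=0,\ \ldots,\ \lambda_{n-2}x_0^k+x_1^k+x_n^k=0\}\subset\mathbb{P}^n$$ over $\mathbb{C}$, of genus $g=\frac{k^{n-1}((n-1)(k-1)-2)+2}{2}$. Its generalized Fermat group is $H\cong\mathbb{Z}_k^n$, generated by the restrictions of $\varphi_j([x_0:\cdots:x_j:\cdots:x_n])=[x_0:\cdots:e^{2\pi i/k}x_j:\cdots:x_n]$, $0\le j\le n$. The set $F=\bigcup_{j=0}^n \mathrm{Fix}(\varphi_j)$ is the set of points of the curve with some coordinate $x_j$ equal to $0$. Weierstrass weight: for a point $p$ of a compact Riemann surface $C$ of genus $g$, let $a_1<\cdots<a_g$ be the Weierstrass gaps at $p$, i.e. the $g$ positive integers $a$ for which there is no meromorphic function on $C$ with a pole of order exactly $a$ at $p$ and holomorphic on $C\setminus\{p\}$. Then $w(p):=\sum_{i=1}^g(a_i-i)$. Moduli: $\mathcal{F}(k,n)$ is the locus of isomorphism classes of generalized Fermat curves of type $(k,n)$ in the moduli space of curves of genus $g$. It is identified with the quotient $\mathcal{P}_n/\mathfrak{S}_{n+1}$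 (the moduli space of the sphere with $n+1$ unordered punctures), with the quotient topology, where the symmetric group acts as follows. Put $(\gamma_1,\ldots,\gamma_{n+1})=(\infty,0,1,\lambda_1,\ldots,\lambda_{n-2})$. For $\sigma\in\mathfrak{S}_{n+1}$ let $T_\sigma$ be the Möbius transformation sending $\gamma_{\sigma^{-1}(1)},\gamma_{\sigma^{-1}(2)},\gamma_{\sigma^{-1}(3)}$ to $\infty,0,1$ respectively, and set $\sigma\cdot(\lambda_1,\ldots,\lambda_{n-2})=(T_\sigma(\gamma_{\sigma^{-1}(4)}),\ldots,T_\sigma(\gamma_{\sigma^{-1}(n+1)}))$. The curves with parameters $\lambda$ and $\mu$ are isomorphic if and only if $\lambda$ and $\mu$ lie in the same $\mathfrak{S}_{n+1}$-orbit. Here $\mathcal{P}_n\subset\mathbb{C}^{n-2}$ carries the usual complex topology. *)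

theory Defs
  imports "HOL-Complex_Analysis.Complex_Analysis" "HOL-Algebra.Sym_Groups" "HOL-Algebra.Group_Action"
    "HOL-Algebra.Bij"
begin

section \<open>Complex projective space and the curves\<close>

text \<open>Homogeneous coordinate vectors of \<open>n\<close>-dimensional projective space are functions on the
  naturals that vanish beyond index \<open>n\<close>; points are scaling classes of such vectors.\<close>

definition hom_coords :: "nat \<Rightarrow> (nat \<Rightarrow> complex) set" where
  "hom_coords n = {x. (\<forall>i>n. x i = 0) \<and> (\<exists>i\<le>n. x i \<noteq> 0)}"

definition proj_pt :: "(nat \<Rightarrow> complex) \<Rightarrow> (nat \<Rightarrow> complex) set" where
  "proj_pt x = {(\<lambda>i. c * x i) | c. c \<noteq> 0}"

definition proj_space :: "nat \<Rightarrow> (nat \<Rightarrow> complex) set set" where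
  "proj_space n = proj_pt ` hom_coords n"

definition param_space :: "nat \<Rightarrow> (nat \<Rightarrow> complex) set" where
  "param_space n = {l \<in> {1..n - 2} \<rightarrow>\<^sub>E (- {0, 1}). inj_on l {1..n - 2}}"

definition fermat_curve :: "nat \<Rightarrow> nat \<Rightarrow> (nat \<Rightarrow> complex) \<Rightarrow> (nat \<Rightarrow> complex) set set" where
  "fermat_curve k n l = {P \<in> proj_space n. \<forall>x\<in>P.
     x 0 ^ k + x 1 ^ k + x 2 ^ k = 0 \<and>
     (\<forall>i\<in>{1..n - 2}. l i * x 0 ^ k + x 1 ^ k + x (i + 2) ^ k = 0)}"

section \<open>The generalized Fermat group and its fixed points\<close>

text \<open>A point is a scaling class, so a linear map acts on it by taking the image of the class.\<close>

definition phi :: "nat \<Rightarrow> nat \<Rightarrow> (nat \<Rightarrow> complex) set \<Rightarrow> (nat \<Rightarrow> complex) set" where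
  "phi k j P = (\<lambda>x. x(j := exp (2 * of_real pi * \<i> / of_nat k) * x j)) ` P"

definition fermat_group ::
    "nat \<Rightarrow> nat \<Rightarrow> (nat \<Rightarrow> complex) \<Rightarrow> ((nat \<Rightarrow> complex) set \<Rightarrow> (nat \<Rightarrow> complex) set) set" where
  "fermat_group k n l = generate (BijGroup (fermat_curve k n l))
     ((\<lambda>j. restrict (phi k j) (fermat_curve k n l)) ` {0..n})"

definition fixed_pts :: "nat \<Rightarrow> nat \<Rightarrow> (nat \<Rightarrow> complex) \<Rightarrow> (nat \<Rightarrow> complex) set set" where
  "fixed_pts k n l = {p \<in> fermat_curve k n l.
     \<exists>h\<in>fermat_group k n l. h \<noteq> \<one>\<^bsub>BijGroup (fermat_curve k n l)\<^esub> \<and> h p = p}"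

section \<open>Riemann surface structure, Weierstrass gaps and weight\<close>

text \<open>The complex structure that a smooth curve \<open>X\<close> inherits from projective space, given by its
  holomorphic local parametrizations \<open>\<psi> : D \<rightarrow> X\<close>, i.e. the inverses of its charts. In terms of a
  lift \<open>\<Psi>\<close> to homogeneous coordinates, \<open>\<psi>\<close> is an immersion at \<open>z\<close> iff \<open>\<Psi>' z\<close> is not a multiple
  of \<open>\<Psi> z\<close>. An injective holomorphic immersion into a curve is biholomorphic onto an open subset
  of the curve, so no topology on \<open>X\<close> is needed here.\<close>

definition local_params ::
    "nat \<Rightarrow> (nat \<Rightarrow> complex) set set \<Rightarrow> (complex set \<times> (complex \<Rightarrow> (nat \<Rightarrow> complex) set)) set" where
  "local_params n X = {(D, \<psi>). open D \<and> inj_on \<psi> D \<and> \<psi> ` D \<subseteq> X \<and>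
     (\<exists>\<Psi>. (\<forall>z\<in>D. \<Psi> z \<in> hom_coords n \<and> \<psi> z = proj_pt (\<Psi> z)) \<and>
          (\<forall>i\<le>n. (\<lambda>z. \<Psi> z i) holomorphic_on D) \<and>
          (\<forall>z\<in>D. \<not> (\<exists>c. \<forall>i\<le>n. deriv (\<lambda>w. \<Psi> w i) z = c * \<Psi> z i)))}"

text \<open>In the following, \<open>\<Phi>\<close> is the collection of all local parametrizations of a compact Riemann
  surface. A meromorphic function whose only pole is \<open>p\<close> is given by a complex-valued function
  whose value at \<open>p\<close> is irrelevant.\<close>

definition holomorphic_off :: "(complex set \<times> (complex \<Rightarrow> 'a)) set \<Rightarrow> 'a \<Rightarrow> ('a \<Rightarrow> complex) \<Rightarrow> bool" where
  "holomorphic_off \<Phi> p f \<longleftrightarrow> (\<forall>(D, \<psi>)\<in>\<Phi>. (f \<circ> \<psi>) holomorphic_on {z \<in> D. \<psi> z \<noteq> p})"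

definition has_pole_of_order ::
    "(complex set \<times> (complex \<Rightarrow> 'a)) set \<Rightarrow> ('a \<Rightarrow> complex) \<Rightarrow> 'a \<Rightarrow> nat \<Rightarrow> bool" where
  "has_pole_of_order \<Phi> f p a \<longleftrightarrow>
     (\<exists>(D, \<psi>)\<in>\<Phi>. \<exists>z\<in>D. \<psi> z = p \<and> is_pole (f \<circ> \<psi>) z \<and> zorder (f \<circ> \<psi>) z = - int a)"

definition weierstrass_gaps :: "(complex set \<times> (complex \<Rightarrow> 'a)) set \<Rightarrow> 'a \<Rightarrow> nat set" where
  "weierstrass_gaps \<Phi> p = {a. a > 0 \<and> \<not> (\<exists>f. holomorphic_off \<Phi> p f \<and> has_pole_of_order \<Phi> f p a)}"

text \<open>By the Weierstrass gap theorem, the number of gaps is the genus, so the sum below runs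
  from 1 to the genus.\<close>

definition weierstrass_weight :: "(complex set \<times> (complex \<Rightarrow> 'a)) set \<Rightarrow> 'a \<Rightarrow> int" where
  "weierstrass_weight \<Phi> p =
     (\<Sum>i = 1..card (weierstrass_gaps \<Phi> p).
        int (sorted_list_of_set (weierstrass_gaps \<Phi> p) ! (i - 1)) - int i)"

definition fermat_weight :: "nat \<Rightarrow> nat \<Rightarrow> (nat \<Rightarrow> complex) \<Rightarrow> (nat \<Rightarrow> complex) set \<Rightarrow> int" where
  "fermat_weight k n l p = weierstrass_weight (local_params n (fermat_curve k n l)) p"

definition weight_bound :: "nat \<Rightarrow> nat \<Rightarrow> real" where
  "weight_bound k n = 1 / 24 * (real k - 1) * (real k ^ (n - 1) - 2) *
     (real k ^ n + real k ^ (n - 1) - 12)"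

section \<open>The moduli space\<close>

text \<open>The Riemann sphere is \<^typ>\<open>complex option\<close>, with \<^const>\<open>None\<close> as the point at infinity.\<close>

definition moebius_map ::
    "complex \<Rightarrow> complex \<Rightarrow> complex \<Rightarrow> complex \<Rightarrow> complex option \<Rightarrow> complex option" where
  "moebius_map a b c d w = (case w of
     None \<Rightarrow> if c = 0 then None else Some (a / c)
   | Some z \<Rightarrow> if c * z + d = 0 then None else Some ((a * z + b) / (c * z + d)))"

definition is_moebius :: "(complex option \<Rightarrow> complex option) \<Rightarrow> bool" where
  "is_moebius T \<longleftrightarrow> (\<exists>a b c d. a * d - b * c \<noteq> 0 \<and> T = moebius_map a b c d)"

definition branch_pt :: "(nat \<Rightarrow> complex) \<Rightarrow> nat \<Rightarrow> complex option" where
  "branch_pt l i =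
     (if i = 1 then None else if i = 2 then Some 0 else if i = 3 then Some 1 else Some (l (i - 3)))"

definition normalizing_map ::
    "(nat \<Rightarrow> nat) \<Rightarrow> (nat \<Rightarrow> complex) \<Rightarrow> complex option \<Rightarrow> complex option" where
  "normalizing_map \<sigma> l = (THE T. is_moebius T \<and>
     T (branch_pt l (inv' \<sigma> 1)) = None \<and>
     T (branch_pt l (inv' \<sigma> 2)) = Some 0 \<and>
     T (branch_pt l (inv' \<sigma> 3)) = Some 1)"

definition sym_act :: "nat \<Rightarrow> (nat \<Rightarrow> nat) \<Rightarrow> (nat \<Rightarrow> complex) \<Rightarrow> (nat \<Rightarrow> complex)" where
  "sym_act n \<sigma> l =
     (\<lambda>i\<in>{1..n - 2}. the (normalizing_map \<sigma> l (branch_pt l (inv' \<sigma> (i + 3)))))"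

definition moduli_class :: "nat \<Rightarrow> (nat \<Rightarrow> complex) \<Rightarrow> (nat \<Rightarrow> complex) set" where
  "moduli_class n l = Group_Action.orbit (sym_group (n + 1)) (sym_act n) l"

definition quotient_topology :: "'a topology \<Rightarrow> ('a \<Rightarrow> 'b) \<Rightarrow> 'b topology" where
  "quotient_topology X q =
     topology (\<lambda>U. U \<subseteq> q ` topspace X \<and> openin X {x \<in> topspace X. q x \<in> U})"

lemma openin_quotient_topology:
  "openin (quotient_topology X q) U \<longleftrightarrow>
     U \<subseteq> q ` topspace X \<and> openin X {x \<in> topspace X. q x \<in> U}"
proof -
  have "istopology (\<lambda>U. U \<subseteq> q ` topspace X \<and> openin X {x \<in> topspace X. q x \<in> U})"
    unfolding istopology_def
  proof (intro conjI allI impI)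
    fix S T assume "S \<subseteq> q ` topspace X \<and> openin X {x \<in> topspace X. q x \<in> S}"
      and "T \<subseteq> q ` topspace X \<and> openin X {x \<in> topspace X. q x \<in> T}"
    moreover have "{x \<in> topspace X. q x \<in> S \<inter> T} =
        {x \<in> topspace X. q x \<in> S} \<inter> {x \<in> topspace X. q x \<in> T}" by auto
    ultimately show "S \<inter> T \<subseteq> q ` topspace X" "openin X {x \<in> topspace X. q x \<in> S \<inter> T}"
      by auto
  next
    fix K assume K: "\<forall>S\<in>K. S \<subseteq> q ` topspace X \<and> openin X {x \<in> topspace X. q x \<in> S}"
    then show "\<Union> K \<subseteq> q ` topspace X" by auto
    have "{x \<in> topspace X. q x \<in> \<Union> K} = (\<Union>S\<in>K. {x \<in> topspace X. q x \<in> S})" by auto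
    with K show "openin X {x \<in> topspace X. q x \<in> \<Union> K}" by auto
  qed
  then show ?thesis
    by (simp add: quotient_topology_def)
qed

lemma topspace_quotient_topology: "topspace (quotient_topology X q) = q ` topspace X"
proof
  show "topspace (quotient_topology X q) \<subseteq> q ` topspace X"
    using openin_quotient_topology[of X q] by (meson openin_topspace)
  have "{x \<in> topspace X. q x \<in> q ` topspace X} = topspace X" by auto
  then show "q ` topspace X \<subseteq> topspace (quotient_topology X q)"
    by (intro openin_subset) (simp add: openin_quotient_topology)
qed

definition param_topology :: "nat \<Rightarrow> (nat \<Rightarrow> complex) topology" where
  "param_topology n = subtopology (product_topology (\<lambda>_. euclidean) {1..n - 2}) (param_space n)"

text \<open>The moduli space of generalized Fermat curves of type \<open>(k, n)\<close>; it does not depend on \<open>k\<close>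
  because two such curves are isomorphic iff their parameters lie in the same orbit.\<close>

definition fermat_moduli :: "nat \<Rightarrow> (nat \<Rightarrow> complex) set topology" where
  "fermat_moduli n = quotient_topology (param_topology n) (moduli_class n)"

lemma topspace_fermat_moduli:
  "topspace (fermat_moduli n) = orbits (sym_group (n + 1)) (param_space n) (sym_act n)"
proof -
  have "topspace (param_topology n) = param_space n"
    by (auto simp: param_topology_def param_space_def PiE_def)
  then show ?thesis
    by (auto simp: fermat_moduli_def topspace_quotient_topology moduli_class_def orbits_def)
qed

end

theory Submission
  imports Defs "HOL-Number_Theory.Cong"
begin

text \<open>Let \<open>p\<close> be a point of the curve with \<open>x\<^sub>j = 0\<close>. In terms of the ratios \<open>y\<^sub>i\<close> of suitably
scaled coordinates \<open>x\<^sub>i\<close>, \<open>i \<noteq> j\<close>, to \<open>x\<^sub>j\<close>, the part \<open>x\<^sub>j \<noteq> 0\<close> of the curve is given by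
\<open>y\<^sub>i ^ k = z - c\<^sub>i\<close>, where the \<open>c\<^sub>i\<close> are distinct and one of them, with index \<open>j0\<close>, is \<open>0\<close>. There are
\<open>k ^ (n - 1)\<close> points at infinity, \<open>p\<close> is one of them, and \<open>t = 1 / y\<^sub>j\<^sub>0\<close> is a parameter at each of
them, with \<open>z = t ^ (- k)\<close>.

A function whose only pole is \<open>p\<close> is a sum of terms \<open>y ^ e P\<^sub>e(z)\<close> with
\<open>y ^ e = \<Prod>\<^sub>i y\<^sub>i ^ e\<^sub>i\<close>, \<open>0 \<le> e\<^sub>i < k\<close> and polynomials \<open>P\<^sub>e\<close>. The roots of unity that multiply the \<open>y\<^sub>i\<close>
act on the points at infinity transitively. Fourier inversion therefore turns the condition that
there is no pole at infinity apart from \<open>p\<close> into the condition that all terms with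
\<open>\<Sum>\<^sub>i e\<^sub>i\<close> in one residue class \<open>r\<close> modulo \<open>k\<close> have, up to a common factor, the principal part of that class
of the function at \<open>p\<close>. With
\<open>R\<^sub>e(s) = \<Prod>\<^sub>i (1 - c\<^sub>i s) ^ (- e\<^sub>i / k)\<close> and \<open>s = t ^ k\<close>, a Laurent tail
\<open>\<Sum>\<^sub>l g\<^sub>l t ^ (- r - k l)\<close> is such a principal part iff it is annihilated by the power series
\<open>s ^ i R\<^sub>e(s)\<close> with \<open>r + k i < \<Sum>\<^sub>i e\<^sub>i\<close>. (These series are the expansions at \<open>p\<close> of the holomorphic
differentials, and the annihilation is an instance of the residue theorem.) By linear algebra, \<open>r + k m\<close> with \<open>1 \<le> r \<le> k\<close> is a gap at \<open>p\<close> iff \<open>m\<close>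
is the order at \<open>0\<close> of an element of the span \<open>W\<^sub>r\<close> of these series. This is
\<open>weierstrass_gaps_centre\<close>.

The series are linearly independent (\<open>radicals_independent\<close>), so \<open>W\<^sub>r\<close> has as many vanishing orders as
there are pairs \<open>(e, i)\<close>. Their sum is smallest when the orders are \<open>0, 1, 2, \<dots>\<close>; counting the
pairs turns this into the lower bound for the weight. Equality holds if no nonzero element
of \<open>W\<^sub>r\<close> vanishes to order at least \<open>dim W\<^sub>r\<close>, for each \<open>r\<close>.

This condition is open because it is the independence of finitely many vectors that depend
continuously on the parameters. It is dense because expanding the same functions at \<open>s\<^sub>0\<close> instead
of \<open>0\<close> only replaces \<open>c\<^sub>i\<close> by \<open>c\<^sub>i / (1 - c\<^sub>i s\<^sub>0)\<close>, which means moving the \<open>j\<close>-th branch point while the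
others stay, and a Wronskian argument finds arbitrarily small \<open>s\<^sub>0\<close> where the condition holds
(\<open>exists_deformation_uninflected\<close>). Requiring it for all orderings of the branch points at once
makes the locus invariant under the symmetric group, so it descends to the moduli space.\<close>

unbundle no vec_syntax

section \<open>Vanishing orders in a space of power series\<close>

definition lincomb :: "'j set \<Rightarrow> ('j \<Rightarrow> complex fps) \<Rightarrow> ('j \<Rightarrow> complex) \<Rightarrow> complex fps" where
  "lincomb J v a = (\<Sum>j\<in>J. fps_const (a j) * v j)"

definition vanishing_orders :: "'j set \<Rightarrow> ('j \<Rightarrow> complex fps) \<Rightarrow> nat set" where
  "vanishing_orders J v = {subdegree (lincomb J v a) | a. lincomb J v a \<noteq> 0}"

definition lin_indep :: "'j set \<Rightarrow> ('j \<Rightarrow> complex fps) \<Rightarrow> bool" where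
  "lin_indep J v \<longleftrightarrow> (\<forall>a. lincomb J v a = 0 \<longrightarrow> (\<forall>j\<in>J. a j = 0))"

text \<open>The Wronskian of the family, in its order, does not vanish: the first \<open>card J\<close> coefficients
separate the linear combinations. This implies linear independence.\<close>

definition uninflected :: "'j set \<Rightarrow> ('j \<Rightarrow> complex fps) \<Rightarrow> bool" where
  "uninflected J v \<longleftrightarrow> (\<forall>a. (\<forall>l<card J. lincomb J v a $ l = 0) \<longrightarrow> (\<forall>j\<in>J. a j = 0))"

lemma lincomb_nth: "lincomb J v a $ l = (\<Sum>j\<in>J. a j * v j $ l)"
  by (simp add: lincomb_def fps_sum_nth)

lemma vanishing_ordersI: "lincomb J v a \<noteq> 0 \<Longrightarrow> subdegree (lincomb J v a) \<in> vanishing_orders J v"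
  unfolding vanishing_orders_def by blast

text \<open>One step of Gaussian elimination: subtracting multiples of a series \<open>v j0\<close> of least order from the
others raises their orders above \<open>d\<close>, so that \<open>d\<close> is split off from the set of orders.\<close>

lemma vanishing_orders_eliminate:
  assumes J: "finite J" "j0 \<in> J" and nz: "v j0 \<noteq> 0"
    and mini: "\<And>j. j \<in> J \<Longrightarrow> subdegree (v j0) \<le> subdegree (v j)"
  defines "d \<equiv> subdegree (v j0)"
  defines "v' \<equiv> (\<lambda>j. v j - fps_const (v j $ d / v j0 $ d) * v j0)"
  shows "vanishing_orders J v = insert d (vanishing_orders (J - {j0}) v')"
    and "d \<notin> vanishing_orders (J - {j0}) v'"
    and "lin_indep J v \<Longrightarrow> lin_indep (J - {j0}) v'"
proof -
  have vd: "v j0 $ d \<noteq> 0"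
    using nz by (simp add: d_def)
  have v'0: "v' j $ l = 0" if "j \<in> J" "l \<le> d" for j l
  proof (cases "l = d")
    case True then show ?thesis using vd by (simp add: v'_def)
  next
    case False
    with that have l: "l < d" by simp
    then have "v j0 $ l = 0" unfolding d_def by (rule nth_less_subdegree_zero)
    moreover have "v j $ l = 0"
      using mini[OF that(1)] l unfolding d_def by (intro nth_less_subdegree_zero) linarith
    ultimately show ?thesis by (simp add: v'_def)
  qed
  have v'j0: "v' j0 = 0" using vd by (simp add: v'_def)
  have dec: "lincomb J v a = fps_const (\<Sum>j\<in>J. a j * (v j $ d / v j0 $ d)) * v j0 + lincomb (J - {j0}) v' a" for a
  proof -
    have "lincomb J v a = (\<Sum>j\<in>J. fps_const (a j * (v j $ d / v j0 $ d)) * v j0 + fps_const (a j) * v' j)"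
      unfolding lincomb_def v'_def
      by (intro sum.cong refl) (simp add: algebra_simps fps_const_mult[symmetric] del: fps_const_mult)
    also have "\<dots> = (\<Sum>j\<in>J. fps_const (a j * (v j $ d / v j0 $ d))) * v j0 + (\<Sum>j\<in>J. fps_const (a j) * v' j)"
      by (simp only: sum.distrib sum_distrib_right)
    also have "(\<Sum>j\<in>J. fps_const (a j) * v' j) = lincomb (J - {j0}) v' a"
      unfolding lincomb_def using J by (subst sum.remove[of J j0]) (simp_all add: v'j0)
    also have "(\<Sum>j\<in>J. fps_const (a j * (v j $ d / v j0 $ d))) = fps_const (\<Sum>j\<in>J. a j * (v j $ d / v j0 $ d))"
      by (rule fps_ext) (simp add: fps_sum_nth)
    finally show ?thesis .
  qed
  have low: "lincomb (J - {j0}) v' a $ l = 0" if "l \<le> d" for a l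
    by (auto simp: lincomb_nth v'0 that intro!: sum.neutral)
  have gt: "d < subdegree (lincomb (J - {j0}) v' a)" if "lincomb (J - {j0}) v' a \<noteq> 0" for a
    using low that by (metis linorder_not_le nth_subdegree_nonzero)
  show nin: "d \<notin> vanishing_orders (J - {j0}) v'"
    using gt by (auto simp: vanishing_orders_def)
  show "vanishing_orders J v = insert d (vanishing_orders (J - {j0}) v')" (is "?A = ?B")
  proof
    show "?A \<subseteq> ?B"
    proof
      fix o' assume "o' \<in> ?A"
      then obtain a where a: "o' = subdegree (lincomb J v a)" "lincomb J v a \<noteq> 0"
        by (auto simp: vanishing_orders_def)
      define c where "c = (\<Sum>j\<in>J. a j * (v j $ d / v j0 $ d))"
      show "o' \<in> ?B"
      proof (cases "c = 0")
        case True
        then have eq: "lincomb J v a = lincomb (J - {j0}) v' a" unfolding dec[of a] c_def by simp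
        show ?thesis
          using vanishing_ordersI[of "J - {j0}" v' a] a unfolding eq by simp
      next
        case False
        have "subdegree (lincomb J v a) = d"
        proof (rule subdegreeI)
          have nth: "lincomb J v a $ l = c * v j0 $ l + lincomb (J - {j0}) v' a $ l" for l
            unfolding dec[of a] c_def[symmetric] by simp
          show "lincomb J v a $ d \<noteq> 0"
            unfolding nth low[OF order_refl] using False vd by simp
          show "lincomb J v a $ i = 0" if "i < d" for i
            unfolding nth low[OF less_imp_le[OF that]]
            using that nth_less_subdegree_zero[of i "v j0"] by (simp add: d_def)
        qed
        then show ?thesis using a by simp
      qed
    qed
    show "?B \<subseteq> ?A"
    proof
      fix o' assume "o' \<in> ?B"
      then consider "o' = d" | a where "o' = subdegree (lincomb (J - {j0}) v' a)" "lincomb (J - {j0}) v' a \<noteq> 0"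
        by (auto simp: vanishing_orders_def)
      then show "o' \<in> ?A"
      proof cases
        case 1
        have "lincomb J v (\<lambda>j. if j = j0 then 1 else 0) = (\<Sum>j\<in>J. if j = j0 then v j0 else 0)"
          unfolding lincomb_def by (intro sum.cong) auto
        also have "\<dots> = v j0" using J by simp
        finally have eq: "lincomb J v (\<lambda>j. if j = j0 then 1 else 0) = v j0" .
        show ?thesis
          using vanishing_ordersI[of J v "\<lambda>j. if j = j0 then 1 else 0", unfolded eq, OF nz]
          unfolding 1 d_def .
      next
        case 2
        define a' where "a' = a(j0 := - (\<Sum>j\<in>J-{j0}. a j * (v j $ d / v j0 $ d)))"
        have "(\<Sum>j\<in>J. a' j * (v j $ d / v j0 $ d)) = 0"
          using J vd by (subst sum.remove[of J j0]) (simp_all add: a'_def)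
        moreover have "lincomb (J - {j0}) v' a' = lincomb (J - {j0}) v' a"
          unfolding lincomb_def by (intro sum.cong) (auto simp: a'_def)
        ultimately have eq: "lincomb J v a' = lincomb (J - {j0}) v' a" unfolding dec[of a'] by simp
        show ?thesis
          using vanishing_ordersI[of J v a', unfolded eq, OF 2(2)] unfolding 2(1) .
      qed
    qed
  qed
  assume ind: "lin_indep J v"
  show "lin_indep (J - {j0}) v'"
    unfolding lin_indep_def
  proof (intro allI impI)
    fix a assume a0: "lincomb (J - {j0}) v' a = 0"
    define a' where "a' = a(j0 := - (\<Sum>j\<in>J-{j0}. a j * (v j $ d / v j0 $ d)))"
    have "(\<Sum>j\<in>J. a' j * (v j $ d / v j0 $ d)) = 0"
      using J vd by (subst sum.remove[of J j0]) (simp_all add: a'_def)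
    moreover have "lincomb (J - {j0}) v' a' = lincomb (J - {j0}) v' a"
      unfolding lincomb_def by (intro sum.cong) (auto simp: a'_def)
    ultimately have "lincomb J v a' = 0" unfolding dec[of a'] using a0 by simp
    with ind have "\<forall>j\<in>J. a' j = 0" unfolding lin_indep_def by blast
    moreover have "a' j = a j" if "j \<in> J - {j0}" for j using that by (simp add: a'_def)
    ultimately show "\<forall>j\<in>J - {j0}. a j = 0" by (metis DiffD1)
  qed
qed

text \<open>A space of power series has as many vanishing orders as its dimension, by repeated elimination.\<close>

lemma card_vanishing_orders:
  assumes "finite J" "lin_indep J v"
  shows "finite (vanishing_orders J v) \<and> card (vanishing_orders J v) = card J"
  using assms
proof (induction "card J" arbitrary: J v)
  case 0
  then show ?case by (simp add: vanishing_orders_def lincomb_def)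
next
  case (Suc m)
  have nz: "v j \<noteq> 0" if "j \<in> J" for j
  proof
    assume "v j = 0"
    then have "lincomb J v (\<lambda>i. if i = j then 1 else 0) = 0"
      unfolding lincomb_def by (intro sum.neutral) auto
    then have "(if j = j then 1 else 0) = (0 :: complex)"
      using Suc.prems(2) that unfolding lin_indep_def by blast
    then show False by simp
  qed
  have "J \<noteq> {}" using Suc.hyps(2) by auto
  then obtain j0 where j0: "j0 \<in> J" "\<And>j. j \<in> J \<Longrightarrow> subdegree (v j0) \<le> subdegree (v j)"
    using ex_min_if_finite[of "(\<lambda>j. subdegree (v j)) ` J"] Suc.prems(1)
    by (metis arg_min_if_finite(1,2) linorder_not_le)
  define v' where "v' = (\<lambda>j. v j - fps_const (v j $ subdegree (v j0) / v j0 $ subdegree (v j0)) * v j0)"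
  note el = vanishing_orders_eliminate[where v=v, OF Suc.prems(1) j0(1) nz[OF j0(1)] j0(2), folded v'_def]
  have m: "m = card (J - {j0})" using Suc.hyps(2) j0 by simp
  have "finite (J - {j0})" using Suc.prems by simp
  moreover have "lin_indep (J - {j0}) v'" using el(3) Suc.prems(2) by blast
  ultimately have "finite (vanishing_orders (J - {j0}) v') \<and> card (vanishing_orders (J - {j0}) v') = card (J - {j0})"
    by (rule Suc.hyps(1)[OF m])
  then
  have "finite (vanishing_orders (J - {j0}) v')" "card (vanishing_orders (J - {j0}) v') = m"
    using m by simp_all
  then show ?case
    using el(1,2) by (simp add: Suc.hyps(2)[symmetric])
qed

lemma lin_indep_if_uninflected: "uninflected J v \<Longrightarrow> lin_indep J v"
proof -
  assume u: "uninflected J v"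
  have "\<forall>j\<in>J. a j = 0" if "lincomb J v a = 0" for a
  proof -
    have "\<forall>l<card J. lincomb J v a $ l = 0" using that by simp
    with u show ?thesis unfolding uninflected_def by blast
  qed
  then show ?thesis unfolding lin_indep_def by blast
qed

lemma vanishing_orders_if_uninflected:
  assumes "finite J" "uninflected J v"
  shows "vanishing_orders J v = {..<card J}"
proof (rule card_subset_eq)
  show "vanishing_orders J v \<subseteq> {..<card J}"
  proof
    fix o' assume "o' \<in> vanishing_orders J v"
    then obtain a where a: "o' = subdegree (lincomb J v a)" "lincomb J v a \<noteq> 0"
      by (auto simp: vanishing_orders_def)
    show "o' \<in> {..<card J}"
    proof (rule ccontr)
      assume "o' \<notin> {..<card J}"
      then have "\<forall>l<card J. lincomb J v a $ l = 0" using a by (auto intro: nth_less_subdegree_zero)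
      with assms(2) have "\<forall>j\<in>J. a j = 0" unfolding uninflected_def by blast
      then have "lincomb J v a = 0" by (simp add: lincomb_def)
      with a show False by simp
    qed
  qed
  show "card (vanishing_orders J v) = card {..<card J}"
    using card_vanishing_orders[OF assms(1) lin_indep_if_uninflected[OF assms(2)]] by simp
qed simp

text \<open>The Fredholm alternative. If \<open>g\<close> obstructs solving for \<open>u\<close> with \<open>J\<close> but does not annihilate the new
vector \<open>v i\<close>, then the hypothesis for \<open>J\<close> is applied to \<open>u\<close> shifted by the multiple of \<open>v i\<close> that \<open>g\<close>
forces.\<close>

lemma solvable_or_annihilated:
  fixes v :: "'j \<Rightarrow> 'l \<Rightarrow> 'a::field"
  assumes "finite J" "finite L"
  shows "(\<exists>a. \<forall>l\<in>L. (\<Sum>j\<in>J. a j * v j l) = u l) \<or>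
         (\<exists>g. (\<forall>j\<in>J. (\<Sum>l\<in>L. g l * v j l) = 0) \<and> (\<Sum>l\<in>L. g l * u l) \<noteq> 0)"
  using assms(1)
proof (induction J arbitrary: u rule: finite_induct)
  case empty
  show ?case
  proof (cases "\<forall>l\<in>L. u l = 0")
    case False
    then obtain l0 where "l0 \<in> L" "u l0 \<noteq> 0" by auto
    then have "(\<Sum>l\<in>L. (if l = l0 then 1 else 0) * u l) \<noteq> 0"
      using assms(2) by (simp add: if_distrib[of "\<lambda>x. x * _"] cong: if_cong)
    then show ?thesis by (intro disjI2 exI[of _ "\<lambda>l. if l = l0 then 1 else 0"]) auto
  qed auto
next
  case (insert i J)
  let ?p = "\<lambda>g w. \<Sum>l\<in>L. g l * (w l :: 'a)"
  show ?case
  proof (cases "\<exists>a. \<forall>l\<in>L. (\<Sum>j\<in>J. a j * v j l) = u l")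
    case True
    then obtain a where a: "\<forall>l\<in>L. (\<Sum>j\<in>J. a j * v j l) = u l" by blast
    have "\<forall>l\<in>L. (\<Sum>j\<in>insert i J. (a(i := 0)) j * v j l) = u l"
    proof
      fix l assume "l \<in> L"
      have "(\<Sum>j\<in>J. (a(i := 0)) j * v j l) = (\<Sum>j\<in>J. a j * v j l)"
        using insert by (intro sum.cong) auto
      then show "(\<Sum>j\<in>insert i J. (a(i := 0)) j * v j l) = u l"
        using insert a \<open>l \<in> L\<close> by simp
    qed
    then show ?thesis by blast
  next
    case False
    with insert.IH[of u] obtain g where g: "\<forall>j\<in>J. ?p g (v j) = 0" "?p g u \<noteq> 0" by blast
    show ?thesis
    proof (cases "?p g (v i) = 0")
      case True
      with g show ?thesis by (intro disjI2 exI[of _ g]) auto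
    next
      case gi: False
      define c where "c = ?p g u / ?p g (v i)"
      consider a where "\<forall>l\<in>L. (\<Sum>j\<in>J. a j * v j l) = u l - c * v i l"
        | h where "\<forall>j\<in>J. ?p h (v j) = 0" "?p h (\<lambda>l. u l - c * v i l) \<noteq> 0"
        using insert.IH[of "\<lambda>l. u l - c * v i l"] by blast
      then show ?thesis
      proof cases
        case 1
        have "\<forall>l\<in>L. (\<Sum>j\<in>insert i J. (a(i := c)) j * v j l) = u l"
        proof
          fix l assume "l \<in> L"
          have "(\<Sum>j\<in>J. (a(i := c)) j * v j l) = (\<Sum>j\<in>J. a j * v j l)"
            using insert by (intro sum.cong) auto
          then show "(\<Sum>j\<in>insert i J. (a(i := c)) j * v j l) = u l"
            using insert 1 \<open>l \<in> L\<close> by simp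
        qed
        then show ?thesis by blast
      next
        case 2
        define b where "b = ?p h (v i) / ?p g (v i)"
        have lin: "?p (\<lambda>l. h l - b * g l) w = ?p h w - b * ?p g w" for w
          by (simp add: algebra_simps sum_subtractf sum_distrib_left)
        have lin2: "?p h (\<lambda>l. u l - c * v i l) = ?p h u - c * ?p h (v i)"
          by (simp add: algebra_simps sum_subtractf sum_distrib_left)
        have "?p (\<lambda>l. h l - b * g l) (v i) = 0" using gi lin by (simp add: b_def)
        moreover have "?p (\<lambda>l. h l - b * g l) u = ?p h (\<lambda>l. u l - c * v i l)"
          unfolding lin lin2 by (simp add: b_def c_def)
        ultimately show ?thesis using 2 g lin
          by (intro disjI2 exI[of _ "\<lambda>l. h l - b * g l"]) auto
      qed
    qed
  qed
qed

text \<open>This converts the absence of a vanishing order \<open>m\<close> into the tail \<open>g\<close> of a Laurent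
series with leading index exactly \<open>m\<close>: the alternative is applied to the truncations after degree
\<open>m\<close> and to the unit vector in degree \<open>m\<close>.\<close>

lemma vanishing_order_or_annihilator:
  assumes "finite J" "m \<notin> vanishing_orders J v"
  obtains g where "\<forall>j\<in>J. (\<Sum>l\<le>m. g l * v j $ l) = 0" "g m \<noteq> 0"
proof -
  define u :: "nat \<Rightarrow> complex" where "u l = (if l = m then 1 else 0)" for l
  have "\<not> (\<exists>a. \<forall>l\<in>{..m}. (\<Sum>j\<in>J. a j * v j $ l) = u l)"
  proof
    assume "\<exists>a. \<forall>l\<in>{..m}. (\<Sum>j\<in>J. a j * v j $ l) = u l"
    then obtain a where a: "\<And>l. l \<le> m \<Longrightarrow> lincomb J v a $ l = u l" by (auto simp: lincomb_nth)
    \<comment> \<open>a solution would have order exactly \<open>m\<close>\<close>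
    have "subdegree (lincomb J v a) = m"
      by (rule subdegreeI) (auto simp: a u_def)
    moreover have "lincomb J v a \<noteq> 0" using a[of m] by (auto simp: u_def)
    ultimately show False using assms(2) by (auto simp: vanishing_orders_def)
  qed
  with solvable_or_annihilated[of J "{..m}" "\<lambda>j l. v j $ l" u] assms(1)
  obtain g where g: "\<forall>j\<in>J. (\<Sum>l\<le>m. g l * v j $ l) = 0" "(\<Sum>l\<le>m. g l * u l) \<noteq> 0" by auto
  have "(\<Sum>l\<le>m. g l * u l) = g m" by (simp add: u_def if_distrib[of "\<lambda>x. _ * x"] cong: if_cong)
  with g show ?thesis using that by auto
qed

text \<open>Independence of the rows of a matrix is an open condition. Pivoting on a nonzero entry replaces the
minors of maximal size by an induction on the number of rows.\<close>

lemma eventually_rows_independent: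
  fixes v :: "'x \<Rightarrow> 'j \<Rightarrow> 'l \<Rightarrow> complex"
  assumes "finite J" "finite L"
    and lim: "\<And>j l. j \<in> J \<Longrightarrow> l \<in> L \<Longrightarrow> ((\<lambda>x. v x j l) \<longlongrightarrow> w j l) F"
    and w: "\<And>a. (\<forall>l\<in>L. (\<Sum>j\<in>J. a j * w j l) = 0) \<Longrightarrow> \<forall>j\<in>J. a j = 0"
  shows "eventually (\<lambda>x. \<forall>a. (\<forall>l\<in>L. (\<Sum>j\<in>J. a j * v x j l) = 0) \<longrightarrow> (\<forall>j\<in>J. a j = 0)) F"
  using assms(1,3,4)
proof (induction J arbitrary: v w rule: finite_induct)
  case empty
  then show ?case by simp
next
  case (insert i J)
  have "\<exists>l0\<in>L. w i l0 \<noteq> 0"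
  proof (rule ccontr)
    assume H: "\<not> (\<exists>l0\<in>L. w i l0 \<noteq> 0)"
    have "(\<Sum>j\<in>insert i J. (if j = i then 1 else 0) * w j l) = 0" if "l \<in> L" for l
      using H that by (intro sum.neutral) auto
    with insert.prems(2)[of "\<lambda>j. if j = i then 1 else 0"] show False by auto
  qed
  then obtain l0 where l0: "l0 \<in> L" "w i l0 \<noteq> 0" by blast
  define red where "red V j l = V j l - V j l0 / V i l0 * (V i l :: complex)" for V :: "'j \<Rightarrow> 'l \<Rightarrow> complex" and j l
  have ev0: "eventually (\<lambda>x. v x i l0 \<noteq> 0) F"
    using tendsto_imp_eventually_ne insert.prems(1)[of i l0] l0 by simp
  have key: "(\<Sum>j\<in>insert i J. a j * V j l) = (\<Sum>j\<in>J. a j * red V j l) + (\<Sum>j\<in>insert i J. a j * V j l0) / V i l0 * V i l"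
    if "V i l0 \<noteq> 0" for a V l
  proof -
    have "(\<Sum>j\<in>J. a j * V j l) = (\<Sum>j\<in>J. a j * red V j l) + (\<Sum>j\<in>J. a j * V j l0) / V i l0 * V i l"
      by (simp add: red_def sum.distrib[symmetric] sum_distrib_right sum_divide_distrib right_diff_distrib)
    then show ?thesis using insert that by (simp add: algebra_simps add_divide_distrib)
  qed
  have "eventually (\<lambda>x. \<forall>a. (\<forall>l\<in>L. (\<Sum>j\<in>J. a j * red (v x) j l) = 0) \<longrightarrow> (\<forall>j\<in>J. a j = 0)) F"
  proof (rule insert.IH)
    show "((\<lambda>x. red (v x) j l) \<longlongrightarrow> red w j l) F" if "j \<in> J" "l \<in> L" for j l
      unfolding red_def using that l0 by (intro tendsto_intros insert.prems) auto
    fix a assume a: "\<forall>l\<in>L. (\<Sum>j\<in>J. a j * red w j l) = 0"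
    define a' where "a' = a(i := - (\<Sum>j\<in>J. a j * w j l0) / w i l0)"
    have eq: "(\<Sum>j\<in>J. a' j * q j) = (\<Sum>j\<in>J. a j * q j)" for q
      using insert by (intro sum.cong) (auto simp: a'_def)
    have "(\<Sum>j\<in>insert i J. a' j * w j l0) = 0"
      using insert l0 eq by (simp add: a'_def)
    then have "(\<Sum>j\<in>insert i J. a' j * w j l) = 0" if "l \<in> L" for l
      unfolding key[where V=w and a=a' and l=l, OF l0(2)] eq[of "\<lambda>j. red w j l"] using a that by simp
    with insert.prems(2)[of a'] have "\<forall>j\<in>insert i J. a' j = 0" by blast
    then show "\<forall>j\<in>J. a j = 0" using insert.hyps by (auto simp: a'_def split: if_splits)
  qed
  with ev0 show ?case
  proof eventually_elim
    case (elim x)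
    show ?case
    proof (intro allI impI)
      fix a assume a: "\<forall>l\<in>L. (\<Sum>j\<in>insert i J. a j * v x j l) = 0"
      have nz: "v x i l0 \<noteq> 0" using elim by blast
      have "(\<Sum>j\<in>J. a j * red (v x) j l) = 0" if "l \<in> L" for l
      proof -
        have z: "(\<Sum>j\<in>insert i J. a j * v x j l) = 0" "(\<Sum>j\<in>insert i J. a j * v x j l0) = 0"
          using a that l0(1) by blast+
        show ?thesis
          using key[where V="v x" and a=a and l=l, OF nz] unfolding z by (simp only: div_0 mult_zero_left add_0_right)
      qed
      with elim have J0: "\<forall>j\<in>J. a j = 0" by blast
      have "(\<Sum>j\<in>insert i J. a j * v x j l0) = 0" using a l0 by blast
      moreover have "(\<Sum>j\<in>J. a j * v x j l0) = 0"
        using J0 by (intro sum.neutral) simp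
      ultimately have "a i * v x i l0 = 0" by (simp add: insert.hyps)
      with nz have "a i = 0" by simp
      with J0 show "\<forall>j\<in>insert i J. a j = 0" by blast
    qed
  qed
qed

lemma eventually_uninflected:
  assumes "finite J" "uninflected J w"
    and "\<And>j l. j \<in> J \<Longrightarrow> ((\<lambda>x. v x j $ l) \<longlongrightarrow> w j $ l) F"
  shows "eventually (\<lambda>x. uninflected J (v x)) F"
proof -
  have "eventually (\<lambda>x. \<forall>a. (\<forall>l\<in>{..<card J}. (\<Sum>j\<in>J. a j * v x j $ l) = 0) \<longrightarrow> (\<forall>j\<in>J. a j = 0)) F"
  proof (rule eventually_rows_independent)
    fix a assume "\<forall>l\<in>{..<card J}. (\<Sum>j\<in>J. a j * w j $ l) = 0"
    then show "\<forall>j\<in>J. a j = 0"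
      using assms(2)[unfolded uninflected_def lincomb_nth] unfolding Ball_def lessThan_iff by blast
  qed (use assms in simp_all)
  then show ?thesis by (simp only: uninflected_def lincomb_nth Ball_def lessThan_iff)
qed

section \<open>Independence of radicals\<close>

text \<open>Exponents \<open>e\<close> of monomials \<open>y ^ e\<close> of the residue class \<open>r\<close>, that is, the characters of the deck group
whose restriction to the stabilizer of \<open>p\<close> is the \<open>r\<close>-th power.\<close>

definition residue_exps :: "nat \<Rightarrow> nat set \<Rightarrow> nat \<Rightarrow> (nat \<Rightarrow> nat) set" where
  "residue_exps k I r = {e \<in> I \<rightarrow>\<^sub>E {..<k}. (\<Sum>i\<in>I. e i) mod k = r mod k}"

text \<open>The number of \<open>i\<close> with \<open>r + k i < \<Sum> e\<close>. The truncated difference matters for \<open>r = k\<close>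
and \<open>e = 0\<close>, where the value is \<open>0\<close>.\<close>

definition num_powers :: "nat \<Rightarrow> nat set \<Rightarrow> nat \<Rightarrow> (nat \<Rightarrow> nat) \<Rightarrow> nat" where
  "num_powers k I r e = ((\<Sum>i\<in>I. e i) - r) div k"

definition diff_index :: "nat \<Rightarrow> nat set \<Rightarrow> nat \<Rightarrow> ((nat \<Rightarrow> nat) \<times> nat) set" where
  "diff_index k I r = (SIGMA e : residue_exps k I r. {..<num_powers k I r e})"

definition radical_fps :: "nat \<Rightarrow> nat set \<Rightarrow> (nat \<Rightarrow> complex) \<Rightarrow> (nat \<Rightarrow> nat) \<Rightarrow> complex fps" where
  "radical_fps k I c e =
     (\<Prod>i\<in>I. fps_binomial (- (of_nat (e i) / of_nat k)) oo (fps_const (- c i) * fps_X))"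

text \<open>Apart from a common factor, these are the expansions at \<open>p\<close> of a basis of the holomorphic
differentials.\<close>

definition diff_fps :: "nat \<Rightarrow> nat set \<Rightarrow> (nat \<Rightarrow> complex) \<Rightarrow> (nat \<Rightarrow> nat) \<times> nat \<Rightarrow> complex fps" where
  "diff_fps k I c = (\<lambda>(e, i). fps_X ^ i * radical_fps k I c e)"

lemma finite_residue_exps: "finite I \<Longrightarrow> finite (residue_exps k I r)"
  unfolding residue_exps_def by (rule finite_subset[OF _ finite_PiE[of I "\<lambda>_. {..<k}"]]) auto

lemma finite_diff_index: "finite I \<Longrightarrow> finite (diff_index k I r)"
  unfolding diff_index_def by (intro finite_SigmaI finite_residue_exps) auto

lemma lincomb_diff_fps:
  assumes "finite I"
  shows "lincomb (diff_index k I r) (diff_fps k I c) a =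
    (\<Sum>e\<in>residue_exps k I r.
       fps_of_poly (\<Sum>i<num_powers k I r e. monom (a (e, i)) i) * radical_fps k I c e)"
proof -
  have "lincomb (diff_index k I r) (diff_fps k I c) a =
    (\<Sum>e\<in>residue_exps k I r. \<Sum>i<num_powers k I r e. fps_const (a (e, i)) * (fps_X ^ i * radical_fps k I c e))"
    unfolding lincomb_def diff_index_def diff_fps_def
    by (subst sum.Sigma) (auto simp: finite_residue_exps assms intro!: sum.cong)
  also have "\<dots> = (\<Sum>e\<in>residue_exps k I r.
       fps_of_poly (\<Sum>i<num_powers k I r e. monom (a (e, i)) i) * radical_fps k I c e)"
    by (intro sum.cong refl) (simp add: fps_of_poly_sum fps_of_poly_monom sum_distrib_right mult.assoc)
  finally show ?thesis .
qed

text \<open>The \<open>k\<close>-th power of \<open>radical_fps k I c e\<close> is the inverse of this polynomial.\<close>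

definition root_poly :: "nat set \<Rightarrow> (nat \<Rightarrow> complex) \<Rightarrow> (nat \<Rightarrow> nat) \<Rightarrow> complex poly" where
  "root_poly I c e = (\<Prod>i\<in>I. [:1, - c i:] ^ e i)"

lemma radical_fps_power:
  assumes "k > 0"
  shows "radical_fps k I c e ^ k * fps_of_poly (root_poly I c e) = 1"
proof -
  have *: "(fps_binomial (- (of_nat (e i) / of_nat k)) oo (fps_const (- c i) * fps_X)) ^ k * fps_of_poly ([:1, - c i:] ^ e i) = 1" for i
  proof -
    have c0: "(fps_const (- c i) * fps_X) $ 0 = 0" by simp
    have p: "fps_of_poly ([:1, - c i:] ^ e i) = fps_binomial (of_nat (e i)) oo (fps_const (- c i) * fps_X)"
      unfolding fps_of_poly_power fps_of_poly_linear' fps_binomial_of_nat fps_compose_power[OF c0, symmetric]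
      by (simp add: fps_compose_add_distrib)
    show ?thesis
      unfolding p fps_compose_power[OF c0] fps_compose_mult_distrib[OF c0, symmetric] fps_binomial_power
        fps_binomial_add_mult[symmetric]
      using assms by simp
  qed
  show ?thesis
    unfolding radical_fps_def root_poly_def fps_of_poly_prod prod_power_distrib prod.distrib[symmetric]
    using * by simp
qed

lemma radical_fps_nth_0: "radical_fps k I c e $ 0 = 1"
  unfolding radical_fps_def by (induction I rule: infinite_finite_induct) auto

lemma fps_mult_nth_lowest:
  fixes f g :: "'a :: comm_ring_1 fps"
  assumes "\<And>i. i < s \<Longrightarrow> f $ i = 0" "\<And>i. i < d \<Longrightarrow> g $ i = 0"
  shows "(f * g) $ (s + d) = f $ s * g $ d"
proof -
  have "(f * g) $ (s + d) = (\<Sum>i=0..s + d. f $ i * g $ (s + d - i))" by (simp add: fps_mult_nth)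
  also have "\<dots> = (\<Sum>i\<in>{s}. f $ i * g $ (s + d - i))"
  proof (intro sum.mono_neutral_right ballI)
    fix i assume i: "i \<in> {0..s + d} - {s}"
    show "f $ i * g $ (s + d - i) = 0"
    proof (cases "i < s")
      case False
      then have "s + d - i < d" using i by auto
      then show ?thesis using assms(2) by simp
    qed (simp add: assms(1))
  qed auto
  finally show ?thesis by simp
qed

text \<open>Subtracting a multiple of \<open>g\<close> one may assume that \<open>f\<close> has no coefficient at the order of \<open>g\<close>; but
comparing lowest coefficients shows that a nonzero \<open>f\<close> would have the same order as \<open>g\<close>.\<close>

lemma wronskian_zero_imp_proportional:
  fixes f g :: "complex fps"
  assumes "g \<noteq> 0" and w: "fps_deriv f * g = f * fps_deriv g"
  shows "\<exists>c. f = fps_const c * g"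
proof -
  define d where "d = subdegree g"
  have gd: "g $ d \<noteq> 0" using assms by (simp add: d_def)
  define u where "u = f - fps_const (f $ d / g $ d) * g"
  have ud: "u $ d = 0" using gd by (simp add: u_def)
  have wu: "fps_deriv u * g = u * fps_deriv g" using w by (simp add: u_def algebra_simps)
  have "u = 0"
  proof (rule ccontr)
    assume u: "u \<noteq> 0"
    define s where "s = subdegree u"
    have us: "u $ s \<noteq> 0" using u by (simp add: s_def)
    have X: "(fps_X * fps_deriv h) $ i = of_nat i * h $ i" for h :: "complex fps" and i
      by (cases i) auto
    have low: "i < s \<Longrightarrow> u $ i = 0" "i < d \<Longrightarrow> g $ i = 0" for i
      unfolding s_def d_def by (rule nth_less_subdegree_zero; assumption)+
    have "((fps_X * fps_deriv u) * g) $ (s + d) = of_nat s * u $ s * g $ d"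
      by (subst fps_mult_nth_lowest) (simp_all only: X low, simp_all)
    moreover have "(u * (fps_X * fps_deriv g)) $ (s + d) = u $ s * (of_nat d * g $ d)"
      by (subst fps_mult_nth_lowest) (simp_all only: X low, simp_all)
    moreover have "(fps_X * fps_deriv u) * g = u * (fps_X * fps_deriv g)"
      using wu by (simp add: mult_ac)
    ultimately have "of_nat s * u $ s * g $ d = u $ s * (of_nat d * g $ d)" by metis
    then have "(of_nat s :: complex) = of_nat d" using us gd by simp
    then have "s = d" by simp
    with us ud show False by simp
  qed
  then show ?thesis unfolding u_def by auto
qed

lemma order_root_poly:
  assumes "finite I" "i \<in> I" "inj_on c I" "c i \<noteq> 0"
  shows "Polynomial.order (1 / c i) (root_poly I c e) = e i" and "root_poly I c e \<noteq> 0"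
proof -
  define Q where "Q = (\<Prod>l\<in>I - {i}. [:1, - c l:] ^ e l)"
  have split: "root_poly I c e = smult ((- c i) ^ e i) ([:- (1 / c i), 1:] ^ e i * Q)"
  proof -
    have "[:1, - c i:] = smult (- c i) [:- (1 / c i), 1:]" using assms by simp
    then have "[:1, - c i:] ^ e i = smult ((- c i) ^ e i) ([:- (1 / c i), 1:] ^ e i)"
      by (simp only: smult_power)
    then show ?thesis unfolding root_poly_def Q_def
      unfolding prod.remove[OF assms(1,2)] by simp
  qed
  have nz: "poly Q (1 / c i) \<noteq> 0"
    using assms by (auto simp: Q_def poly_prod inj_on_def field_simps)
  then have "Q \<noteq> 0" by auto
  then have nz2: "[:- (1 / c i), 1:] ^ e i * Q \<noteq> 0" by simp
  then show "root_poly I c e \<noteq> 0" unfolding split using assms by simp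
  show "Polynomial.order (1 / c i) (root_poly I c e) = e i"
    unfolding split using assms nz2 by (simp add: order_smult order_mult order_power_n_n order_0I[OF nz])
qed

text \<open>At most one \<open>c i\<close> is zero. That radicand is invisible in \<open>radical_fps\<close>, but its exponent is
determined by the others because the residue class of the sum is fixed.\<close>

lemma residue_exps_eqI:
  assumes I: "finite I" "inj_on c I" and e: "e \<in> residue_exps k I r" "e' \<in> residue_exps k I r"
    and eq: "\<And>i. i \<in> I \<Longrightarrow> c i \<noteq> 0 \<Longrightarrow> e i = e' i"
  shows "e = e'"
proof (rule PiE_ext)
  show "e \<in> I \<rightarrow>\<^sub>E {..<k}" "e' \<in> I \<rightarrow>\<^sub>E {..<k}" using e by (auto simp: residue_exps_def)
  fix i assume i: "i \<in> I"
  show "e i = e' i"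
  proof (cases "c i = 0")
    case True
    have rest: "(\<Sum>l\<in>I-{i}. e l) = (\<Sum>l\<in>I-{i}. e' l)"
      using I i True by (intro sum.cong eq) (auto simp: inj_on_def)
    have "(e i + (\<Sum>l\<in>I-{i}. e l)) mod k = (e' i + (\<Sum>l\<in>I-{i}. e l)) mod k"
      using e I i unfolding residue_exps_def rest by (simp add: sum.remove[of I i, symmetric])
         (metis (no_types, lifting) rest sum.remove)
    then have "[e i = e' i] (mod k)" by (simp only: cong_def[symmetric] cong_add_rcancel_nat)
    moreover have "e i < k" "e' i < k" using e i by (auto simp: residue_exps_def)
    ultimately show ?thesis by (simp add: cong_def)
  qed (use eq i in auto)
qed

text \<open>Each \<open>R\<^sub>e\<close> satisfies a differential equation \<open>D R\<^sub>e' = q\<^sub>e R\<^sub>e\<close> with a polynomial \<open>D\<close> that does not depend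
on \<open>e\<close>. Differentiating a relation and eliminating the term of \<open>e0\<close> gives a shorter one. Its
triviality says that the Wronskian of \<open>p\<^sub>e R\<^sub>e\<close> and \<open>p\<^sub>e\<^sub>0 R\<^sub>e\<^sub>0\<close> vanishes, so that both are
proportional. Comparing the multiplicity of the root \<open>1 / c\<^sub>i\<close> in their \<open>k\<close>-th powers gives
\<open>e i = e0 i\<close> modulo \<open>k\<close>.\<close>

lemma radicals_independent:
  assumes k: "k > 0" and I: "finite I" "inj_on c I"
    and S: "finite S" "S \<subseteq> residue_exps k I r"
    and rel: "(\<Sum>e\<in>S. fps_of_poly (p e) * radical_fps k I c e) = 0"
  shows "\<forall>e\<in>S. p e = 0"
  using S rel
proof (induction S arbitrary: p rule: finite_induct)
  case empty
  then show ?case by simp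
next
  case (insert e0 S)
  let ?R = "radical_fps k I c"
  define P where "P = root_poly I c"
  define N where "N e = root_poly I c (\<lambda>i. k - e i)" for e
  define D where "D = root_poly I c (\<lambda>_. k)"
  define q where "q e = smult (- 1 / of_nat k) (pderiv (P e) * N e)" for e
  have Rnz: "?R e \<noteq> 0" for e using radical_fps_nth_0[of k I c e] by auto
  have Rk: "?R e ^ k * fps_of_poly (P e) = 1" for e
    unfolding P_def by (rule radical_fps_power[OF k])
  have PN: "P e * N e = D" if "e \<in> residue_exps k I r" for e
    unfolding P_def N_def D_def root_poly_def prod.distrib[symmetric] power_add[symmetric]
    using that by (intro prod.cong refl) (auto simp: residue_exps_def PiE_def Pi_def less_imp_le)
  have DR: "fps_of_poly D * fps_deriv (?R e) = fps_of_poly (q e) * ?R e" if e: "e \<in> residue_exps k I r" for e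
  proof -
    obtain k' where k': "k = Suc k'" using k by (cases k) auto
    have dR: "fps_deriv (?R e ^ k) = of_nat k * fps_deriv (?R e) * ?R e ^ k'"
      by (simp only: fps_deriv_power' k' diff_Suc_1)
    have "fps_deriv (?R e ^ k * fps_of_poly (P e)) = 0" by (simp add: Rk)
    then have "?R e ^ k * fps_of_poly (pderiv (P e)) + of_nat k * fps_deriv (?R e) * ?R e ^ k' * fps_of_poly (P e) = 0"
      by (simp only: fps_deriv_mult dR fps_of_poly_pderiv)
    moreover have "?R e ^ k = ?R e * ?R e ^ k'" by (simp add: k')
    ultimately have "?R e ^ k' * (of_nat k * fps_deriv (?R e) * fps_of_poly (P e) + ?R e * fps_of_poly (pderiv (P e))) = 0"
      by (simp only: algebra_simps)
    then have "of_nat k * fps_deriv (?R e) * fps_of_poly (P e) = - (?R e * fps_of_poly (pderiv (P e)))"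
      using Rnz by (simp add: eq_neg_iff_add_eq_0)
    then have A: "fps_const (of_nat k) * fps_deriv (?R e) * fps_of_poly (P e) = - (?R e * fps_of_poly (pderiv (P e)))"
      by (simp only: fps_of_nat)
    have kk: "fps_const (of_nat k) * fps_const (- 1 / of_nat k) = (- 1 :: complex fps)"
      using k by (simp add: fps_const_mult fps_const_neg[symmetric] del: fps_const_neg)
    have "fps_const (of_nat k) * (fps_of_poly D * fps_deriv (?R e)) =
        (fps_const (of_nat k) * fps_deriv (?R e) * fps_of_poly (P e)) * fps_of_poly (N e)"
      unfolding PN[OF e, symmetric] fps_of_poly_mult by (simp only: mult_ac)
    also have "\<dots> = (- 1) * (fps_of_poly (pderiv (P e)) * fps_of_poly (N e) * ?R e)"
      unfolding A by simp
    also have "\<dots> = fps_const (of_nat k) * (fps_of_poly (q e) * ?R e)"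
      unfolding q_def fps_of_poly_smult fps_of_poly_mult kk[symmetric] by (simp only: mult_ac)
    finally show ?thesis using k by simp
  qed
  have Dnz: "fps_of_poly D \<noteq> 0"
    unfolding D_def root_poly_def fps_of_poly_prod using I by (simp add: fps_of_poly_power)
  have e0: "e0 \<in> residue_exps k I r" and S: "S \<subseteq> residue_exps k I r" using insert.prems by auto
  define f where "f e = fps_of_poly (p e) * ?R e" for e
  define h where "h e = D * pderiv (p e) + p e * q e" for e
  have Df: "fps_of_poly D * fps_deriv (f e) = fps_of_poly (h e) * ?R e" if "e \<in> residue_exps k I r" for e
  proof -
    have "fps_of_poly D * fps_deriv (f e) = fps_of_poly D * fps_of_poly (pderiv (p e)) * ?R e +
        fps_of_poly (p e) * (fps_of_poly D * fps_deriv (?R e))"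
      by (simp add: f_def fps_of_poly_pderiv algebra_simps)
    then show ?thesis unfolding DR[OF that] h_def by (simp add: fps_of_poly_mult fps_of_poly_add algebra_simps)
  qed
  have sum0: "(\<Sum>e\<in>insert e0 S. f e) = 0" using insert.prems by (simp add: f_def)
  have sum1: "(\<Sum>e\<in>insert e0 S. fps_of_poly (h e) * ?R e) = 0"
  proof -
    have "fps_of_poly D * fps_deriv (\<Sum>e\<in>insert e0 S. f e) = (\<Sum>e\<in>insert e0 S. fps_of_poly (h e) * ?R e)"
      unfolding fps_deriv_sum sum_distrib_left by (intro sum.cong refl Df) (use e0 S in auto)
    then show ?thesis unfolding sum0 by simp
  qed
  show ?case
  proof (cases "p e0 = 0")
    case True
    with insert sum0 S show ?thesis by (simp add: f_def)
  next
    case p0: False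
    define w where "w e = p e0 * h e - h e0 * p e" for e
    have "(\<Sum>e\<in>S. fps_of_poly (w e) * ?R e) = 0"
    proof -
      have "(\<Sum>e\<in>insert e0 S. fps_of_poly (w e) * ?R e) =
        fps_of_poly (p e0) * (\<Sum>e\<in>insert e0 S. fps_of_poly (h e) * ?R e) - fps_of_poly (h e0) * (\<Sum>e\<in>insert e0 S. f e)"
        unfolding sum_distrib_left sum_subtractf[symmetric]
        by (intro sum.cong refl) (simp add: w_def f_def fps_of_poly_mult fps_of_poly_diff algebra_simps)
      also have "\<dots> = 0" unfolding sum0 sum1 by simp
      finally show ?thesis using insert.hyps by (simp add: w_def mult.commute)
    qed
    then have w0: "\<forall>e\<in>S. w e = 0" by (rule insert.IH[OF S])
    have "\<forall>e\<in>S. p e = 0"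
    proof (rule ccontr)
      assume "\<not> (\<forall>e\<in>S. p e = 0)"
      then obtain e where e: "e \<in> S" "p e \<noteq> 0" by blast
      have er: "e \<in> residue_exps k I r" using S e by blast
      have fnz: "f e0 \<noteq> 0" "f e \<noteq> 0" using p0 e Rnz by (simp_all add: f_def)
      have "fps_of_poly D * (fps_deriv (f e) * f e0 - f e * fps_deriv (f e0)) = fps_of_poly (w e) * ?R e * ?R e0"
      proof -
        have "fps_of_poly D * (fps_deriv (f e) * f e0 - f e * fps_deriv (f e0)) =
          (fps_of_poly D * fps_deriv (f e)) * f e0 - f e * (fps_of_poly D * fps_deriv (f e0))"
          by (simp add: algebra_simps)
        also have "\<dots> = fps_of_poly (w e) * ?R e * ?R e0"
          unfolding Df[OF er] Df[OF e0] unfolding w_def f_def fps_of_poly_mult fps_of_poly_diff by (simp add: algebra_simps)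
        finally show ?thesis .
      qed
      moreover have "w e = 0" using w0 e(1) by blast
      ultimately have "fps_deriv (f e) * f e0 = f e * fps_deriv (f e0)" using Dnz by simp
      from wronskian_zero_imp_proportional[OF fnz(1) this] obtain \<kappa> where \<kappa>: "f e = fps_const \<kappa> * f e0" by blast
      have \<kappa>0: "\<kappa> \<noteq> 0" using \<kappa> fnz by auto
      have fk: "f x ^ k * fps_of_poly (P x) = fps_of_poly (p x ^ k)" for x
        using Rk[of x] by (simp add: f_def power_mult_distrib fps_of_poly_power mult.assoc)
      have "fps_of_poly (p e ^ k * P e0) = (f e ^ k * fps_of_poly (P e)) * fps_of_poly (P e0)"
        unfolding fk fps_of_poly_mult ..
      also have "\<dots> = fps_const \<kappa> ^ k * (f e0 ^ k * fps_of_poly (P e0)) * fps_of_poly (P e)"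
        unfolding \<kappa> by (simp add: power_mult_distrib mult_ac)
      also have "\<dots> = fps_of_poly (smult (\<kappa> ^ k) (p e0 ^ k * P e))"
        unfolding fk fps_of_poly_smult fps_of_poly_mult fps_const_power by (simp add: mult_ac)
      finally have poly_eq: "p e ^ k * P e0 = smult (\<kappa> ^ k) (p e0 ^ k * P e)"
        by (simp only: fps_of_poly_eq_iff)
      have "e = e0"
      proof (rule residue_exps_eqI[OF I er e0])
        fix i assume i: "i \<in> I" "c i \<noteq> 0"
        note op = order_root_poly[OF I(1) i(1) I(2) i(2), folded P_def]
        have opow: "Polynomial.order (1 / c i) (x ^ m) = m * Polynomial.order (1 / c i) x" if "x \<noteq> 0" for x :: "complex poly" and m
          using that by (induction m) (simp_all add: order_mult)
        have "Polynomial.order (1 / c i) (p e ^ k * P e0) = k * Polynomial.order (1 / c i) (p e) + e0 i"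
          using op e by (simp add: order_mult opow)
        moreover have "Polynomial.order (1 / c i) (smult (\<kappa> ^ k) (p e0 ^ k * P e)) = k * Polynomial.order (1 / c i) (p e0) + e i"
          using op p0 \<kappa>0 by (simp add: order_smult order_mult opow)
        ultimately have "k * Polynomial.order (1 / c i) (p e) + e0 i = k * Polynomial.order (1 / c i) (p e0) + e i"
          using poly_eq by simp
        then have "(k * Polynomial.order (1 / c i) (p e) + e0 i) mod k = (k * Polynomial.order (1 / c i) (p e0) + e i) mod k" by simp
        moreover have "e i < k" "e0 i < k" using er e0 i by (auto simp: residue_exps_def)
        ultimately show "e i = e0 i" by simp
      qed
      with e insert.hyps show False by simp
    qed
    then have "(\<Sum>e\<in>S. f e) = 0" by (intro sum.neutral) (auto simp: f_def)
    then have "f e0 = 0" using sum0 by (simp add: insert.hyps)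
    then show ?thesis using p0 Rnz by (simp add: f_def)
  qed
qed

lemma coeff_sum_monom: "coeff (\<Sum>i<m. monom (a i) i) l = (if l < m then a l else 0)"
  by (simp add: coeff_sum)

lemma lin_indep_diff_fps:
  assumes "k > 0" "finite I" "inj_on c I"
  shows "lin_indep (diff_index k I r) (diff_fps k I c)"
  unfolding lin_indep_def
proof (intro allI impI)
  fix a assume "lincomb (diff_index k I r) (diff_fps k I c) a = 0"
  then have 0: "\<forall>e\<in>residue_exps k I r. (\<Sum>i<num_powers k I r e. monom (a (e, i)) i) = 0"
    unfolding lincomb_diff_fps[OF assms(2)]
    by (rule radicals_independent[OF assms finite_residue_exps[OF assms(2)] order_refl])
  show "\<forall>j\<in>diff_index k I r. a j = 0"
  proof
    fix j assume "j \<in> diff_index k I r"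
    then obtain e i where j: "j = (e, i)" "e \<in> residue_exps k I r" "i < num_powers k I r e"
      by (auto simp: diff_index_def)
    have "coeff (\<Sum>i<num_powers k I r e. monom (a (e, i)) i) i = 0" using 0 j by simp
    then show "a j = 0" unfolding coeff_sum_monom using j by simp
  qed
qed

section \<open>Points without inflection\<close>

text \<open>The Wronskian of independent holomorphic functions does not vanish identically. Instead of expanding
the determinant, one divides by a function \<open>F i\<close> on a disc where it has no zero and differentiates: the
derivatives of the remaining quotients are independent, and a combination that vanishes to order
\<open>m + 1\<close> turns into one that vanishes to order \<open>m\<close>.\<close>

lemma exists_uninflected_point:
  fixes F :: "'j \<Rightarrow> complex \<Rightarrow> complex"
  assumes "finite J" "open D" "connected D" "D \<noteq> {}"
    and "\<And>j. j \<in> J \<Longrightarrow> F j holomorphic_on D"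
    and "\<And>a. (\<forall>s\<in>D. (\<Sum>j\<in>J. a j * F j s) = 0) \<Longrightarrow> \<forall>j\<in>J. a j = 0"
  shows "\<exists>s0\<in>D. \<forall>a \<Phi>. (\<lambda>x. \<Sum>j\<in>J. a j * F j (s0 + x)) has_fps_expansion \<Phi> \<longrightarrow>
           (\<forall>l<card J. \<Phi> $ l = 0) \<longrightarrow> (\<forall>j\<in>J. a j = 0)"
  using assms
proof (induction J arbitrary: F D rule: finite_induct)
  case empty
  then show ?case by auto
next
  case (insert i J)
  note hol = insert.prems(4)
  have "\<exists>s1\<in>D. F i s1 \<noteq> 0"
  proof (rule ccontr)
    assume H: "\<not> (\<exists>s1\<in>D. F i s1 \<noteq> 0)"
    have "(\<Sum>j\<in>insert i J. (if j = i then 1 else 0) * F j s) = 0" if "s \<in> D" for s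
      using H that by (intro sum.neutral) auto
    with insert.prems(5)[of "\<lambda>j. if j = i then 1 else 0"] show False by auto
  qed
  then obtain s1 where s1: "s1 \<in> D" "F i s1 \<noteq> 0" by blast
  have "open (D \<inter> F i -` (- {0}))"
    using insert.prems(1) holomorphic_on_imp_continuous_on[OF hol[of i]]
    by (intro continuous_open_preimage) auto
  then obtain \<epsilon> where \<epsilon>: "\<epsilon> > 0" "ball s1 \<epsilon> \<subseteq> D \<inter> F i -` (- {0})"
    using s1 open_contains_ball by (metis ComplI IntI singletonD vimageI)
  define B where "B = ball s1 \<epsilon>"
  have B: "open B" "connected B" "B \<noteq> {}" "B \<subseteq> D" "\<And>s. s \<in> B \<Longrightarrow> F i s \<noteq> 0"
    using \<epsilon> by (auto simp: B_def)
  have holB: "F j holomorphic_on B" if "j \<in> insert i J" for j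
    using hol[OF that] B(4) holomorphic_on_subset by blast
  have holQ: "(\<lambda>s. F j s / F i s) holomorphic_on B" if "j \<in> insert i J" for j
    using holB that B(5) by (intro holomorphic_intros) auto
  define G where "G j = deriv (\<lambda>s. F j s / F i s)" for j
  have dQ: "((\<lambda>s. \<Sum>j\<in>insert i J. a j * (F j s / F i s)) has_field_derivative (\<Sum>j\<in>J. a j * G j s)) (at s)"
    if s: "s \<in> B" for a s
  proof -
    have "((\<lambda>s. F j s / F i s) has_field_derivative G j s) (at s)" if "j \<in> insert i J" for j
      unfolding G_def using holQ[OF that] B(1) s by (simp add: holomorphic_derivI)
    then have "((\<lambda>s. \<Sum>j\<in>insert i J. a j * (F j s / F i s)) has_field_derivative (\<Sum>j\<in>insert i J. a j * G j s)) (at s)"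
      by (intro DERIV_sum DERIV_cmult) auto
    moreover have "G i s = 0"
    proof -
      have "((\<lambda>s. F i s / F i s) has_field_derivative 0) (at s)"
        by (rule has_field_derivative_transform_within_open[OF _ B(1) s, of "\<lambda>_. 1"]) (use B in auto)
      then show ?thesis unfolding G_def by (rule DERIV_imp_deriv)
    qed
    ultimately show ?thesis using insert.hyps by simp
  qed
  have "\<exists>s0\<in>B. \<forall>a \<Phi>. (\<lambda>x. \<Sum>j\<in>J. a j * G j (s0 + x)) has_fps_expansion \<Phi> \<longrightarrow>
           (\<forall>l<card J. \<Phi> $ l = 0) \<longrightarrow> (\<forall>j\<in>J. a j = 0)"
  proof (rule insert.IH[OF B(1-3)])
    show "G j holomorphic_on B" if "j \<in> J" for j
      unfolding G_def using holQ that B(1) by (intro holomorphic_deriv) auto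
    fix a assume a: "\<forall>s\<in>B. (\<Sum>j\<in>J. a j * G j s) = 0"
    have "\<exists>c. \<forall>s\<in>B. (\<Sum>j\<in>insert i J. a j * (F j s / F i s)) = c"
    proof (rule has_field_derivative_zero_constant)
      show "convex B" by (simp add: B_def)
      show "((\<lambda>s. \<Sum>j\<in>insert i J. a j * (F j s / F i s)) has_field_derivative 0) (at s within B)" if "s \<in> B" for s
        using dQ[OF that, of a] a that by (simp add: has_field_derivative_at_within)
    qed
    then obtain c where c: "\<And>s. s \<in> B \<Longrightarrow> (\<Sum>j\<in>insert i J. a j * (F j s / F i s)) = c" by blast
    \<comment> \<open>If the derivatives of the quotients are dependent, the combination of the quotients is constant,
      which is a relation that involves \<open>F i\<close>.\<close>
    define a' where "a' = a(i := a i - c)"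
    have a'eq: "(\<Sum>j\<in>insert i J. a' j * F j s) = (\<Sum>j\<in>insert i J. a j * F j s) - c * F i s" for s
    proof -
      have "(\<Sum>j\<in>J. a' j * F j s) = (\<Sum>j\<in>J. a j * F j s)"
        using insert.hyps by (intro sum.cong) (auto simp: a'_def)
      then show ?thesis using insert.hyps by (simp add: a'_def algebra_simps)
    qed
    have zero: "(\<Sum>j\<in>insert i J. a' j * F j s) = 0" if "s \<in> B" for s
    proof -
      have "(\<Sum>j\<in>insert i J. a j * F j s) = (\<Sum>j\<in>insert i J. a j * (F j s / F i s)) * F i s"
        unfolding sum_distrib_right using B(5)[OF that] by (intro sum.cong) auto
      then show ?thesis unfolding a'eq c[OF that] by simp
    qed
    have "(\<Sum>j\<in>insert i J. a' j * F j s) = 0" if "s \<in> D" for s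
      by (rule analytic_continuation_open[of B D "\<lambda>s. \<Sum>j\<in>insert i J. a' j * F j s" "\<lambda>_. 0", OF B(1) insert.prems(1) B(3) insert.prems(2) B(4)])
         (use zero that in \<open>auto intro!: holomorphic_intros hol simp del: sum.insert\<close>)
    then have "\<forall>j\<in>insert i J. a' j = 0" by (intro insert.prems(5)) blast
    moreover have "a' j = a j" if "j \<in> J" for j using that insert.hyps by (auto simp: a'_def)
    ultimately show "\<forall>j\<in>J. a j = 0" by (metis insertI2)
  qed
  then obtain s0 where s0: "s0 \<in> B" and IH: "\<And>a \<Phi>. (\<lambda>x. \<Sum>j\<in>J. a j * G j (s0 + x)) has_fps_expansion \<Phi> \<Longrightarrow>
           (\<forall>l<card J. \<Phi> $ l = 0) \<Longrightarrow> (\<forall>j\<in>J. a j = 0)" by blast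
  show ?case
  proof (intro bexI[of _ s0] allI impI)
    show "s0 \<in> D" using s0 B by blast
    fix a \<Phi>
    assume \<Phi>: "(\<lambda>x. \<Sum>j\<in>insert i J. a j * F j (s0 + x)) has_fps_expansion \<Phi>"
      and low: "\<forall>l<card (insert i J). \<Phi> $ l = 0"
    have low': "\<Phi> $ l = 0" if "l \<le> card J" for l using low that insert.hyps by simp
    define \<Psi> where "\<Psi> = fps_expansion (F i) s0"
    have "F i analytic_on {s0}" using holB[of i] s0 B(1) analytic_at by blast
    then have \<Psi>: "(\<lambda>x. F i (s0 + x)) has_fps_expansion \<Psi>"
      unfolding \<Psi>_def by (rule analytic_at_imp_has_fps_expansion)
    have \<Psi>0: "\<Psi> $ 0 \<noteq> 0" using has_fps_expansion_imp_0_eq_fps_nth_0[OF \<Psi>] B(5)[OF s0] by simp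
    have quot: "(\<lambda>x. (\<Sum>j\<in>insert i J. a j * F j (s0 + x)) * inverse (F i (s0 + x))) has_fps_expansion \<Phi> * inverse \<Psi>"
      by (intro has_fps_expansion_mult has_fps_expansion_inverse \<Phi> \<Psi> \<Psi>0)
    have lowq: "(\<Phi> * inverse \<Psi>) $ l = 0" if "l \<le> card J" for l
      unfolding fps_mult_nth using that by (intro sum.neutral) (auto simp: low')
    have ev: "eventually (\<lambda>x. s0 + x \<in> B) (nhds 0)"
    proof -
      have "((\<lambda>x. s0 + x) \<longlongrightarrow> s0 + 0) (nhds 0)" by (intro tendsto_intros filterlim_ident)
      then show ?thesis using topological_tendstoD[OF _ B(1)] s0 by fastforce
    qed
    have "deriv (\<lambda>x. (\<Sum>j\<in>insert i J. a j * F j (s0 + x)) * inverse (F i (s0 + x))) x = (\<Sum>j\<in>J. a j * G j (s0 + x))"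
      if "s0 + x \<in> B" for x
    proof (rule DERIV_imp_deriv)
      have "((\<lambda>x. \<Sum>j\<in>insert i J. a j * (F j (s0 + x) / F i (s0 + x))) has_field_derivative (\<Sum>j\<in>J. a j * G j (s0 + x))) (at x)"
      proof -
        have "((\<lambda>x. s0 + x) has_field_derivative 1) (at x)" by (auto intro!: derivative_eq_intros)
        from DERIV_chain2[where g = "\<lambda>x. s0 + x", OF dQ[OF that, of a] this]
        show ?thesis by (simp only: mult_1_right)
      qed
      then show "((\<lambda>x. (\<Sum>j\<in>insert i J. a j * F j (s0 + x)) * inverse (F i (s0 + x))) has_field_derivative (\<Sum>j\<in>J. a j * G j (s0 + x))) (at x)"
        by (simp add: sum_distrib_right divide_inverse mult.assoc del: sum.insert)
    qed
    then have ev2: "eventually (\<lambda>x. deriv (\<lambda>x. (\<Sum>j\<in>insert i J. a j * F j (s0 + x)) * inverse (F i (s0 + x))) x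
        = (\<Sum>j\<in>J. a j * G j (s0 + x))) (nhds 0)"
      using ev by (rule eventually_mono[rotated])
    have "(\<lambda>x. \<Sum>j\<in>J. a j * G j (s0 + x)) has_fps_expansion fps_deriv (\<Phi> * inverse \<Psi>)"
      using has_fps_expansion_deriv[OF quot] has_fps_expansion_cong[OF ev2 refl] by blast
    moreover have "\<forall>l<card J. fps_deriv (\<Phi> * inverse \<Psi>) $ l = 0"
      using lowq by (simp only: fps_deriv_nth) simp
    ultimately have aJ: "\<forall>j\<in>J. a j = 0" by (rule IH)
    have "(\<Sum>j\<in>insert i J. a j * F j (s0 + 0)) = \<Phi> $ 0"
      using has_fps_expansion_imp_0_eq_fps_nth_0[OF \<Phi>] by simp
    moreover have "(\<Sum>j\<in>J. a j * F j (s0 + 0)) = 0" using aJ by (intro sum.neutral) auto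
    ultimately have "a i * F i s0 = 0" using low'[of 0] by (simp add: insert.hyps)
    then have "a i = 0" using B(5)[OF s0] by simp
    with aJ show "\<forall>j\<in>insert i J. a j = 0" by blast
  qed
qed

definition radical_fun :: "nat \<Rightarrow> nat set \<Rightarrow> (nat \<Rightarrow> complex) \<Rightarrow> (nat \<Rightarrow> nat) \<Rightarrow> complex \<Rightarrow> complex" where
  "radical_fun k I c e s = (\<Prod>i\<in>I. (1 - c i * s) powr (- (of_nat (e i) / of_nat k)))"

lemma radical_fun_has_fps_expansion: "radical_fun k I c e has_fps_expansion radical_fps k I c e"
proof -
  have "(\<lambda>s. (1 - c i * s) powr (- (of_nat (e i) / of_nat k))) has_fps_expansion
      (fps_binomial (- (of_nat (e i) / of_nat k)) oo (fps_const (- c i) * fps_X))" for i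
  proof -
    have "((\<lambda>x. (1 + x) powr (- (of_nat (e i) / of_nat k))) \<circ> (\<lambda>x. - c i * x)) has_fps_expansion
        (fps_binomial (- (of_nat (e i) / of_nat k)) oo (fps_const (- c i) * fps_X))"
      by (intro has_fps_expansion_compose has_fps_expansion_binomial_complex has_fps_expansion_cmult_left has_fps_expansion_fps_X) simp
    then show ?thesis by (simp add: o_def)
  qed
  then show ?thesis unfolding radical_fun_def radical_fps_def by (intro has_fps_expansion_prod)
qed

lemma Re_one_minus_pos: "norm (w :: complex) < 1 \<Longrightarrow> Re (1 - w) > 0"
  using complex_Re_le_cmod[of w] by simp

lemma radical_fun_holomorphic:
  assumes "\<And>i s. i \<in> I \<Longrightarrow> s \<in> D \<Longrightarrow> norm (c i * s) < 1"
  shows "radical_fun k I c e holomorphic_on D"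
  unfolding radical_fun_def
proof (intro holomorphic_intros)
  fix i s assume "i \<in> I" "s \<in> D"
  then have "Re (1 - c i * s) > 0" using assms Re_one_minus_pos by blast
  then show "1 - c i * s \<notin> \<real>\<^sub>\<le>\<^sub>0" by (auto simp: complex_nonpos_Reals_iff)
qed

lemma powr_mult_right_half_plane:
  assumes "Re w > 0" "Re z > 0"
  shows "(w * z) powr a = w powr a * z powr (a :: complex)"
proof -
  have nz: "w \<noteq> 0" "z \<noteq> 0" using assms by auto
  have "\<bar>Im (Ln w)\<bar> < pi / 2" "\<bar>Im (Ln z)\<bar> < pi / 2" using assms Re_Ln_pos_lt[OF nz(1)] Re_Ln_pos_lt[OF nz(2)] by blast+
  then have "Ln (w * z) = Ln w + Ln z" using nz by (intro Ln_times_simple) linarith+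
  then show ?thesis using nz by (simp add: powr_def distrib_left exp_add)
qed

text \<open>Since \<open>1 - c\<^sub>i (s\<^sub>0 + x) = (1 - c\<^sub>i s\<^sub>0) (1 - c'\<^sub>i x)\<close> with \<open>c'\<^sub>i = c\<^sub>i / (1 - c\<^sub>i s\<^sub>0)\<close>, and polynomials of
bounded degree are stable under translation, expanding the functions of the parameters \<open>c\<close> at \<open>s\<^sub>0\<close>
gives the space of functions of the parameters \<open>c'\<close> at \<open>0\<close>. So it suffices to find a point \<open>s\<^sub>0\<close> without
inflection near \<open>0\<close>.\<close>

lemma exists_deformation_uninflected:
  assumes k: "k > 0" and I: "finite I" "inj_on c I" and \<epsilon>: "\<epsilon> > (0::real)"
  shows "\<exists>s0. norm s0 < \<epsilon> \<and> (\<forall>i\<in>I. 1 - c i * s0 \<noteq> 0) \<and>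
           uninflected (diff_index k I r) (diff_fps k I (\<lambda>i. c i / (1 - c i * s0)))"
proof -
  define M where "M = 1 + (\<Sum>i\<in>I. norm (c i))"
  have M: "M > 0" "i \<in> I \<Longrightarrow> norm (c i) < M" for i
  proof -
    have "(\<Sum>i\<in>I. norm (c i)) \<ge> 0" by (intro sum_nonneg) auto
    then show "M > 0" by (simp add: M_def)
    assume "i \<in> I"
    then have "norm (c i) \<le> (\<Sum>i\<in>I. norm (c i))" using I by (intro member_le_sum) auto
    then show "norm (c i) < M" by (simp add: M_def)
  qed
  define D where "D = ball (0::complex) (min \<epsilon> (1 / M))"
  have small: "norm (c i * s) < 1" if "i \<in> I" "s \<in> D" for i s
  proof -
    have "norm s < 1 / M" using that by (simp add: D_def)
    then have "M * norm s < 1" using M(1) by (simp add: field_simps)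
    moreover have "norm (c i) * norm s \<le> M * norm s" using M(2)[OF that(1)] by (intro mult_right_mono) auto
    ultimately show ?thesis by (simp add: norm_mult)
  qed
  let ?J = "diff_index k I r"
  define F where "F = (\<lambda>(e, i) s. s ^ i * radical_fun k I c e s)"
  have hol: "F j holomorphic_on D" for j
    unfolding F_def using small by (cases j) (auto intro!: holomorphic_intros radical_fun_holomorphic)
  have exp: "F j has_fps_expansion diff_fps k I c j" for j
    unfolding F_def diff_fps_def
    by (cases j) (auto intro!: has_fps_expansion_mult has_fps_expansion_fps_X_power radical_fun_has_fps_expansion)
  have D: "open D" "connected D" "D \<noteq> {}" "0 \<in> D" using \<epsilon> M(1) by (auto simp: D_def min_def)
  have "\<exists>s0\<in>D. \<forall>a \<Phi>. (\<lambda>x. \<Sum>j\<in>?J. a j * F j (s0 + x)) has_fps_expansion \<Phi> \<longrightarrow>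
           (\<forall>l<card ?J. \<Phi> $ l = 0) \<longrightarrow> (\<forall>j\<in>?J. a j = 0)"
  proof (rule exists_uninflected_point[OF finite_diff_index[OF I(1)] D(1-3) hol])
    fix a assume a: "\<forall>s\<in>D. (\<Sum>j\<in>?J. a j * F j s) = 0"
    have "(\<lambda>s. \<Sum>j\<in>?J. a j * F j s) has_fps_expansion lincomb ?J (diff_fps k I c) a"
      unfolding lincomb_def by (intro has_fps_expansion_sum has_fps_expansion_cmult_left exp)
    moreover have "eventually (\<lambda>s. (\<Sum>j\<in>?J. a j * F j s) = 0) (nhds 0)"
      using eventually_nhds_in_open[OF D(1,4)] by (rule eventually_mono) (use a in auto)
    then have "(\<lambda>s. \<Sum>j\<in>?J. a j * F j s) has_fps_expansion 0"
      by (simp add: has_fps_expansion_0_iff)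
    ultimately have "lincomb ?J (diff_fps k I c) a = 0"
      by (rule fps_expansion_unique_complex)
    then show "\<forall>j\<in>?J. a j = 0"
      using lin_indep_diff_fps[OF k I, of r] unfolding lin_indep_def by blast
  qed
  then obtain s0 where s0: "s0 \<in> D" and good: "\<And>a \<Phi>. (\<lambda>x. \<Sum>j\<in>?J. a j * F j (s0 + x)) has_fps_expansion \<Phi> \<Longrightarrow>
           (\<forall>l<card ?J. \<Phi> $ l = 0) \<Longrightarrow> (\<forall>j\<in>?J. a j = 0)" by blast
  have nz: "1 - c i * s0 \<noteq> 0" if "i \<in> I" for i
    using Re_one_minus_pos[OF small[OF that s0]] by (metis less_irrefl zero_complex.sel(1))
  define c' where "c' = (\<lambda>i. c i / (1 - c i * s0))"
  define K where "K e = (\<Prod>i\<in>I. (1 - c i * s0) powr (- (of_nat (e i) / of_nat k)))" for e :: "nat \<Rightarrow> nat"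
  have Knz: "K e \<noteq> 0" for e using nz I(1) by (auto simp: K_def powr_def)
  have shift: "eventually (\<lambda>x. \<forall>e. radical_fun k I c e (s0 + x) = K e * radical_fun k I c' e x) (nhds 0)"
  proof -
    have "eventually (\<lambda>x. \<forall>i\<in>I. norm (c' i * x) < 1) (nhds 0)"
    proof (intro eventually_ball_finite ballI I(1))
      fix i assume "i \<in> I"
      have "((\<lambda>x. norm (c' i * x)) \<longlongrightarrow> norm (c' i * 0)) (nhds 0)" by (intro tendsto_intros filterlim_ident)
      then show "eventually (\<lambda>x. norm (c' i * x) < 1) (nhds 0)" by (rule order_tendstoD) auto
    qed
    then show ?thesis
    proof eventually_elim
      case (elim x)
      have "(1 - c i * (s0 + x)) powr a = (1 - c i * s0) powr a * (1 - c' i * x) powr a" if "i \<in> I" for i a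
      proof -
        have "1 - c i * (s0 + x) = (1 - c i * s0) * (1 - c' i * x)"
          using nz[OF that] by (simp add: c'_def field_simps)
        moreover have "Re (1 - c i * s0) > 0" "Re (1 - c' i * x) > 0"
          using small[OF that s0] elim that by (blast intro: Re_one_minus_pos)+
        ultimately show ?thesis by (simp only: powr_mult_right_half_plane)
      qed
      then show ?case unfolding radical_fun_def K_def prod.distrib[symmetric] by (intro allI prod.cong) auto
    qed
  qed
  have "uninflected ?J (diff_fps k I c')"
    unfolding uninflected_def
  proof (intro allI impI)
    fix a assume a: "\<forall>l<card ?J. lincomb ?J (diff_fps k I c') a $ l = 0"
    define p where "p e = (\<Sum>i<num_powers k I r e. monom (a (e, i)) i)" for e
    \<comment> \<open>the coefficient polynomials, translated back from \<open>s0\<close> to \<open>0\<close>\<close>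
    define q where "q e = smult (inverse (K e)) (pcompose (p e) [:- s0, 1:])" for e
    have degq: "coeff (q e) i = 0" if "i \<ge> num_powers k I r e" for e i
    proof (cases "num_powers k I r e")
      case 0 then show ?thesis by (simp add: q_def p_def)
    next
      case (Suc m)
      have "degree (p e) \<le> m" unfolding p_def
        by (rule degree_sum_le) (auto simp: Suc intro: order_trans[OF degree_monom_le])
      then have "degree (q e) \<le> m" unfolding q_def by (simp add: degree_pcompose)
      then show ?thesis using that Suc by (intro coeff_eq_0) simp
    qed
    define a' where "a' = (\<lambda>(e, i). coeff (q e) i)"
    have polyq: "(\<Sum>i<num_powers k I r e. coeff (q e) i * y ^ i) = poly (q e) y" for e y
    proof -
      have "poly (q e) y = (\<Sum>i\<le>degree (q e). coeff (q e) i * y ^ i)" by (rule poly_altdef)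
      also have "\<dots> = (\<Sum>i<max (Suc (degree (q e))) (num_powers k I r e). coeff (q e) i * y ^ i)"
        by (intro sum.mono_neutral_left) (auto simp: coeff_eq_0 not_le)
      also have "\<dots> = (\<Sum>i<num_powers k I r e. coeff (q e) i * y ^ i)"
        by (intro sum.mono_neutral_right) (auto simp: degq not_less)
      finally show ?thesis ..
    qed
    have sumJ: "(\<Sum>j\<in>?J. b j) = (\<Sum>e\<in>residue_exps k I r. \<Sum>i<num_powers k I r e. b (e, i))" for b :: "_ \<Rightarrow> complex"
      unfolding diff_index_def by (subst sum.Sigma) (auto simp: finite_residue_exps I)
    have ev: "eventually (\<lambda>x. (\<Sum>j\<in>?J. a j * (case j of (e, i) \<Rightarrow> x ^ i * radical_fun k I c' e x)) = (\<Sum>j\<in>?J. a' j * F j (s0 + x))) (nhds 0)"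
      using shift
    proof eventually_elim
      case (elim x)
      have "(\<Sum>i<num_powers k I r e. a (e, i) * (x ^ i * radical_fun k I c' e x)) =
            (\<Sum>i<num_powers k I r e. a' (e, i) * F (e, i) (s0 + x))" for e
      proof -
        have "(\<Sum>i<num_powers k I r e. a' (e, i) * F (e, i) (s0 + x)) =
            (\<Sum>i<num_powers k I r e. coeff (q e) i * (s0 + x) ^ i) * radical_fun k I c e (s0 + x)"
          by (simp add: a'_def F_def sum_distrib_right mult.assoc)
        also have "\<dots> = inverse (K e) * poly (p e) x * (K e * radical_fun k I c' e x)"
          unfolding polyq using elim by (simp add: q_def poly_pcompose)
        also have "\<dots> = poly (p e) x * radical_fun k I c' e x" using Knz[of e] by simp
        also have "\<dots> = (\<Sum>i<num_powers k I r e. a (e, i) * (x ^ i * radical_fun k I c' e x))"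
          by (simp add: p_def poly_sum poly_monom sum_distrib_right mult.assoc)
        finally show ?thesis ..
      qed
      then show ?case unfolding sumJ by simp
    qed
    moreover have "(\<lambda>x. \<Sum>j\<in>?J. a j * (case j of (e, i) \<Rightarrow> x ^ i * radical_fun k I c' e x)) has_fps_expansion lincomb ?J (diff_fps k I c') a"
      unfolding lincomb_def diff_fps_def
      by (intro has_fps_expansion_sum has_fps_expansion_cmult_left)
         (auto intro!: has_fps_expansion_mult has_fps_expansion_fps_X_power radical_fun_has_fps_expansion split: prod.splits)
    ultimately have "(\<lambda>x. \<Sum>j\<in>?J. a' j * F j (s0 + x)) has_fps_expansion lincomb ?J (diff_fps k I c') a"
      using has_fps_expansion_cong[OF ev refl] by blast
    then have a'0: "\<forall>j\<in>?J. a' j = 0" using a by (rule good)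
    show "\<forall>j\<in>?J. a j = 0"
    proof
      fix j assume j: "j \<in> ?J"
      obtain e i where ei: "j = (e, i)" by (cases j)
      have e: "e \<in> residue_exps k I r" "i < num_powers k I r e" using j ei by (auto simp: diff_index_def)
      have "coeff (q e) l = 0" for l
      proof (cases "l < num_powers k I r e")
        case True
        then have "(e, l) \<in> ?J" using e by (simp add: diff_index_def)
        then have "a' (e, l) = 0" using a'0 by blast
        then show ?thesis by (simp add: a'_def)
      qed (use degq in auto)
      then have "q e = 0" by (simp add: poly_eq_iff)
      then have "pcompose (p e) [:- s0, 1:] = 0" using Knz[of e] by (simp add: q_def)
      then have "p e = 0" by (simp add: pcompose_eq_0_iff)
      then have "coeff (p e) i = 0" by simp
      then show "a j = 0" unfolding p_def coeff_sum_monom using ei e by simp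
    qed
  qed
  then show ?thesis using s0 nz unfolding c'_def D_def by auto
qed

lemma tendsto_diff_fps_nth:
  assumes "finite I" and "\<And>i. i \<in> I \<Longrightarrow> ((\<lambda>x. c x i) \<longlongrightarrow> c0 i) F"
  shows "((\<lambda>x. diff_fps k I (c x) j $ l) \<longlongrightarrow> diff_fps k I c0 j $ l) F"
proof -
  have "((\<lambda>x. radical_fps k I (c x) e $ l) \<longlongrightarrow> radical_fps k I c0 e $ l) F" for e l
    using assms unfolding radical_fps_def
  proof (induction I arbitrary: l rule: finite_induct)
    case (insert i I)
    show ?case
      unfolding prod.insert[OF insert.hyps] fps_mult_nth fps_compose_linear fps_nth_Abs_fps
      by (intro tendsto_intros insert.prems) (use insert in \<open>auto simp: fps_compose_linear\<close>)
  qed simp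
  then show ?thesis
    unfolding diff_fps_def by (cases j) (auto simp: fps_X_power_mult_nth)
qed

lemma radical_fps_scale:
  "radical_fps k I (\<lambda>i. \<mu> * c i) e = radical_fps k I c e oo (fps_const \<mu> * fps_X)"
proof -
  have "fps_binomial b oo (fps_const (- (\<mu> * c i)) * fps_X) = (fps_binomial b oo (fps_const (- c i) * fps_X)) oo (fps_const \<mu> * fps_X)" for b i
    by (simp add: fps_compose_linear fps_eq_iff power_mult_distrib[symmetric] mult.assoc[symmetric] fps_compose_linear[symmetric])
  then show ?thesis unfolding radical_fps_def by (subst fps_compose_prod_distrib) simp_all
qed

text \<open>Scaling the parameters is a change of the variable of the power series. It is needed because the
parameters \<open>c\<close> are determined by the branch points only up to a common factor.\<close>

lemma lincomb_diff_fps_scale: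
  "lincomb J (diff_fps k I (\<lambda>i. \<mu> * c i)) a $ l = \<mu> ^ l * lincomb J (diff_fps k I c) (\<lambda>(e, i). a (e, i) / \<mu> ^ i) $ l"
  if "\<mu> \<noteq> 0"
proof -
  have "a j * diff_fps k I (\<lambda>i. \<mu> * c i) j $ l = \<mu> ^ l * ((\<lambda>(e, i). a (e, i) / \<mu> ^ i) j * diff_fps k I c j $ l)" for j
    using that
    by (cases j) (auto simp: diff_fps_def radical_fps_scale fps_compose_linear fps_X_power_mult_nth power_diff)
  then show ?thesis unfolding lincomb_nth sum_distrib_left by (rule sum.cong[OF refl])
qed

lemma vanishing_orders_diff_fps_scale_subset:
  assumes "\<mu> \<noteq> 0"
  shows "vanishing_orders J (diff_fps k I (\<lambda>i. \<mu> * c i)) \<subseteq> vanishing_orders J (diff_fps k I c)"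
proof
  fix m assume "m \<in> vanishing_orders J (diff_fps k I (\<lambda>i. \<mu> * c i))"
  then obtain a where a: "m = subdegree (lincomb J (diff_fps k I (\<lambda>i. \<mu> * c i)) a)" "lincomb J (diff_fps k I (\<lambda>i. \<mu> * c i)) a \<noteq> 0"
    unfolding vanishing_orders_def by blast
  define b where "b = (\<lambda>(e, i). a (e, i) / \<mu> ^ i)"
  have nth: "lincomb J (diff_fps k I (\<lambda>i. \<mu> * c i)) a $ l = \<mu> ^ l * lincomb J (diff_fps k I c) b $ l" for l
    unfolding b_def by (rule lincomb_diff_fps_scale[OF assms])
  have m: "lincomb J (diff_fps k I c) b $ m \<noteq> 0"
    using a nth[of m] by (metis mult_zero_right nth_subdegree_nonzero)
  have "lincomb J (diff_fps k I c) b $ l = 0" if "l < m" for l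
    using nth[of l] that assms nth_less_subdegree_zero unfolding a(1) by (metis mult_eq_0_iff power_not_zero)
  with m have "subdegree (lincomb J (diff_fps k I c) b) = m" by (intro subdegreeI) auto
  moreover have "lincomb J (diff_fps k I c) b \<noteq> 0" using m by auto
  ultimately show "m \<in> vanishing_orders J (diff_fps k I c)" using vanishing_ordersI by metis
qed

lemma vanishing_orders_diff_fps_scale:
  assumes "\<mu> \<noteq> 0"
  shows "vanishing_orders J (diff_fps k I (\<lambda>i. \<mu> * c i)) = vanishing_orders J (diff_fps k I c)"
proof
  show "vanishing_orders J (diff_fps k I c) \<subseteq> vanishing_orders J (diff_fps k I (\<lambda>i. \<mu> * c i))"
    using vanishing_orders_diff_fps_scale_subset[of "inverse \<mu>" J k I "\<lambda>i. \<mu> * c i"] assms by (simp add: mult.assoc[symmetric])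
qed (rule vanishing_orders_diff_fps_scale_subset[OF assms])

lemma uninflected_diff_fps_scale:
  assumes "\<mu> \<noteq> 0" and u: "uninflected (diff_index k I r) (diff_fps k I c)"
  shows "uninflected (diff_index k I r) (diff_fps k I (\<lambda>i. \<mu> * c i))"
  unfolding uninflected_def
proof (intro allI impI ballI)
  fix a j
  assume a: "\<forall>l<card (diff_index k I r). lincomb (diff_index k I r) (diff_fps k I (\<lambda>i. \<mu> * c i)) a $ l = 0"
    and j: "j \<in> diff_index k I r"
  have "\<forall>l<card (diff_index k I r). lincomb (diff_index k I r) (diff_fps k I c) (\<lambda>(e, i). a (e, i) / \<mu> ^ i) $ l = 0"
    using a assms(1) unfolding lincomb_diff_fps_scale[OF assms(1)] by simp
  with u have "\<forall>j\<in>diff_index k I r. (\<lambda>(e, i). a (e, i) / \<mu> ^ i) j = 0" unfolding uninflected_def by blast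
  with j have "(\<lambda>(e, i). a (e, i) / \<mu> ^ i) j = 0" by blast
  then show "a j = 0" using assms(1) by (cases j) simp
qed

section \<open>Counting exponents and summing gaps\<close>

text \<open>Multiplication of the monomial \<open>y ^ e\<close> by \<open>y\<^sub>i ^ d\<close>, up to \<open>k\<close>-th powers. It shifts the residue class by
\<open>d\<close>, so that all classes have the same size.\<close>

definition rotate_exp :: "nat \<Rightarrow> nat \<Rightarrow> nat \<Rightarrow> (nat \<Rightarrow> nat) \<Rightarrow> nat \<Rightarrow> nat" where
  "rotate_exp k i d e = e(i := (e i + d) mod k)"

lemma residue_exps_cong_mod: "r mod k = r' mod k \<Longrightarrow> residue_exps k I r = residue_exps k I r'"
  by (simp add: residue_exps_def)

lemma residue_exps_less: "e \<in> residue_exps k I r \<Longrightarrow> i \<in> I \<Longrightarrow> e i < k"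
  by (auto simp: residue_exps_def)

lemma rotate_exp_mem:
  assumes "finite I" "i \<in> I" "k > 0" "e \<in> residue_exps k I r"
  shows "rotate_exp k i d e \<in> residue_exps k I (r + d)"
proof -
  have rest: "(\<Sum>l\<in>I - {i}. rotate_exp k i d e l) = (\<Sum>l\<in>I - {i}. e l)"
    by (intro sum.cong) (auto simp: rotate_exp_def)
  have "(\<Sum>l\<in>I. rotate_exp k i d e l) mod k = ((e i + d) mod k + (\<Sum>l\<in>I - {i}. e l)) mod k"
    using assms by (subst sum.remove[of I i]) (simp_all add: rest, simp add: rotate_exp_def)
  also have "\<dots> = ((e i + (\<Sum>l\<in>I - {i}. e l)) + d) mod k" by (simp add: mod_simps ac_simps)
  also have "e i + (\<Sum>l\<in>I - {i}. e l) = (\<Sum>l\<in>I. e l)" using assms by (simp add: sum.remove)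
  also have "((\<Sum>l\<in>I. e l) + d) mod k = (r + d) mod k"
    using assms(4) by (auto simp: residue_exps_def intro: mod_add_cong)
  finally show ?thesis
    using assms by (auto simp: residue_exps_def rotate_exp_def PiE_def Pi_def extensional_def)
qed

lemma bij_betw_rotate_exp:
  assumes "finite I" "i \<in> I" "k > 0"
  shows "bij_betw (rotate_exp k i d) (residue_exps k I r) (residue_exps k I (r + d))"
proof (rule bij_betwI[where g = "rotate_exp k i (d * (k - 1))"])
  have kd: "d + d * (k - 1) = d * k" using assms(3) by (cases k) simp_all
  show "rotate_exp k i d \<in> residue_exps k I r \<rightarrow> residue_exps k I (r + d)"
    using rotate_exp_mem[OF assms] by blast
  show "rotate_exp k i (d * (k - 1)) \<in> residue_exps k I (r + d) \<rightarrow> residue_exps k I r"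
  proof
    fix e assume "e \<in> residue_exps k I (r + d)"
    then have "rotate_exp k i (d * (k - 1)) e \<in> residue_exps k I (r + d + d * (k - 1))"
      by (rule rotate_exp_mem[OF assms])
    moreover have "(r + d + d * (k - 1)) mod k = r mod k" unfolding add.assoc kd by simp
    ultimately show "rotate_exp k i (d * (k - 1)) e \<in> residue_exps k I r"
      using residue_exps_cong_mod by metis
  qed
  have inv: "((x + a) mod k + b) mod k = x" if "x < k" "a + b = d * k" for x a b
  proof -
    have "((x + a) mod k + b) mod k = (x + d * k) mod k" unfolding that(2)[symmetric] by (simp add: mod_simps add.assoc)
    then show ?thesis using that by simp
  qed
  show "rotate_exp k i (d * (k - 1)) (rotate_exp k i d e) = e" if "e \<in> residue_exps k I r" for e
    using inv[OF residue_exps_less[OF that assms(2)] kd] by (auto simp: rotate_exp_def)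
  have kd': "d * (k - 1) + d = d * k" using kd by simp
  show "rotate_exp k i d (rotate_exp k i (d * (k - 1)) e) = e" if "e \<in> residue_exps k I (r + d)" for e
    using inv[OF residue_exps_less[OF that assms(2)] kd'] by (auto simp: rotate_exp_def)
qed

text \<open>Here \<open>d * (k - 1)\<close> stands for \<open>- d\<close> modulo \<open>k\<close>, so the residue class is preserved.\<close>

definition transfer_exp :: "nat \<Rightarrow> nat \<Rightarrow> nat \<Rightarrow> nat \<Rightarrow> (nat \<Rightarrow> nat) \<Rightarrow> nat \<Rightarrow> nat" where
  "transfer_exp k i i' d = rotate_exp k i' (d * (k - 1)) \<circ> rotate_exp k i d"

lemma bij_betw_transfer_exp:
  assumes "finite I" "i \<in> I" "i' \<in> I" "k > 0"
  shows "bij_betw (transfer_exp k i i' d) (residue_exps k I r) (residue_exps k I r)"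
proof -
  have "(r + d + d * (k - 1)) mod k = (r + d * k) mod k"
    using assms(4) by (cases k) (simp_all add: ac_simps)
  then have "residue_exps k I (r + d + d * (k - 1)) = residue_exps k I r"
    by (intro residue_exps_cong_mod) simp
  then show ?thesis unfolding transfer_exp_def
    using bij_betw_trans[OF bij_betw_rotate_exp[OF assms(1,2,4)] bij_betw_rotate_exp[OF assms(1,3,4)]] by metis
qed

lemma card_residue_exps:
  assumes "finite I" "I \<noteq> {}" "k > 0"
  shows "card (residue_exps k I r) = k ^ (card I - 1)"
proof -
  obtain i where i: "i \<in> I" using assms by blast
  have const: "card (residue_exps k I r) = card (residue_exps k I 0)" for r
    using bij_betw_same_card[OF bij_betw_rotate_exp[OF assms(1) i assms(3), of r 0]] by simp
  have un: "I \<rightarrow>\<^sub>E {..<k} = (\<Union>r<k. residue_exps k I r)"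
    using assms(3) by (auto simp: residue_exps_def)
  have "k ^ card I = card (I \<rightarrow>\<^sub>E {..<k})" using assms(1) by (simp add: card_PiE)
  also have "\<dots> = (\<Sum>r<k. card (residue_exps k I r))"
    unfolding un
  proof (rule card_UN_disjoint)
    show "\<forall>r\<in>{..<k}. finite (residue_exps k I r)" using finite_residue_exps[OF assms(1)] by blast
  qed (auto simp: residue_exps_def)
  also have "\<dots> = (\<Sum>r<k. card (residue_exps k I 0))" by (rule sum.cong[OF refl const])
  also have "\<dots> = k * card (residue_exps k I 0)" by simp
  finally have "k * card (residue_exps k I 0) = k * k ^ (card I - 1)"
    using assms by (metis card_gt_0_iff power_minus_mult mult.commute)
  then show ?thesis using const[of r] assms(3) by simp
qed

lemma sum_rotations_mod:
  fixes k x :: nat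
  assumes "k > 0"
  shows "(\<Sum>d<k. (x + d) mod k) = \<Sum>{..<k}"
proof -
  have inj: "inj_on (\<lambda>d. (x + d) mod k) {..<k}"
  proof (rule inj_onI)
    fix d d' assume d: "d \<in> {..<k}" "d' \<in> {..<k}" and "(x + d) mod k = (x + d') mod k"
    then have "[d = d'] (mod k)" by (simp add: cong_def[symmetric] cong_add_lcancel_nat)
    then show "d = d'" using d by (simp add: cong_def)
  qed
  have im: "(\<lambda>d. (x + d) mod k) ` {..<k} = {..<k}"
    using inj assms by (intro card_subset_eq) (auto simp: card_image)
  show ?thesis using sum.reindex[OF inj, of "\<lambda>y. y"] unfolding im by (simp add: o_def)
qed

text \<open>By transfer between two coordinates, the value of a coordinate is uniformly distributed on a
residue class.\<close>

lemma sum_coordinate_residue_exps: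
  assumes "finite I" "i \<in> I" "i' \<in> I" "i \<noteq> i'" "k > 0"
  shows "2 * (\<Sum>e\<in>residue_exps k I r. e i) = k ^ (card I - 1) * (k - 1)"
proof -
  let ?E = "residue_exps k I r"
  have "(\<Sum>e\<in>?E. e i) = (\<Sum>e\<in>?E. (e i + d) mod k)" for d
  proof -
    have "(\<Sum>e\<in>?E. e i) = (\<Sum>e\<in>?E. transfer_exp k i i' d e i)"
      by (rule sum.reindex_bij_betw[OF bij_betw_transfer_exp[OF assms(1-3,5)], symmetric])
    then show ?thesis using assms(4) by (simp add: transfer_exp_def rotate_exp_def)
  qed
  then have "k * (\<Sum>e\<in>?E. e i) = (\<Sum>d<k. \<Sum>e\<in>?E. (e i + d) mod k)" by simp
  also have "\<dots> = (\<Sum>e\<in>?E. \<Sum>d<k. (e i + d) mod k)" by (rule sum.swap)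
  also have "\<dots> = card ?E * \<Sum>{..<k}" using assms(5) by (simp add: sum_rotations_mod)
  also have "card ?E = k ^ (card I - 1)" using assms(2) by (intro card_residue_exps assms(1,5)) auto
  finally have "2 * (k * (\<Sum>e\<in>?E. e i)) = k ^ (card I - 1) * (2 * \<Sum>{..<k})" by simp
  also have "2 * \<Sum>{..<k} = k * (k - 1)"
  proof (induction k)
    case (Suc k)
    then show ?case by (cases k) (simp_all add: lessThan_Suc)
  qed simp
  finally have "k * (2 * (\<Sum>e\<in>?E. e i)) = k * (k ^ (card I - 1) * (k - 1))" by (simp add: ac_simps)
  then show ?thesis using assms(5) by simp
qed

text \<open>The summand for \<open>r = k\<close> comes from the exponent \<open>e = 0\<close>, where the difference \<open>\<Sum> e - k\<close> is truncated.\<close>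

lemma card_diff_index:
  assumes "finite I" "card I \<ge> 2" "k \<ge> 2" "r \<in> {1..k}"
  shows "2 * real k * real (card (diff_index k I r)) =
    real k ^ (card I - 1) * (real (card I) * (real k - 1) - 2 * real r) + (if r = k then 2 * real k else 0)"
proof -
  let ?E = "residue_exps k I r"
  have k: "k > 0" using assms by simp
  have ne: "I \<noteq> {}" using assms(2) by auto
  have coord: "2 * (\<Sum>e\<in>?E. e i) = k ^ (card I - 1) * (k - 1)" if i: "i \<in> I" for i
  proof -
    have "card (I - {i}) > 0" using assms i by simp
    then obtain i' where "i' \<in> I - {i}" by (metis card_gt_0_iff all_not_in_conv)
    then show ?thesis using sum_coordinate_residue_exps[OF assms(1) i, of i' k r] k by auto
  qed
  have "2 * (\<Sum>e\<in>?E. \<Sum>i\<in>I. e i) = (\<Sum>i\<in>I. 2 * (\<Sum>e\<in>?E. e i))"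
    by (subst sum.swap) (simp add: sum_distrib_left)
  also have "\<dots> = card I * (k ^ (card I - 1) * (k - 1))" using coord by simp
  finally have tot: "2 * (\<Sum>e\<in>?E. \<Sum>i\<in>I. e i) = card I * (k ^ (card I - 1) * (k - 1))" .
  have each: "real k * real (num_powers k I r e) = real (\<Sum>i\<in>I. e i) - real r + (if r = k \<and> (\<Sum>i\<in>I. e i) = 0 then real k else 0)"
    if e: "e \<in> ?E" for e
  proof -
    have md: "(\<Sum>i\<in>I. e i) mod k = r mod k" using e by (simp add: residue_exps_def)
    show ?thesis
    proof (cases "r \<le> (\<Sum>i\<in>I. e i)")
      case True
      then have "k dvd (\<Sum>i\<in>I. e i) - r" using md by (metis mod_eq_dvd_iff_nat)
      then have "k * num_powers k I r e = (\<Sum>i\<in>I. e i) - r" by (simp add: num_powers_def)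
      then have "real k * real (num_powers k I r e) = real ((\<Sum>i\<in>I. e i) - r)" by (metis of_nat_mult)
      then show ?thesis using True assms(4) by (simp add: of_nat_diff)
    next
      case False
      then have "(\<Sum>i\<in>I. e i) < k" "(\<Sum>i\<in>I. e i) < r" using assms(4) by auto
      then have "r = k \<and> (\<Sum>i\<in>I. e i) = 0" using md assms(4)
        by (metis atLeastAtMost_iff mod_less mod_self nat_less_le order_less_irrefl)
      then show ?thesis by (simp add: num_powers_def)
    qed
  qed
  have zero: "(\<Sum>e\<in>?E. if r = k \<and> (\<Sum>i\<in>I. e i) = 0 then real k else 0) = (if r = k then real k else 0)"
  proof (cases "r = k")
    case True
    have "{e \<in> ?E. (\<Sum>i\<in>I. e i) = 0} = {\<lambda>i\<in>I. 0}"
      using assms True by (auto simp: residue_exps_def fun_eq_iff PiE_def extensional_def restrict_def)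
    then show ?thesis using True
      by (simp add: sum.If_cases finite_residue_exps[OF assms(1)] Int_def)
  qed simp
  have "card (diff_index k I r) = (\<Sum>e\<in>?E. num_powers k I r e)"
    unfolding diff_index_def by (simp add: card_SigmaI finite_residue_exps[OF assms(1)])
  then have "2 * real k * real (card (diff_index k I r)) = 2 * (\<Sum>e\<in>?E. real k * real (num_powers k I r e))"
    by (simp add: sum_distrib_left mult.assoc)
  also have "(\<Sum>e\<in>?E. real k * real (num_powers k I r e)) =
      (\<Sum>e\<in>?E. real (\<Sum>i\<in>I. e i)) - real (card ?E) * real r + (if r = k then real k else 0)"
    unfolding zero[symmetric] by (simp add: each sum.distrib sum_subtractf cong: sum.cong)
  also have "2 * \<dots> = real (2 * (\<Sum>e\<in>?E. \<Sum>i\<in>I. e i)) - 2 * real (card ?E) * real r + (if r = k then 2 * real k else 0)"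
    by simp
  also have "\<dots> = real k ^ (card I - 1) * (real (card I) * (real k - 1) - 2 * real r) + (if r = k then 2 * real k else 0)"
    unfolding tot card_residue_exps[OF assms(1) ne k] using k by (simp add: algebra_simps of_nat_diff)
  finally show ?thesis .
qed

text \<open>Transfer between two coordinates where \<open>\<omega>\<close> differs permutes the summands and multiplies them by a
constant other than \<open>1\<close>.\<close>

lemma character_sum_residue_exps:
  fixes \<omega> :: "nat \<Rightarrow> complex"
  assumes "finite I" "i \<in> I" "i' \<in> I" "\<omega> i \<noteq> \<omega> i'" "k > 0" and roots: "\<And>l. l \<in> I \<Longrightarrow> \<omega> l ^ k = 1"
  shows "(\<Sum>e\<in>residue_exps k I r. \<Prod>l\<in>I. \<omega> l ^ e l) = 0"
proof -
  let ?E = "residue_exps k I r"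
  have pm: "\<omega> l ^ (m mod k) = \<omega> l ^ m" if "l \<in> I" for l m
  proof -
    have "\<omega> l ^ m = \<omega> l ^ (k * (m div k) + m mod k)" by simp
    then show ?thesis unfolding power_add power_mult roots[OF that] by simp
  qed
  have rot: "(\<Prod>l\<in>I. \<omega> l ^ rotate_exp k x d e l) = \<omega> x ^ d * (\<Prod>l\<in>I. \<omega> l ^ e l)" if "x \<in> I" for x d e
  proof -
    have rest: "(\<Prod>l\<in>I - {x}. \<omega> l ^ rotate_exp k x d e l) = (\<Prod>l\<in>I - {x}. \<omega> l ^ e l)"
      by (intro prod.cong) (auto simp: rotate_exp_def)
    have "\<omega> x ^ rotate_exp k x d e x = \<omega> x ^ d * \<omega> x ^ e x"
      unfolding rotate_exp_def fun_upd_same pm[OF that] by (simp add: power_add)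
    then show ?thesis using assms(1) that by (simp add: prod.remove[of I x] rest mult.assoc)
  qed
  have "(\<Sum>e\<in>?E. \<Prod>l\<in>I. \<omega> l ^ e l) = (\<Sum>e\<in>?E. \<Prod>l\<in>I. \<omega> l ^ transfer_exp k i i' 1 e l)"
    by (rule sum.reindex_bij_betw[OF bij_betw_transfer_exp[OF assms(1-3,5)], symmetric])
  also have "\<dots> = (\<Sum>e\<in>?E. \<omega> i' ^ (k - 1) * \<omega> i * (\<Prod>l\<in>I. \<omega> l ^ e l))"
    unfolding transfer_exp_def o_def rot[OF assms(3)] rot[OF assms(2)] by (simp add: mult.assoc)
  finally have eq: "(\<Sum>e\<in>?E. \<Prod>l\<in>I. \<omega> l ^ e l) = \<omega> i' ^ (k - 1) * \<omega> i * (\<Sum>e\<in>?E. \<Prod>l\<in>I. \<omega> l ^ e l)"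
    by (simp only: sum_distrib_left[symmetric])
  have "\<omega> i' ^ (k - 1) * \<omega> i \<noteq> 1"
  proof
    assume H: "\<omega> i' ^ (k - 1) * \<omega> i = 1"
    have "\<omega> i' * \<omega> i' ^ (k - 1) = 1" using roots[OF assms(3)] assms(5) by (cases k) auto
    then have "\<omega> i = \<omega> i' * \<omega> i' ^ (k - 1) * \<omega> i" by (simp only: mult_1)
    also have "\<dots> = \<omega> i'" by (simp only: mult.assoc H mult_1_right)
    finally show False using assms(4) by simp
  qed
  then show ?thesis using eq by simp
qed

text \<open>The residue \<open>0\<close> is represented by \<open>r = k\<close>, because gaps are positive.\<close>

definition gap_set :: "nat \<Rightarrow> nat set \<Rightarrow> (nat \<Rightarrow> complex) \<Rightarrow> nat set" where
  "gap_set k I c = (\<Union>r\<in>{1..k}. (\<lambda>m. r + k * m) ` vanishing_orders (diff_index k I r) (diff_fps k I c))"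

lemma weierstrass_weight_eq_sum:
  assumes "finite (weierstrass_gaps \<Phi> p)"
  shows "weierstrass_weight \<Phi> p = int (\<Sum>(weierstrass_gaps \<Phi> p)) - int (\<Sum>{1..card (weierstrass_gaps \<Phi> p)})"
proof -
  define A where "A = weierstrass_gaps \<Phi> p"
  define xs where "xs = sorted_list_of_set A"
  have len: "length xs = card A" by (simp add: xs_def)
  have "(\<Sum>i = 1..card A. int (xs ! (i - 1))) = (\<Sum>i<card A. int (xs ! i))"
    by (rule sum.reindex_bij_witness[of _ "\<lambda>i. i + 1" "\<lambda>i. i - 1"]) auto
  also have "\<dots> = int (sum_list xs)" using len by (simp add: sum_list_sum_nth atLeast0LessThan)
  also have "sum_list xs = \<Sum>A"
    using assms unfolding xs_def A_def by (metis distinct_sorted_list_of_set set_sorted_list_of_set sum_code map_idI sum_list_distinct_conv_sum_set sum.cong)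
  finally show ?thesis unfolding weierstrass_weight_def A_def[symmetric] xs_def[symmetric]
    by (simp add: sum_subtractf)
qed

text \<open>Here \<open>N = k ^ (n - 1)\<close> and \<open>m r\<close> is the dimension of the space of class \<open>r\<close>. Its sum over \<open>r\<close> is the
genus. The quantity \<open>A\<close>, which carries the dependence on \<open>n\<close>, cancels.\<close>

lemma weight_bound_identity:
  fixes k N A :: real and m :: "nat \<Rightarrow> real"
  assumes k: "k = real K" "K \<ge> 2" and m: "\<And>r. r \<in> {1..K} \<Longrightarrow> 2 * k * m r = N * (A - 2 * real r) + (if r = K then 2 * k else 0)"
    and A: "A = n * (k - 1)"
  shows "(\<Sum>r=1..K. real r * m r + k * (m r * (m r - 1) / 2)) - (\<Sum>r=1..K. m r) * ((\<Sum>r=1..K. m r) + 1) / 2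
     = 1 / 24 * (k - 1) * (N - 2) * (k * N + N - 12)"
proof -
  define P where "P = N / (2 * k)"
  have k0: "k > 0" using k by simp
  have N: "N = 2 * k * P" using k0 by (simp add: P_def)
  have mr: "m r = P * (A - 2 * real r) + (if r = K then 1 else 0)" if "r \<in> {1..K}" for r
  proof -
    have "2 * k * m r = 2 * k * (P * (A - 2 * real r) + (if r = K then 1 else 0))"
      using m[OF that] unfolding N by (simp add: algebra_simps split: if_splits)
    then show ?thesis using k0 by simp
  qed
  have s1: "(\<Sum>r=1..K. real r) = k * (k + 1) / 2"
    unfolding k(1) by (induction K) (auto simp: field_simps)
  have s2: "(\<Sum>r=1..K. real r ^ 2) = k * (k + 1) * (2 * k + 1) / 6"
    unfolding k(1) by (induction K) (auto simp: field_simps power2_eq_square)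
  have s0: "(\<Sum>r=1..K. a) = k * a" for a :: real using k by simp
  have g: "(\<Sum>r=1..K. m r) = P * (k * A - k * (k + 1)) + 1"
  proof -
    have "(\<Sum>r=1..K. m r) = (\<Sum>r=1..K. P * A - 2 * P * real r + (if r = K then 1 else 0))"
      by (intro sum.cong refl) (simp add: mr algebra_simps)
    also have "\<dots> = k * (P * A) - 2 * P * (\<Sum>r=1..K. real r) + 1"
      using k by (simp add: sum.distrib sum_subtractf sum_distrib_left)
    finally show ?thesis unfolding s1 by (simp add: field_simps)
  qed
  define B0 where "B0 = k / 2 * (P^2 * A^2 - P * A)"
  define B1 where "B1 = P * A + k / 2 * (2 * P - 4 * P^2 * A)"
  define B2 where "B2 = - 2 * P + k / 2 * (4 * P^2)"
  have T: "(\<Sum>r=1..K. real r * m r + k * (m r * (m r - 1) / 2)) =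
     k * B0 + B1 * (k * (k + 1) / 2) + B2 * (k * (k + 1) * (2 * k + 1) / 6) + (k + k * (P * (A - 2 * k)))"
  proof -
    have "(\<Sum>r=1..K. real r * m r + k * (m r * (m r - 1) / 2)) =
       (\<Sum>r=1..K. B0 + B1 * real r + B2 * real r ^ 2 + (if r = K then k + k * (P * (A - 2 * k)) else 0))"
      by (intro sum.cong refl) (auto simp: mr k(1) B0_def B1_def B2_def field_simps power2_eq_square)
    also have "\<dots> = (\<Sum>r=1..K. B0) + B1 * (\<Sum>r=1..K. real r) + B2 * (\<Sum>r=1..K. real r ^ 2) + (k + k * (P * (A - 2 * k)))"
      using k by (simp add: sum.distrib sum_distrib_left)
    finally show ?thesis unfolding s0 s1 s2 .
  qed
  show ?thesis unfolding T g N B0_def B1_def B2_def by (simp add: field_simps power2_eq_square)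
qed

lemma sum_gap_set:
  assumes "finite I" "k > 0" "inj_on c I"
  shows "finite (gap_set k I c)"
    and "card (gap_set k I c) = (\<Sum>r=1..k. card (diff_index k I r))"
    and "\<Sum>(gap_set k I c) = (\<Sum>r=1..k. r * card (diff_index k I r) + k * \<Sum>(vanishing_orders (diff_index k I r) (diff_fps k I c)))"
proof -
  let ?O = "\<lambda>r. vanishing_orders (diff_index k I r) (diff_fps k I c)"
  have O: "finite (?O r)" "card (?O r) = card (diff_index k I r)" for r
    using card_vanishing_orders[OF finite_diff_index[OF assms(1)] lin_indep_diff_fps[OF assms(2,1,3)]] by auto
  have inj: "inj_on (\<lambda>m. r + k * m) A" for r A using assms(2) by (auto simp: inj_on_def)
  have disj: "\<forall>r\<in>{1..k}. \<forall>r'\<in>{1..k}. r \<noteq> r' \<longrightarrow> (\<lambda>m. r + k * m) ` ?O r \<inter> (\<lambda>m. r' + k * m) ` ?O r' = {}"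
  proof (intro ballI impI, rule ccontr)
    fix r r' assume r: "r \<in> {1..k}" "r' \<in> {1..k}" "r \<noteq> r'"
      and "(\<lambda>m. r + k * m) ` ?O r \<inter> (\<lambda>m. r' + k * m) ` ?O r' \<noteq> {}"
    then obtain m m' where "r + k * m = r' + k * m'" by auto
    then have "(r - 1) + k * m = (r' - 1) + k * m'" using r by auto
    then have "((r - 1) + k * m) mod k = ((r' - 1) + k * m') mod k" by simp
    moreover have "r - 1 < k" "r' - 1 < k" using r by auto
    ultimately have "r - 1 = r' - 1" by simp
    then show False using r by auto
  qed
  show "finite (gap_set k I c)" unfolding gap_set_def using O by auto
  show "card (gap_set k I c) = (\<Sum>r=1..k. card (diff_index k I r))"
    unfolding gap_set_def using O disj by (subst card_UN_disjoint) (auto simp: card_image inj)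
  have "\<Sum>(gap_set k I c) = (\<Sum>r=1..k. \<Sum>((\<lambda>m. r + k * m) ` ?O r))"
    unfolding gap_set_def using O disj by (subst sum.UNION_disjoint) auto
  also have "\<dots> = (\<Sum>r=1..k. r * card (diff_index k I r) + k * \<Sum>(?O r))"
    by (intro sum.cong refl) (simp add: sum.reindex[OF inj] sum.distrib sum_distrib_left O)
  finally show "\<Sum>(gap_set k I c) = (\<Sum>r=1..k. r * card (diff_index k I r) + k * \<Sum>(?O r))" .
qed

text \<open>A set of \<open>m\<close> natural numbers has the least sum iff it is \<open>{0..<m}\<close>. This is applied to each of the
\<open>k\<close> sets of vanishing orders, whose sizes do not depend on the parameters.\<close>

lemma gap_set_weight:
  assumes I: "finite I" "card I = n" "n \<ge> 2" and k: "k \<ge> 2" and c: "inj_on c I"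
    and gaps: "weierstrass_gaps \<Phi> p = gap_set k I c"
  shows "weight_bound k n \<le> real_of_int (weierstrass_weight \<Phi> p)"
    and "(\<And>r. r \<in> {1..k} \<Longrightarrow> uninflected (diff_index k I r) (diff_fps k I c)) \<Longrightarrow>
          real_of_int (weierstrass_weight \<Phi> p) = weight_bound k n"
proof -
  let ?O = "\<lambda>r. vanishing_orders (diff_index k I r) (diff_fps k I c)"
  let ?m = "\<lambda>r. real (card (diff_index k I r))"
  have k0: "k > 0" using k by simp
  note S = sum_gap_set[OF I(1) k0 c]
  have O: "card (?O r) = card (diff_index k I r)" for r
    using card_vanishing_orders[OF finite_diff_index[OF I(1)] lin_indep_diff_fps[OF k0 I(1) c]] by auto
  have tri: "real (\<Sum>{0..<m}) = real m * (real m - 1) / 2" for m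
    by (induction m) (auto simp: field_simps)
  have tri1: "real (\<Sum>{1..m}) = real m * (real m + 1) / 2" for m :: nat
    by (induction m) (auto simp: field_simps)
  have w: "real_of_int (weierstrass_weight \<Phi> p) =
     (\<Sum>r=1..k. real r * ?m r + real k * real (\<Sum>(?O r))) - (\<Sum>r=1..k. ?m r) * ((\<Sum>r=1..k. ?m r) + 1) / 2"
    unfolding weierstrass_weight_eq_sum[of \<Phi> p, unfolded gaps, OF S(1)] S(2,3) of_int_diff of_int_of_nat_eq tri1 by simp
  have N: "real k ^ n = real k * real k ^ (n - 1)" using I by (cases n) auto
  have bound: "(\<Sum>r=1..k. real r * ?m r + real k * (?m r * (?m r - 1) / 2)) - (\<Sum>r=1..k. ?m r) * ((\<Sum>r=1..k. ?m r) + 1) / 2 = weight_bound k n"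
    unfolding weight_bound_def N
    by (rule weight_bound_identity[where A = "real n * (real k - 1)"])
       (use card_diff_index[OF I(1) _ k] I k in auto)
  have "real k * (?m r * (?m r - 1) / 2) \<le> real k * real (\<Sum>(?O r))" for r
  proof -
    have "\<Sum>{0..<card (?O r)} \<le> \<Sum>(?O r)" by (rule card_sum_le_nat_sum)
    then have "real (\<Sum>{0..<card (?O r)}) \<le> real (\<Sum>(?O r))" by (simp only: of_nat_le_iff)
    then show ?thesis unfolding tri O by (intro mult_left_mono) auto
  qed
  then show "weight_bound k n \<le> real_of_int (weierstrass_weight \<Phi> p)"
    unfolding w bound[symmetric] by (intro diff_right_mono sum_mono add_left_mono) auto
  assume u: "\<And>r. r \<in> {1..k} \<Longrightarrow> uninflected (diff_index k I r) (diff_fps k I c)"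
  have "real (\<Sum>(?O r)) = ?m r * (?m r - 1) / 2" if "r \<in> {1..k}" for r
    unfolding vanishing_orders_if_uninflected[OF finite_diff_index[OF I(1)] u[OF that]] tri[symmetric]
    by (simp add: atLeast0LessThan)
  then have "(\<Sum>r=1..k. real r * ?m r + real k * real (\<Sum>(?O r))) =
      (\<Sum>r=1..k. real r * ?m r + real k * (?m r * (?m r - 1) / 2))"
    by (intro sum.cong refl) (simp only:)
  then show "real_of_int (weierstrass_weight \<Phi> p) = weight_bound k n"
    unfolding w bound[symmetric] by (simp only:)
qed

section \<open>The curve as a cyclic cover and its local parametrizations\<close>

lemma proj_pt_scale: "a \<noteq> 0 \<Longrightarrow> proj_pt (\<lambda>i. a * x i) = proj_pt x"
proof -
  assume a: "a \<noteq> 0"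
  have "\<exists>d. (\<lambda>i. e * x i) = (\<lambda>i. d * (a * x i)) \<and> d \<noteq> 0" if "e \<noteq> 0" for e
    using a that by (intro exI[of _ "e / a"]) (auto simp: fun_eq_iff)
  moreover have "\<exists>d. (\<lambda>i. e * (a * x i)) = (\<lambda>i. d * x i) \<and> d \<noteq> 0" if "e \<noteq> 0" for e
    using a that by (intro exI[of _ "e * a"]) (auto simp: fun_eq_iff)
  ultimately show ?thesis unfolding proj_pt_def by fast
qed

lemma proj_pt_eqD: "proj_pt x = proj_pt y \<Longrightarrow> \<exists>a. a \<noteq> 0 \<and> y = (\<lambda>i. a * x i)"
proof -
  assume "proj_pt x = proj_pt y"
  moreover have "y \<in> proj_pt y" unfolding proj_pt_def by (auto intro!: exI[of _ 1])
  ultimately have "y \<in> proj_pt x" by simp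
  then show ?thesis unfolding proj_pt_def by blast
qed

lemma mem_proj_pt_self: "x \<in> proj_pt x"
  unfolding proj_pt_def by (auto intro!: exI[of _ 1])

lemma mem_proj_ptD: "y \<in> proj_pt x \<Longrightarrow> \<exists>a. a \<noteq> 0 \<and> y = (\<lambda>i. a * x i)"
  unfolding proj_pt_def by blast

lemma eventually_nhds_isCont:
  assumes "isCont f z" "open S" "f z \<in> S"
  shows "eventually (\<lambda>w. f w \<in> S) (nhds z)"
proof -
  have "(f \<longlongrightarrow> f z) (nhds z)"
    using assms(1) unfolding isCont_def by (simp only: tendsto_at_iff_tendsto_nhds)
  then show ?thesis using assms(2,3) by (rule topological_tendstoD)
qed

text \<open>A coordinate that is constant fixes the scaling, and a coordinate that is linear then shows
injectivity and immersion. The parametrizations below have this form.\<close>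

lemma local_paramsI:
  assumes D: "open D" and hom: "\<And>z. z \<in> D \<Longrightarrow> \<Psi> z \<in> hom_coords n"
    and X: "\<And>z. z \<in> D \<Longrightarrow> proj_pt (\<Psi> z) \<in> X"
    and hol: "\<And>i. i \<le> n \<Longrightarrow> (\<lambda>z. \<Psi> z i) holomorphic_on D"
    and \<alpha>: "\<alpha> \<le> n" "\<kappa> \<noteq> 0" "\<And>z. z \<in> D \<Longrightarrow> \<Psi> z \<alpha> = \<kappa>"
    and \<beta>: "\<beta> \<le> n" "s \<noteq> 0" "\<And>z. z \<in> D \<Longrightarrow> \<Psi> z \<beta> = s * z"
  shows "(D, \<lambda>z. proj_pt (\<Psi> z)) \<in> local_params n X"
proof -
  have "inj_on (\<lambda>z. proj_pt (\<Psi> z)) D"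
  proof (rule inj_onI)
    fix z w assume zw: "z \<in> D" "w \<in> D" "proj_pt (\<Psi> z) = proj_pt (\<Psi> w)"
    then obtain a where a: "\<Psi> w = (\<lambda>i. a * \<Psi> z i)" using proj_pt_eqD by blast
    have "\<kappa> = a * \<kappa>" using fun_cong[OF a, of \<alpha>] \<alpha>(3) zw by simp
    then have "a = 1" using \<alpha>(2) by simp
    then show "z = w" using fun_cong[OF a, of \<beta>] \<beta> zw by simp
  qed
  moreover have "\<not> (\<exists>e. \<forall>i\<le>n. deriv (\<lambda>w. \<Psi> w i) z = e * \<Psi> z i)" if z: "z \<in> D" for z
  proof
    assume "\<exists>e. \<forall>i\<le>n. deriv (\<lambda>w. \<Psi> w i) z = e * \<Psi> z i"
    then obtain e where e: "\<And>i. i \<le> n \<Longrightarrow> deriv (\<lambda>w. \<Psi> w i) z = e * \<Psi> z i" by blast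
    have "((\<lambda>w. \<Psi> w \<alpha>) has_field_derivative 0) (at z)"
      by (rule has_field_derivative_transform_within_open[OF _ D z, of "\<lambda>_. \<kappa>"]) (auto simp: \<alpha>)
    then have "e = 0" using e[OF \<alpha>(1)] \<alpha> z by (simp add: DERIV_imp_deriv)
    have "((\<lambda>w. s * w) has_field_derivative s) (at z)" by (auto intro!: derivative_eq_intros)
    then have "((\<lambda>w. \<Psi> w \<beta>) has_field_derivative s) (at z)"
      by (rule has_field_derivative_transform_within_open[OF _ D z]) (auto simp: \<beta>)
    then show False using e[OF \<beta>(1)] \<open>e = 0\<close> \<beta>(2) by (simp add: DERIV_imp_deriv)
  qed
  ultimately show ?thesis
    unfolding local_params_def using assms by (auto intro!: exI[of _ \<Psi>])
qed

lemma local_paramsE: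
  assumes "(D, \<psi>) \<in> local_params n X"
  obtains \<Psi> where "open D" "inj_on \<psi> D" "\<psi> ` D \<subseteq> X" "\<And>z. z \<in> D \<Longrightarrow> \<Psi> z \<in> hom_coords n"
    "\<And>z. z \<in> D \<Longrightarrow> \<psi> z = proj_pt (\<Psi> z)" "\<And>i. i \<le> n \<Longrightarrow> (\<lambda>z. \<Psi> z i) holomorphic_on D"
proof -
  from assms obtain \<Psi> where "open D" "inj_on \<psi> D" "\<psi> ` D \<subseteq> X"
    and \<Psi>: "\<forall>z\<in>D. \<Psi> z \<in> hom_coords n \<and> \<psi> z = proj_pt (\<Psi> z)" "\<forall>i\<le>n. (\<lambda>z. \<Psi> z i) holomorphic_on D"
    unfolding local_params_def by blast
  show ?thesis
    by (rule that[of \<Psi>]) (use \<open>open D\<close> \<open>inj_on \<psi> D\<close> \<open>\<psi> ` D \<subseteq> X\<close> \<Psi> in simp_all)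
qed

text \<open>The curve seen from the coordinate \<open>x\<^sub>j\<close>. The factors \<open>b\<close> are chosen such that the point of interest
is \<open>x\<^sub>j = 0\<close>, \<open>x\<^sub>i = b\<^sub>i\<close>; with \<open>y\<^sub>i = x\<^sub>i / (b\<^sub>i x\<^sub>j)\<close> the equations become \<open>y\<^sub>i ^ k = z - c\<^sub>i\<close> where
\<open>z = y\<^sub>j\<^sub>0 ^ k\<close>.\<close>

locale fermat_cover =
  fixes k n j j0 :: nat and b c :: "nat \<Rightarrow> complex" and X :: "(nat \<Rightarrow> complex) set set" and I :: "nat set"
  assumes k: "k \<ge> 2" and j: "j \<le> n" and j0: "j0 \<in> I"
    and I: "I = {..n} - {j}"
    and c0: "c j0 = 0" and b0: "b j0 = 1" and b: "\<And>i. b i \<noteq> 0" and c: "inj_on c I"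
    and X: "X = {P \<in> proj_space n. \<forall>x\<in>P. \<forall>i\<in>I. x i ^ k = b i ^ k * (x j0 ^ k - c i * x j ^ k)}"
begin

lemma finI: "finite I" and k0: "k > 0" and I_le: "i \<in> I \<Longrightarrow> i \<le> n"
  and mem_I: "i \<in> I \<longleftrightarrow> i \<le> n \<and> i \<noteq> j"
  using k by (auto simp: I)

text \<open>Vectors are written in the coordinates \<open>t\<close> for \<open>x\<^sub>j\<close> and \<open>y\<^sub>i\<close> for \<open>x\<^sub>i / b\<^sub>i\<close>, which makes the affine part
\<open>t = 1\<close> and the points at infinity \<open>t = 0\<close>.\<close>

definition coords :: "complex \<Rightarrow> (nat \<Rightarrow> complex) \<Rightarrow> nat \<Rightarrow> complex" where
  "coords t y = (\<lambda>i. if i = j then t else if i \<in> I then b i * y i else 0)"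

definition on_cone :: "complex \<Rightarrow> (nat \<Rightarrow> complex) \<Rightarrow> bool" where
  "on_cone t y \<longleftrightarrow> (\<forall>i\<in>I. y i ^ k = y j0 ^ k - c i * t ^ k)"

definition roots :: "complex set" where "roots = {\<zeta>. \<zeta> ^ k = 1}"

text \<open>Tuples of roots of unity, multiplying the \<open>y\<^sub>i\<close>. The diagonal tuples fix every point at infinity.\<close>

definition deck :: "(nat \<Rightarrow> complex) set" where "deck = I \<rightarrow>\<^sub>E roots"

definition monom_at :: "(nat \<Rightarrow> nat) \<Rightarrow> (nat \<Rightarrow> complex) \<Rightarrow> complex" where
  "monom_at e y = (\<Prod>i\<in>I. y i ^ e i)"

definition kroot :: "nat \<Rightarrow> complex \<Rightarrow> complex" where
  "kroot i t = (1 - c i * t ^ k) powr (1 / of_nat k)"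

definition centre :: "(nat \<Rightarrow> complex) set" where "centre = proj_pt (coords 0 (\<lambda>_. 1))"

text \<open>A local parametrization at the point at infinity with coordinates \<open>\<omega>\<close>. In affine coordinates it is
\<open>y\<^sub>i = \<omega>\<^sub>i (1 - c\<^sub>i t ^ k) ^ (1 / k) / t\<close>.\<close>

definition at_infinity_pt :: "(nat \<Rightarrow> complex) \<Rightarrow> complex \<Rightarrow> (nat \<Rightarrow> complex) set" where
  "at_infinity_pt \<omega> t = proj_pt (coords t (\<lambda>i. \<omega> i * kroot i t))"

lemma coords_simps [simp]: "coords t y j = t" "i \<in> I \<Longrightarrow> coords t y i = b i * y i" "i > n \<Longrightarrow> coords t y i = 0"
  using j by (auto simp: coords_def mem_I)

lemma coords_cong: "(\<And>i. i \<in> I \<Longrightarrow> y i = y' i) \<Longrightarrow> coords t y = coords t y'"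
  by (auto simp: coords_def)

lemma coords_scale: "coords (a * t) (\<lambda>i. a * y i) = (\<lambda>i. a * coords t y i)"
  by (auto simp: coords_def)

lemma coords_hom: "t \<noteq> 0 \<or> (\<exists>i\<in>I. y i \<noteq> 0) \<Longrightarrow> coords t y \<in> hom_coords n"
  unfolding hom_coords_def using j b by (auto simp: coords_def mem_I intro: exI[of _ j])

lemma on_coneD: "on_cone t y \<Longrightarrow> i \<in> I \<Longrightarrow> y i ^ k = y j0 ^ k - c i * t ^ k"
  by (simp add: on_cone_def)

lemma on_coneI: "(\<And>i. i \<in> I \<Longrightarrow> y i ^ k = y j0 ^ k - c i * t ^ k) \<Longrightarrow> on_cone t y"
  unfolding on_cone_def by blast

lemma coords_mem: "on_cone t y \<Longrightarrow> t \<noteq> 0 \<or> (\<exists>i\<in>I. y i \<noteq> 0) \<Longrightarrow> proj_pt (coords t y) \<in> X"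
proof -
  assume cone: "on_cone t y" and nz: "t \<noteq> 0 \<or> (\<exists>i\<in>I. y i \<noteq> 0)"
  have "x i ^ k = b i ^ k * (x j0 ^ k - c i * x j ^ k)" if x: "x \<in> proj_pt (coords t y)" and i: "i \<in> I" for x i
  proof -
    obtain a where a: "x = (\<lambda>i. a * coords t y i)" using mem_proj_ptD[OF x] by blast
    show ?thesis unfolding a using i j0 by (simp add: power_mult_distrib on_coneD[OF cone i] b0 algebra_simps)
  qed
  then show ?thesis unfolding X proj_space_def using coords_hom[OF nz] by blast
qed

lemma point_coords:
  assumes "x \<in> hom_coords n" "proj_pt x \<in> X"
  shows "x = coords (x j) (\<lambda>i. x i / b i)" and "on_cone (x j) (\<lambda>i. x i / b i)"
proof -
  show "x = coords (x j) (\<lambda>i. x i / b i)"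
    using assms(1) b by (auto simp: fun_eq_iff coords_def hom_coords_def mem_I not_le)
  have "x i ^ k = b i ^ k * (x j0 ^ k - c i * x j ^ k)" if "i \<in> I" for i
    using assms(2) mem_proj_pt_self[of x] that unfolding X by blast
  then have "(x i / b i) ^ k = x j0 ^ k - c i * x j ^ k" if "i \<in> I" for i
    using that b[of i] by (simp add: power_divide)
  then show "on_cone (x j) (\<lambda>i. x i / b i)"
    by (intro on_coneI) (simp only: b0 div_by_1)
qed

lemma deckD: "\<omega> \<in> deck \<Longrightarrow> i \<in> I \<Longrightarrow> \<omega> i ^ k = 1"
  by (auto simp: deck_def roots_def)

lemma roots_nz: "\<zeta> \<in> roots \<Longrightarrow> \<zeta> \<noteq> 0"
  using k0 by (auto simp: roots_def power_0_left)

lemma deck_root: "\<omega> \<in> deck \<Longrightarrow> i \<in> I \<Longrightarrow> \<omega> i \<in> roots"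
  unfolding deck_def by (rule PiE_mem)

lemma deck_nz: "\<omega> \<in> deck \<Longrightarrow> i \<in> I \<Longrightarrow> \<omega> i \<noteq> 0"
  by (rule roots_nz[OF deck_root])

lemma finite_roots: "finite roots"
  unfolding roots_def using k by (intro finite_roots_unity) simp

lemma finite_deck: "finite deck"
  unfolding deck_def using finite_roots finI by (intro finite_PiE) auto

lemma monom_at_mult: "monom_at e (\<lambda>i. u i * y i) = monom_at e u * monom_at e y"
  by (simp add: monom_at_def power_mult_distrib prod.distrib)

lemma monom_at_divide: "monom_at e (\<lambda>i. y i / t) = monom_at e y / t ^ (\<Sum>i\<in>I. e i)"
  by (simp add: monom_at_def power_divide prod_dividef power_sum)

lemma monom_at_const: "monom_at e (\<lambda>_. t) = t ^ (\<Sum>i\<in>I. e i)"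
  by (simp add: monom_at_def power_sum)

lemma monom_at_nz: "(\<And>i. i \<in> I \<Longrightarrow> y i \<noteq> 0) \<Longrightarrow> monom_at e y \<noteq> 0"
  using finI by (simp add: monom_at_def)

lemma powr_kth [simp]: "((w::complex) powr (1 / of_nat k)) ^ k = w"
proof (cases "w = 0")
  case True then show ?thesis using k0 by (simp add: power_0_left)
next
  case False
  have "(w powr (1 / of_nat k)) ^ k = exp (1 / of_nat k * Ln w) ^ k"
    using False by (simp add: powr_def)
  also have "\<dots> = exp (of_nat k * (1 / of_nat k * Ln w))" by (rule exp_of_nat_mult[symmetric])
  finally show ?thesis using False k0 by simp
qed

definition rad :: real where
  "rad = min 1 (1 / (1 + (\<Sum>i\<in>I. norm (c i))))"

lemma rad_pos: "rad > 0"
  unfolding rad_def by (auto intro!: add_pos_nonneg sum_nonneg)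

lemma rad_small:
  fixes t :: complex
  assumes "i \<in> I" "t \<in> ball 0 rad"
  shows "norm (c i * t ^ k) < 1"
proof -
  define M where "M = 1 + (\<Sum>i\<in>I. norm (c i))"
  have M: "M > 0" unfolding M_def by (intro add_pos_nonneg sum_nonneg) auto
  have cM: "norm (c i) \<le> M" using member_le_sum[OF assms(1), of "\<lambda>i. norm (c i)"] finI by (simp add: M_def)
  have t: "norm t < 1" "norm t < 1 / M" using assms(2) by (auto simp: rad_def M_def)
  have "norm t ^ k \<le> norm t ^ 1" using t k0 by (intro power_decreasing) auto
  then have "norm (t ^ k) < 1 / M" using t by (simp add: norm_power)
  then have "M * norm (t ^ k) < 1" using M by (simp add: field_simps)
  moreover have "norm (c i) * norm (t ^ k) \<le> M * norm (t ^ k)" using cM by (intro mult_right_mono) auto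
  ultimately show ?thesis by (simp add: norm_mult)
qed

lemma kroot_holomorphic: "i \<in> I \<Longrightarrow> kroot i holomorphic_on ball 0 rad"
  unfolding kroot_def
proof (intro holomorphic_intros)
  fix t :: complex assume "i \<in> I" "t \<in> ball 0 rad"
  then have "Re (1 - c i * t ^ k) > 0" by (intro Re_one_minus_pos rad_small)
  then show "1 - c i * t ^ k \<notin> \<real>\<^sub>\<le>\<^sub>0" by (auto simp: complex_nonpos_Reals_iff)
qed

lemma kroot_power: "kroot i t ^ k = 1 - c i * t ^ k" by (simp add: kroot_def)

lemma one_minus_nz: "i \<in> I \<Longrightarrow> t \<in> ball 0 rad \<Longrightarrow> 1 - c i * t ^ k \<noteq> 0"
  using Re_one_minus_pos[OF rad_small] by (metis less_irrefl zero_complex.sel(1))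

lemma kroot_nz: "i \<in> I \<Longrightarrow> t \<in> ball 0 rad \<Longrightarrow> kroot i t \<noteq> 0"
  using one_minus_nz by (simp add: kroot_def)

lemma kroot_0 [simp]: "kroot i 0 = 1" using k0 by (simp add: kroot_def power_0_left)

lemma kroot_j0 [simp]: "kroot j0 t = 1" by (simp add: kroot_def c0)

text \<open>With the principal branches, the radical function is the inverse of the leading factor of \<open>y ^ e\<close> at
infinity.\<close>

lemma radical_fun_monom_at:
  fixes t :: complex
  assumes "t \<in> ball 0 rad"
  shows "radical_fun k I c e (t ^ k) * monom_at e (\<lambda>i. kroot i t) = 1"
proof -
  have "(1 - c i * t ^ k) powr (- (of_nat (e i) / of_nat k)) * kroot i t ^ e i = 1" if "i \<in> I" for i
  proof -
    have w: "1 - c i * t ^ k \<noteq> 0" by (rule one_minus_nz[OF that assms])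
    have "kroot i t ^ e i = exp (of_nat (e i) / of_nat k * Ln (1 - c i * t ^ k))"
      using w by (simp add: kroot_def powr_def exp_of_nat_mult[symmetric])
    then show ?thesis using w by (simp add: powr_def exp_minus)
  qed
  then show ?thesis unfolding radical_fun_def monom_at_def prod.distrib[symmetric] by simp
qed

lemma at_infinity_cone: "\<omega> \<in> deck \<Longrightarrow> on_cone t (\<lambda>i. \<omega> i * kroot i t)"
  by (rule on_coneI) (simp add: power_mult_distrib kroot_power deckD j0)

lemma at_infinity_local_params:
  assumes "\<omega> \<in> deck"
  shows "(ball 0 rad, at_infinity_pt \<omega>) \<in> local_params n X"
  unfolding at_infinity_pt_def
proof (rule local_paramsI[where \<alpha> = j0 and \<kappa> = "\<omega> j0" and \<beta> = j and s = 1])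
  fix z :: complex assume z: "z \<in> ball 0 rad"
  have nz: "z \<noteq> 0 \<or> (\<exists>i\<in>I. \<omega> i * kroot i z \<noteq> 0)"
    using j0 deck_nz[OF assms j0] by (intro disjI2 bexI[of _ j0]) auto
  show "coords z (\<lambda>i. \<omega> i * kroot i z) \<in> hom_coords n" by (rule coords_hom[OF nz])
  show "proj_pt (coords z (\<lambda>i. \<omega> i * kroot i z)) \<in> X" by (rule coords_mem[OF at_infinity_cone[OF assms] nz])
next
  fix i assume "i \<le> n"
  then consider "i = j" | "i \<in> I" by (auto simp: mem_I)
  then show "(\<lambda>z. coords z (\<lambda>i. \<omega> i * kroot i z) i) holomorphic_on ball 0 rad"
    by cases (auto intro!: holomorphic_intros kroot_holomorphic)
qed (use j0 I_le j deck_nz[OF assms] b0 in auto)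

lemma at_infinity_eq_centre_iff:
  assumes "\<omega> \<in> deck" "t \<in> ball 0 rad"
  shows "at_infinity_pt \<omega> t = centre \<longleftrightarrow> t = 0 \<and> (\<forall>i\<in>I. \<omega> i = \<omega> j0)"
proof
  assume "at_infinity_pt \<omega> t = centre"
  then obtain a where a: "coords t (\<lambda>i. \<omega> i * kroot i t) = (\<lambda>i. a * coords 0 (\<lambda>_. 1) i)"
    unfolding at_infinity_pt_def centre_def using proj_pt_eqD by metis
  have t0: "t = 0" using fun_cong[OF a, of j] by simp
  have "\<omega> i = a" if "i \<in> I" for i using fun_cong[OF a, of i] that b[of i] t0 by simp
  then show "t = 0 \<and> (\<forall>i\<in>I. \<omega> i = \<omega> j0)" using j0 t0 by simp
next
  assume H: "t = 0 \<and> (\<forall>i\<in>I. \<omega> i = \<omega> j0)"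
  have "coords t (\<lambda>i. \<omega> i * kroot i t) = (\<lambda>i. \<omega> j0 * coords 0 (\<lambda>_. 1) i)"
    using H by (auto simp: coords_def fun_eq_iff)
  then show "at_infinity_pt \<omega> t = centre"
    unfolding at_infinity_pt_def centre_def using proj_pt_scale[OF deck_nz[OF assms(1) j0]] by simp
qed

lemma kroot_twist: "\<zeta> ^ k = 1 \<Longrightarrow> kroot i (\<zeta> * t) = kroot i t"
  by (simp add: kroot_def power_mult_distrib)

text \<open>A local section of the cover with \<open>y\<^sub>i\<^sub>1 = \<tau>\<close> as the parameter, through the affine point \<open>y0\<close>. Since
\<open>z = c\<^sub>i\<^sub>1 + \<tau> ^ k\<close>, it is available both at unramified points and at the points over \<open>z = c\<^sub>i\<^sub>1\<close>.\<close>

definition branch :: "nat \<Rightarrow> (nat \<Rightarrow> complex) \<Rightarrow> complex \<Rightarrow> nat \<Rightarrow> complex" where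
  "branch i1 y0 \<tau> = (\<lambda>l. if l = i1 then \<tau> else y0 l * ((c i1 + \<tau> ^ k - c l) / y0 l ^ k) powr (1 / of_nat k))"

definition branch_dom :: "nat \<Rightarrow> (nat \<Rightarrow> complex) \<Rightarrow> complex set" where
  "branch_dom i1 y0 = (\<Inter>l\<in>I - {i1}. {\<tau>. Re ((c i1 + \<tau> ^ k - c l) / y0 l ^ k) > 0})"

lemma open_branch_dom: "open (branch_dom i1 y0)"
  unfolding branch_dom_def
proof (intro open_INT ballI)
  fix l assume "l \<in> I - {i1}"
  show "open {\<tau>. Re ((c i1 + \<tau> ^ k - c l) / y0 l ^ k) > 0}"
    unfolding divide_inverse by (intro open_Collect_less continuous_intros)
qed (use finI in auto)

lemma branch_domD: "\<tau> \<in> branch_dom i1 y0 \<Longrightarrow> l \<in> I \<Longrightarrow> l \<noteq> i1 \<Longrightarrow> Re ((c i1 + \<tau> ^ k - c l) / y0 l ^ k) > 0"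
  by (auto simp: branch_dom_def)

lemma branch_base_nz:
  assumes "\<tau> \<in> branch_dom i1 y0" "l \<in> I" "l \<noteq> i1"
  shows "y0 l ^ k \<noteq> 0"
proof
  assume "y0 l ^ k = 0"
  with branch_domD[OF assms] show False by (simp only: div_by_0 zero_complex.sel less_irrefl)
qed

lemma branch_power:
  assumes "\<tau> \<in> branch_dom i1 y0" "l \<in> I"
  shows "branch i1 y0 \<tau> l ^ k = c i1 + \<tau> ^ k - c l"
proof (cases "l = i1")
  case False
  then have "y0 l ^ k \<noteq> 0" using branch_base_nz[OF assms] by blast
  then show ?thesis using False by (simp add: branch_def power_mult_distrib)
qed (simp add: branch_def)

lemma branch_nz: "\<tau> \<in> branch_dom i1 y0 \<Longrightarrow> l \<in> I \<Longrightarrow> l \<noteq> i1 \<Longrightarrow> branch i1 y0 \<tau> l \<noteq> 0"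
  using branch_power[of \<tau> i1 y0 l] branch_domD[of \<tau> i1 y0 l] k0 by (auto simp: power_0_left)

lemma branch_cone: "\<tau> \<in> branch_dom i1 y0 \<Longrightarrow> on_cone 1 (branch i1 y0 \<tau>)"
  by (rule on_coneI) (simp add: branch_power j0 c0)

lemma branch_holomorphic:
  assumes "l \<in> I"
  shows "(\<lambda>\<tau>. branch i1 y0 \<tau> l) holomorphic_on branch_dom i1 y0"
proof (cases "l = i1")
  case False
  have "(c i1 + \<tau> ^ k - c l) / y0 l ^ k \<notin> \<real>\<^sub>\<le>\<^sub>0" if "\<tau> \<in> branch_dom i1 y0" for \<tau>
    using branch_domD[OF that assms False] by (auto simp: complex_nonpos_Reals_iff)
  moreover have "y0 l ^ k \<noteq> 0" if "\<tau> \<in> branch_dom i1 y0" for \<tau>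
    using branch_base_nz[OF that assms False] .
  ultimately show ?thesis using False unfolding branch_def by (auto intro!: holomorphic_intros)
qed (simp add: branch_def)

lemma branch_local_params:
  assumes "i1 \<in> I"
  shows "(branch_dom i1 y0, \<lambda>\<tau>. proj_pt (coords 1 (branch i1 y0 \<tau>))) \<in> local_params n X"
proof (rule local_paramsI[where \<alpha> = j and \<kappa> = 1 and \<beta> = i1 and s = "b i1", OF open_branch_dom])
  fix i assume "i \<le> n"
  then consider "i = j" | "i \<in> I" by (auto simp: mem_I)
  then show "(\<lambda>\<tau>. coords 1 (branch i1 y0 \<tau>) i) holomorphic_on branch_dom i1 y0"
    by cases (auto intro!: holomorphic_intros branch_holomorphic)
next
  fix \<tau> assume "\<tau> \<in> branch_dom i1 y0"
  then show "proj_pt (coords 1 (branch i1 y0 \<tau>)) \<in> X" 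
    by (intro coords_mem branch_cone disjI1 one_neq_zero)
  show "coords 1 (branch i1 y0 \<tau>) \<in> hom_coords n" by (rule coords_hom) (rule disjI1, rule one_neq_zero)
  show "coords 1 (branch i1 y0 \<tau>) i1 = b i1 * \<tau>" using assms by (simp add: branch_def)
qed (use assms I_le j b in auto)

lemma branch_twist:
  assumes "\<omega> \<in> deck" "i1 \<in> I" "l \<in> I"
  shows "branch i1 (\<lambda>i. \<omega> i * y0 i) (\<omega> i1 * \<tau>) l = \<omega> l * branch i1 y0 \<tau> l"
  using deckD[OF assms(1,2)] deckD[OF assms(1,3)] by (simp add: branch_def power_mult_distrib)

lemma branch_dom_twist:
  assumes "\<omega> \<in> deck" "i1 \<in> I"
  shows "\<omega> i1 * \<tau> \<in> branch_dom i1 (\<lambda>i. \<omega> i * y0 i) \<longleftrightarrow> \<tau> \<in> branch_dom i1 y0"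
  using deckD[OF assms(1)] assms(2) by (simp add: branch_dom_def power_mult_distrib)

lemma affine_neq_centre: "proj_pt (coords 1 y) \<noteq> centre"
proof
  assume "proj_pt (coords 1 y) = centre"
  then obtain a where "coords 0 (\<lambda>_. 1) = (\<lambda>i. a * coords 1 y i)" "a \<noteq> 0"
    unfolding centre_def using proj_pt_eqD by metis
  from fun_cong[OF this(1), of j] this(2) show False by simp
qed

text \<open>Every parametrization at a point at infinity factors through the standard one: \<open>\<theta>\<close> is \<open>x\<^sub>j / x\<^sub>j\<^sub>0\<close>, and
the other ratios of coordinates agree with the principal roots near \<open>z0\<close> because they do so up to a
root of unity, which is continuous and equal to \<open>1\<close> at \<open>z0\<close>.\<close>

lemma local_param_at_infinity:
  assumes \<Phi>: "(D, \<psi>) \<in> local_params n X" and z0: "z0 \<in> D"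
    and \<omega>: "\<omega> \<in> deck" "\<omega> j0 = 1" and at: "\<psi> z0 = at_infinity_pt \<omega> 0"
  shows "\<exists>N \<theta>. open N \<and> z0 \<in> N \<and> N \<subseteq> D \<and> \<theta> holomorphic_on N \<and> \<theta> z0 = 0 \<and> \<theta> ` N \<subseteq> ball 0 rad \<and>
           (\<forall>z\<in>N. \<psi> z = at_infinity_pt \<omega> (\<theta> z))"
proof -
  obtain \<Psi> where D: "open D" and "inj_on \<psi> D" and \<psi>D: "\<psi> ` D \<subseteq> X" and \<Psi>: "\<And>z. z \<in> D \<Longrightarrow> \<Psi> z \<in> hom_coords n"
    "\<And>z. z \<in> D \<Longrightarrow> \<psi> z = proj_pt (\<Psi> z)" and hol: "\<And>i. i \<le> n \<Longrightarrow> (\<lambda>z. \<Psi> z i) holomorphic_on D"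
    by (rule local_paramsE[OF \<Phi>]) (rule that)
  have \<Psi>X: "proj_pt (\<Psi> z) \<in> X" if "z \<in> D" for z using \<psi>D \<Psi>(2)[OF that] that by auto
  have "proj_pt (coords 0 \<omega>) = proj_pt (\<Psi> z0)"
    using at unfolding \<Psi>(2)[OF z0] at_infinity_pt_def by simp
  then obtain a where a: "a \<noteq> 0" "\<Psi> z0 = (\<lambda>i. a * coords 0 \<omega> i)"
    using proj_pt_eqD by blast
  define D1 where "D1 = D \<inter> (\<lambda>z. \<Psi> z j0) -` (- {0})"
  have D1: "open D1" unfolding D1_def
    using holomorphic_on_imp_continuous_on[OF hol[OF I_le[OF j0]]] D by (intro continuous_open_preimage) auto
  have z01: "z0 \<in> D1" using z0 a \<omega> j0 b0 by (simp add: D1_def)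
  have nz: "\<Psi> z j0 \<noteq> 0" "z \<in> D" if "z \<in> D1" for z using that by (auto simp: D1_def)
  have hol1: "(\<lambda>z. \<Psi> z i) holomorphic_on D1" if "i \<le> n" for i
    using hol[OF that] by (rule holomorphic_on_subset) (auto simp: D1_def)
  define \<theta> where "\<theta> z = \<Psi> z j / \<Psi> z j0" for z
  have \<theta>hol: "\<theta> holomorphic_on D1" unfolding \<theta>_def using nz j j0 I_le by (intro holomorphic_intros hol1) auto
  have \<theta>0: "\<theta> z0 = 0" using a by (simp add: \<theta>_def)
  have \<theta>lim: "isCont \<theta> z0" using \<theta>hol D1 z01 holomorphic_on_imp_continuous_on continuous_on_eq_continuous_at by blast
  have evrad: "eventually (\<lambda>z. \<theta> z \<in> ball 0 rad) (nhds z0)"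
    by (rule eventually_nhds_isCont[OF \<theta>lim]) (use \<theta>0 rad_pos in simp_all)
  define q where "q i z = \<Psi> z i / (b i * \<Psi> z j0) / (\<omega> i * kroot i (\<theta> z))" for i z
  have qlim: "eventually (\<lambda>z. q i z = 1) (nhds z0)" if i: "i \<in> I" for i
  proof -
    have "isCont (kroot i) 0"
      using kroot_holomorphic[OF i] rad_pos holomorphic_on_imp_continuous_on continuous_on_eq_continuous_at
      by (metis centre_in_ball open_ball)
    then have "isCont (\<lambda>z. kroot i (\<theta> z)) z0" using \<theta>lim \<theta>0 isCont_o2 by metis
    moreover have "isCont (\<lambda>z. \<Psi> z i) z0" "isCont (\<lambda>z. \<Psi> z j0) z0"
      using hol1 i j0 I_le D1 z01 holomorphic_on_imp_continuous_on continuous_on_eq_continuous_at by blast+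
    ultimately have "isCont (q i) z0"
      unfolding q_def using nz[OF z01] b deck_nz[OF \<omega>(1) i] \<theta>0 by (intro continuous_intros) auto
    moreover have "q i z0 = 1"
      unfolding q_def using a \<theta>0 i j0 b[of i] b0 \<omega> deck_nz[OF \<omega>(1) i] by simp
    moreover have "open (- (roots - {1}))" using finite_roots by (intro open_Compl finite_imp_closed) auto
    ultimately have "eventually (\<lambda>z. q i z \<in> - (roots - {1})) (nhds z0)"
      by (intro eventually_nhds_isCont) auto
    then show ?thesis using evrad eventually_nhds_in_open[OF D1 z01]
    proof eventually_elim
      case (elim z)
      have "on_cone (\<Psi> z j) (\<lambda>i. \<Psi> z i / b i)"
        by (rule point_coords(2)[OF \<Psi>(1) \<Psi>X]) (use nz(2) elim in blast)+
      from on_coneD[OF this i] have "(\<Psi> z i / b i) ^ k = \<Psi> z j0 ^ k - c i * \<Psi> z j ^ k" using b0 by simp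
      then have A: "(\<Psi> z i / (b i * \<Psi> z j0)) ^ k = 1 - c i * \<theta> z ^ k"
        using nz(1)[OF elim(3)] by (simp add: \<theta>_def power_divide power_mult_distrib field_simps)
      have "1 - c i * \<theta> z ^ k \<noteq> 0" by (rule one_minus_nz[OF i elim(2)])
      then have "q i z ^ k = 1"
        unfolding q_def power_divide[of "\<Psi> z i / (b i * \<Psi> z j0)"] power_mult_distrib[of "\<omega> i"]
          A deckD[OF \<omega>(1) i] kroot_power mult_1 by (rule divide_self)
      then show ?case using elim(1) by (auto simp: roots_def)
    qed
  qed
  have "eventually (\<lambda>z. \<forall>i\<in>I. q i z = 1) (nhds z0)"
    using qlim finI by (simp add: eventually_ball_finite)
  then have "eventually (\<lambda>z. z \<in> D1 \<and> \<theta> z \<in> ball 0 rad \<and> (\<forall>i\<in>I. q i z = 1)) (nhds z0)"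
    using evrad eventually_nhds_in_open[OF D1 z01] by eventually_elim auto
  then obtain N where N: "open N" "z0 \<in> N" "\<And>z. z \<in> N \<Longrightarrow> z \<in> D1 \<and> \<theta> z \<in> ball 0 rad \<and> (\<forall>i\<in>I. q i z = 1)"
    unfolding eventually_nhds by blast
  have "\<psi> z = at_infinity_pt \<omega> (\<theta> z)" if z: "z \<in> N" for z
  proof -
    note Nz = N(3)[OF z]
    have "\<Psi> z i / b i = \<Psi> z j0 * (\<omega> i * kroot i (\<theta> z))" if i: "i \<in> I" for i
    proof -
      have "\<omega> i * kroot i (\<theta> z) \<noteq> 0" using deck_nz[OF \<omega>(1) i] kroot_nz[OF i] Nz by simp
      moreover have "q i z = 1" using Nz i by blast
      ultimately have "\<Psi> z i / (b i * \<Psi> z j0) = \<omega> i * kroot i (\<theta> z)" by (simp add: q_def)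
      then show ?thesis using nz(1)[of z] Nz b[of i] by (simp add: field_simps)
    qed
    moreover have "\<Psi> z j = \<Psi> z j0 * \<theta> z" using nz(1)[of z] Nz by (simp add: \<theta>_def)
    moreover have "\<Psi> z = coords (\<Psi> z j) (\<lambda>i. \<Psi> z i / b i)"
      by (rule point_coords(1)[OF \<Psi>(1) \<Psi>X]) (use nz(2) Nz in blast)+
    moreover have "coords (\<Psi> z j) (\<lambda>i. \<Psi> z i / b i) = coords (\<Psi> z j) (\<lambda>i. \<Psi> z j0 * (\<omega> i * kroot i (\<theta> z)))"
      using calculation(1) by (rule coords_cong)
    ultimately have "\<Psi> z = coords (\<Psi> z j0 * \<theta> z) (\<lambda>i. \<Psi> z j0 * (\<omega> i * kroot i (\<theta> z)))"
      by simp
    then have "\<Psi> z = (\<lambda>i. \<Psi> z j0 * coords (\<theta> z) (\<lambda>i. \<omega> i * kroot i (\<theta> z)) i)"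
      unfolding coords_scale .
    then have "proj_pt (\<Psi> z) = at_infinity_pt \<omega> (\<theta> z)"
      unfolding at_infinity_pt_def
      using proj_pt_scale[of "\<Psi> z j0" "coords (\<theta> z) (\<lambda>i. \<omega> i * kroot i (\<theta> z))"] nz(1)[of z] Nz by simp
    then show ?thesis using \<Psi>(2)[of z] nz(2)[of z] Nz by simp
  qed
  moreover have "N \<subseteq> D" "\<theta> ` N \<subseteq> ball 0 rad" using N(3) by (auto simp: D1_def)
  moreover have "\<theta> holomorphic_on N" using \<theta>hol N(3) by (meson holomorphic_on_subset subsetI)
  ultimately show ?thesis using N(1,2) \<theta>0 by blast
qed

end

section \<open>Functions with a single pole: vanishing orders are gaps\<close>

text \<open>Riemann's removable singularity theorem at finitely many points.\<close>

lemma holomorphic_extend_finite: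
  assumes "finite S" "f holomorphic_on UNIV - S" "\<And>s. s \<in> S \<Longrightarrow> ((\<lambda>z. (z - s) * f z) \<longlongrightarrow> 0) (at s)"
  shows "\<exists>g. g holomorphic_on UNIV \<and> (\<forall>z. z \<notin> S \<longrightarrow> g z = f z)"
  using assms
proof (induction S arbitrary: f rule: finite_induct)
  case empty
  then show ?case by auto
next
  case (insert s S)
  have op: "open (UNIV - S)" using insert.hyps(1) by (simp add: open_Diff finite_imp_closed)
  have "f holomorphic_on (UNIV - S) - {s}" using insert.prems(1) by (rule holomorphic_on_subset) auto
  moreover have "s \<in> interior (UNIV - S)" using op insert.hyps by (simp add: interior_open)
  ultimately obtain g where g: "g holomorphic_on UNIV - S" "\<forall>z\<in>(UNIV - S) - {s}. g z = f z"
    using holomorphic_on_extend_lim[of f "UNIV - S" s] insert.prems(2)[of s] by blast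
  have "((\<lambda>z. (z - u) * g z) \<longlongrightarrow> 0) (at u)" if u: "u \<in> S" for u
  proof (rule Lim_transform_eventually)
    show "((\<lambda>z. (z - u) * f z) \<longlongrightarrow> 0) (at u)" using insert.prems(2)[of u] u by blast
    have "open (- (insert s S - {u}))" using insert.hyps(1) by (intro open_Compl finite_imp_closed) auto
    then have "eventually (\<lambda>z. z \<in> - (insert s S - {u})) (at u)"
      by (intro eventually_at_topological[THEN iffD2] exI[of _ "- (insert s S - {u})"]) auto
    moreover have "eventually (\<lambda>z. z \<noteq> u) (at u)" by (simp add: eventually_at_filter)
    ultimately show "eventually (\<lambda>z. (z - u) * f z = (z - u) * g z) (at u)"
      by eventually_elim (use g(2) in auto)
  qed
  from insert.IH[OF g(1) this] obtain h where "h holomorphic_on UNIV" "\<forall>z. z \<notin> S \<longrightarrow> h z = g z" by blast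
  then show ?case using g(2) by (intro exI[of _ h]) auto
qed

context fermat_cover
begin

definition deck_one :: "nat \<Rightarrow> complex" where "deck_one = (\<lambda>i\<in>I. 1)"

lemma deck_one: "deck_one \<in> deck" "i \<in> I \<Longrightarrow> deck_one i = 1"
  by (auto simp: deck_one_def deck_def roots_def)

lemma centre_eq: "centre = at_infinity_pt deck_one 0"
  using at_infinity_eq_centre_iff[of deck_one 0] deck_one rad_pos j0 by simp

text \<open>The order of the pole is transferred from an arbitrary parametrization to the standard one. The
change of parameter \<open>\<theta>\<close> is injective, hence has a holomorphic inverse.\<close>

lemma pole_limit:
  assumes off: "holomorphic_off (local_params n X) centre f"
    and pole: "has_pole_of_order (local_params n X) f centre a"
  shows "\<exists>L. L \<noteq> 0 \<and> ((\<lambda>t. t ^ a * f (at_infinity_pt deck_one t)) \<longlongrightarrow> L) (at 0)"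
proof -
  obtain D \<psi> z0 where \<Phi>: "(D, \<psi>) \<in> local_params n X" and z0: "z0 \<in> D" "\<psi> z0 = centre"
    and p: "is_pole (f \<circ> \<psi>) z0" "zorder (f \<circ> \<psi>) z0 = - int a"
    using pole unfolding has_pole_of_order_def by blast
  obtain N \<theta> where N: "open N" "z0 \<in> N" "N \<subseteq> D" and \<theta>: "\<theta> holomorphic_on N" "\<theta> z0 = 0"
    and eq: "\<And>z. z \<in> N \<Longrightarrow> \<psi> z = at_infinity_pt deck_one (\<theta> z)"
    using local_param_at_infinity[OF \<Phi> z0(1) deck_one(1) deck_one(2)[OF j0]] z0(2) centre_eq by metis
  have inj\<psi>: "inj_on \<psi> D" using local_paramsE[OF \<Phi>] by metis
  have inj: "inj_on \<theta> N"
  proof (rule inj_onI)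
    fix z w assume zw: "z \<in> N" "w \<in> N" "\<theta> z = \<theta> w"
    then have "\<psi> z = \<psi> w" using eq by simp
    then show "z = w" using inj\<psi> zw N(3) by (auto simp: inj_on_def)
  qed
  obtain g where g: "g holomorphic_on (\<theta> ` N)" "\<And>z. z \<in> N \<Longrightarrow> deriv \<theta> z * deriv g (\<theta> z) = 1" "\<And>z. z \<in> N \<Longrightarrow> g (\<theta> z) = z"
    using holomorphic_has_inverse[OF \<theta>(1) N(1) inj] by metis
  have op: "open (\<theta> ` N)" by (rule open_mapping_thm3[OF \<theta>(1) N(1) inj])
  have 0: "0 \<in> \<theta> ` N" using N(2) \<theta>(2) by force
  have g0: "g 0 = z0" using g(3)[OF N(2)] \<theta>(2) by simp
  have dg: "deriv g 0 \<noteq> 0" using g(2)[OF N(2)] \<theta>(2) by auto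
  have hol: "(f \<circ> \<psi>) holomorphic_on N - {z0}"
  proof (rule holomorphic_on_subset)
    show "(f \<circ> \<psi>) holomorphic_on {z \<in> D. \<psi> z \<noteq> centre}"
      using off \<Phi> unfolding holomorphic_off_def by blast
    show "N - {z0} \<subseteq> {z \<in> D. \<psi> z \<noteq> centre}"
    proof
      fix z assume "z \<in> N - {z0}"
      then have z: "z \<in> D" "z \<noteq> z0" using N(3) by auto
      then have "\<psi> z \<noteq> \<psi> z0" using inj_onD[OF inj\<psi>, of z z0] z0(1) by blast
      then show "z \<in> {z \<in> D. \<psi> z \<noteq> centre}" using z z0(2) by simp
    qed
  qed
  define q where "q = zor_poly (f \<circ> \<psi>) z0"
  obtain r where q: "q z0 \<noteq> 0" "r > 0" "cball z0 r \<subseteq> N" "q holomorphic_on cball z0 r"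
    "\<And>w. w \<in> cball z0 r - {z0} \<Longrightarrow> (f \<circ> \<psi>) w = q w / (w - z0) ^ a"
    using zorder_exist_pole[OF hol N(1,2) p(1)] unfolding p(2) q_def by auto
  have gcont: "isCont g 0"
    using g(1) op 0 holomorphic_on_imp_continuous_on continuous_on_eq_continuous_at by blast
  have "(g has_field_derivative deriv g 0) (at 0)" using g(1) op 0 by (simp add: holomorphic_derivI)
  then have "((\<lambda>t. (g t - g 0) / (t - 0)) \<longlongrightarrow> deriv g 0) (at 0)"
    by (simp add: has_field_derivative_iff)
  then have lim1: "((\<lambda>t. t / (g t - z0)) \<longlongrightarrow> inverse (deriv g 0)) (at 0)"
    unfolding g0 using tendsto_inverse[OF _ dg] by fastforce
  have "isCont q (g 0)"
  proof (rule continuous_on_interior)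
    show "continuous_on (cball z0 r) q" by (rule holomorphic_on_imp_continuous_on[OF q(4)])
    show "g 0 \<in> interior (cball z0 r)" using q(2) g0 by simp
  qed
  then have "isCont (\<lambda>t. q (g t)) 0" by (rule isCont_o2[OF gcont])
  then have lim2: "((\<lambda>t. q (g t)) \<longlongrightarrow> q z0) (at 0)" unfolding isCont_def g0 .
  have lim: "((\<lambda>t. q (g t) * (t / (g t - z0)) ^ a) \<longlongrightarrow> q z0 * inverse (deriv g 0) ^ a) (at 0)"
    by (intro tendsto_intros lim1 lim2)
  have ev1: "eventually (\<lambda>t. g t \<in> ball z0 r) (nhds 0)"
    by (rule eventually_nhds_isCont[OF gcont]) (use g0 q(2) in auto)
  have "eventually (\<lambda>t. q (g t) * (t / (g t - z0)) ^ a = t ^ a * f (at_infinity_pt deck_one t)) (at 0)"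
    unfolding eventually_at_filter using ev1 eventually_nhds_in_open[OF op 0]
  proof eventually_elim
    case (elim t)
    show ?case
    proof (intro impI)
      assume t: "t \<noteq> 0"
      obtain z where z: "z \<in> N" "t = \<theta> z" using elim by blast
      then have gz: "g t = z" using g(3) by simp
      have "z \<noteq> z0" using t z \<theta>(2) by auto
      then have "f (\<psi> z) = q z / (z - z0) ^ a" using q(5)[of z] elim gz by simp
      then show "q (g t) * (t / (g t - z0)) ^ a = t ^ a * f (at_infinity_pt deck_one t)"
        using eq[OF z(1)] z(2) gz by (simp add: power_divide)
    qed
  qed
  then have "((\<lambda>t. t ^ a * f (at_infinity_pt deck_one t)) \<longlongrightarrow> q z0 * inverse (deriv g 0) ^ a) (at 0)"
    by (rule Lim_transform_eventually[OF lim])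
  moreover have "q z0 * inverse (deriv g 0) ^ a \<noteq> 0" using q(1) dg by simp
  ultimately show ?thesis by blast
qed

text \<open>The component of \<open>f\<close> in the character \<open>e\<close> of the deck group, up to the factor \<open>k ^ n\<close>.\<close>

definition twist_sum :: "((nat \<Rightarrow> complex) set \<Rightarrow> complex) \<Rightarrow> (nat \<Rightarrow> nat) \<Rightarrow> (nat \<Rightarrow> complex) \<Rightarrow> complex" where
  "twist_sum f e y = (\<Sum>\<omega>\<in>deck. inverse (monom_at e \<omega>) * f (proj_pt (coords 1 (\<lambda>i. \<omega> i * y i))))"

lemma monom_at_cong: "(\<And>i. i \<in> I \<Longrightarrow> y i = y' i) \<Longrightarrow> monom_at e y = monom_at e y'"
  by (simp add: monom_at_def)

lemma twist_sum_cong: "(\<And>i. i \<in> I \<Longrightarrow> y i = y' i) \<Longrightarrow> twist_sum f e y = twist_sum f e y'"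
proof -
  assume H: "\<And>i. i \<in> I \<Longrightarrow> y i = y' i"
  have "coords 1 (\<lambda>i. \<omega> i * y i) = coords 1 (\<lambda>i. \<omega> i * y' i)" for \<omega>
    by (rule coords_cong) (simp add: H)
  then show ?thesis by (simp add: twist_sum_def)
qed

lemma deck_mult: "\<omega> \<in> deck \<Longrightarrow> \<eta> \<in> deck \<Longrightarrow> (\<lambda>i\<in>I. \<omega> i * \<eta> i) \<in> deck"
  using deckD[of \<omega>] deckD[of \<eta>] by (auto simp: deck_def roots_def power_mult_distrib)

lemma deck_inverse: "\<eta> \<in> deck \<Longrightarrow> (\<lambda>i\<in>I. inverse (\<eta> i)) \<in> deck"
  using deckD[of \<eta>] by (auto simp: deck_def roots_def power_inverse)

lemma bij_betw_deck_mult: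
  assumes \<eta>: "\<eta> \<in> deck"
  shows "bij_betw (\<lambda>\<omega>. \<lambda>i\<in>I. \<omega> i * \<eta> i) deck deck"
proof (rule bij_betwI[where g = "\<lambda>\<omega>. \<lambda>i\<in>I. \<omega> i * inverse (\<eta> i)"])
  show "(\<lambda>\<omega>. \<lambda>i\<in>I. \<omega> i * \<eta> i) \<in> deck \<rightarrow> deck" using deck_mult[OF _ \<eta>] by blast
  have "(\<lambda>i\<in>I. \<omega> i * inverse (\<eta> i)) \<in> deck" if "\<omega> \<in> deck" for \<omega>
  proof -
    have "(\<lambda>i\<in>I. \<omega> i * (\<lambda>i\<in>I. inverse (\<eta> i)) i) = (\<lambda>i\<in>I. \<omega> i * inverse (\<eta> i))" by (rule restrict_ext) simp
    then show ?thesis using deck_mult[OF that deck_inverse[OF \<eta>]] by simp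
  qed
  then show "(\<lambda>\<omega>. \<lambda>i\<in>I. \<omega> i * inverse (\<eta> i)) \<in> deck \<rightarrow> deck" by blast
  fix \<omega> assume "\<omega> \<in> deck"
  then have ext: "\<omega> \<in> extensional I" by (simp add: deck_def PiE_def)
  show "(\<lambda>i\<in>I. (\<lambda>i\<in>I. \<omega> i * \<eta> i) i * inverse (\<eta> i)) = \<omega>"
    by (rule extensionalityI[OF _ ext]) (use deck_nz[OF \<eta>] in auto)
  show "(\<lambda>i\<in>I. (\<lambda>i\<in>I. \<omega> i * inverse (\<eta> i)) i * \<eta> i) = \<omega>"
    by (rule extensionalityI[OF _ ext]) (use deck_nz[OF \<eta>] in auto)
qed

lemma twist_sum_twist:
  assumes \<eta>: "\<eta> \<in> deck"
  shows "twist_sum f e (\<lambda>i. \<eta> i * y i) = monom_at e \<eta> * twist_sum f e y"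
proof -
  have "twist_sum f e y = (\<Sum>\<omega>\<in>deck. inverse (monom_at e (\<lambda>i\<in>I. \<omega> i * \<eta> i)) * f (proj_pt (coords 1 (\<lambda>i. (\<lambda>i\<in>I. \<omega> i * \<eta> i) i * y i))))"
    unfolding twist_sum_def by (rule sum.reindex_bij_betw[OF bij_betw_deck_mult[OF \<eta>], symmetric])
  also have "\<dots> = (\<Sum>\<omega>\<in>deck. inverse (monom_at e \<eta>) * (inverse (monom_at e \<omega>) * f (proj_pt (coords 1 (\<lambda>i. \<omega> i * (\<eta> i * y i))))))"
  proof (rule sum.cong[OF refl])
    fix \<omega>
    have "monom_at e (\<lambda>i\<in>I. \<omega> i * \<eta> i) = monom_at e \<omega> * monom_at e \<eta>"
      unfolding monom_at_mult[symmetric] by (rule monom_at_cong) simp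
    moreover have "coords 1 (\<lambda>i. (\<lambda>i\<in>I. \<omega> i * \<eta> i) i * y i) = coords 1 (\<lambda>i. \<omega> i * (\<eta> i * y i))"
      by (rule coords_cong) simp
    ultimately show "inverse (monom_at e (\<lambda>i\<in>I. \<omega> i * \<eta> i)) * f (proj_pt (coords 1 (\<lambda>i. (\<lambda>i\<in>I. \<omega> i * \<eta> i) i * y i))) =
      inverse (monom_at e \<eta>) * (inverse (monom_at e \<omega>) * f (proj_pt (coords 1 (\<lambda>i. \<omega> i * (\<eta> i * y i)))))"
      by simp
  qed
  also have "\<dots> = inverse (monom_at e \<eta>) * twist_sum f e (\<lambda>i. \<eta> i * y i)"
    by (simp add: twist_sum_def sum_distrib_left)
  finally show ?thesis using monom_at_nz[of \<eta> e] deck_nz[OF \<eta>] by simp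
qed

definition kroots :: "complex \<Rightarrow> nat \<Rightarrow> complex" where
  "kroots z i = (z - c i) powr (1 / of_nat k)"

text \<open>The quotient of the \<open>e\<close>-component of \<open>f\<close> by \<open>y ^ e\<close> is invariant under the deck group, hence a
function of \<open>z\<close>. It is defined by the principal roots, but every other choice gives the same
value by \<open>coeff_fun_eq\<close>.\<close>

definition coeff_fun :: "((nat \<Rightarrow> complex) set \<Rightarrow> complex) \<Rightarrow> (nat \<Rightarrow> nat) \<Rightarrow> complex \<Rightarrow> complex" where
  "coeff_fun f e z = twist_sum f e (kroots z) / monom_at e (kroots z)"

lemma kroots_power: "kroots z i ^ k = z - c i" by (simp add: kroots_def)

lemma coeff_fun_eq:
  assumes cone: "on_cone 1 y" and nz: "\<And>i. i \<in> I \<Longrightarrow> y i \<noteq> 0"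
  shows "coeff_fun f e (y j0 ^ k) = twist_sum f e y / monom_at e y"
proof -
  let ?z = "y j0 ^ k"
  have yk: "y i ^ k = ?z - c i" if "i \<in> I" for i using on_coneD[OF cone that] by simp
  define \<eta> where "\<eta> = (\<lambda>i\<in>I. y i / kroots ?z i)"
  have knz: "kroots ?z i \<noteq> 0" if "i \<in> I" for i
    using yk[OF that] nz[OF that] kroots_power[of ?z i] k0 by (metis power_eq_0_iff)
  have "(y i / kroots ?z i) ^ k = 1" if "i \<in> I" for i
    unfolding power_divide kroots_power yk[OF that, symmetric] using nz[OF that] by simp
  then have \<eta>: "\<eta> \<in> deck" by (auto simp: deck_def roots_def \<eta>_def)
  have y: "y i = \<eta> i * kroots ?z i" if "i \<in> I" for i using knz[OF that] that by (simp add: \<eta>_def)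
  have "twist_sum f e y = twist_sum f e (\<lambda>i. \<eta> i * kroots ?z i)" by (rule twist_sum_cong) (rule y)
  moreover have "monom_at e y = monom_at e (\<lambda>i. \<eta> i * kroots ?z i)" by (rule monom_at_cong) (rule y)
  moreover have "monom_at e \<eta> \<noteq> 0" by (rule monom_at_nz) (rule deck_nz[OF \<eta>])
  ultimately show ?thesis
    unfolding coeff_fun_def twist_sum_twist[OF \<eta>] monom_at_mult by simp
qed

lemma twist_sum_branch_holomorphic:
  assumes off: "holomorphic_off (local_params n X) centre f" and i1: "i1 \<in> I"
  shows "(\<lambda>\<tau>. twist_sum f e (branch i1 y0 \<tau>)) holomorphic_on branch_dom i1 y0"
  unfolding twist_sum_def
proof (intro holomorphic_intros)
  fix \<omega> assume \<omega>: "\<omega> \<in> deck"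
  let ?y = "\<lambda>i. \<omega> i * y0 i"
  have "(f \<circ> (\<lambda>\<tau>. proj_pt (coords 1 (branch i1 ?y \<tau>)))) holomorphic_on branch_dom i1 ?y"
  proof -
    have "(f \<circ> (\<lambda>\<tau>. proj_pt (coords 1 (branch i1 ?y \<tau>)))) holomorphic_on
       {z \<in> branch_dom i1 ?y. proj_pt (coords 1 (branch i1 ?y z)) \<noteq> centre}"
      using off branch_local_params[OF i1, of ?y] unfolding holomorphic_off_def by blast
    then show ?thesis using affine_neq_centre by simp
  qed
  moreover have "(\<lambda>\<tau>. \<omega> i1 * \<tau>) ` branch_dom i1 y0 \<subseteq> branch_dom i1 ?y"
    using branch_dom_twist[OF \<omega> i1] by blast
  ultimately have "((f \<circ> (\<lambda>\<tau>. proj_pt (coords 1 (branch i1 ?y \<tau>)))) \<circ> (\<lambda>\<tau>. \<omega> i1 * \<tau>)) holomorphic_on branch_dom i1 y0"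
    by (intro holomorphic_on_compose_gen[of "\<lambda>\<tau>. \<omega> i1 * \<tau>"] holomorphic_intros) auto
  moreover have "coords 1 (branch i1 ?y (\<omega> i1 * \<tau>)) = coords 1 (\<lambda>i. \<omega> i * branch i1 y0 \<tau> i)" for \<tau>
    by (rule coords_cong) (rule branch_twist[OF \<omega> i1])
  ultimately show "(\<lambda>\<tau>. f (proj_pt (coords 1 (\<lambda>i. \<omega> i * branch i1 y0 \<tau> i)))) holomorphic_on branch_dom i1 y0"
    by (simp add: o_def)
qed

lemma coeff_fun_holomorphic:
  assumes off: "holomorphic_off (local_params n X) centre f"
  shows "coeff_fun f e holomorphic_on UNIV - c ` I"
proof (rule holomorphic_onI)
  fix z0 assume z0: "z0 \<in> UNIV - c ` I"
  define y0 where "y0 = kroots z0"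
  have y0: "y0 l ^ k = z0 - c l" for l by (simp add: y0_def kroots_power)
  have z0c: "z0 - c l \<noteq> 0" if "l \<in> I" for l using z0 that by auto
  have z0nz: "z0 \<noteq> 0" using z0c[OF j0] c0 by simp
  have y0nz: "y0 l \<noteq> 0" if "l \<in> I" for l using z0c[OF that] y0[of l] k0 by (auto simp: power_0_left)
  \<comment> \<open>On this neighbourhood principal roots of \<open>(z - c l) / (z0 - c l)\<close> are holomorphic.\<close>
  define N where "N = (\<Inter>l\<in>I. {z. Re ((z - c l) / (z0 - c l)) > 0})"
  have N: "open N" unfolding N_def divide_inverse
    by (intro open_INT ballI open_Collect_less continuous_intros finI)
  have z0N: "z0 \<in> N" unfolding N_def using z0c by simp
  have Nz: "Re ((z - c l) / (z0 - c l)) > 0" if "z \<in> N" "l \<in> I" for z l using that by (auto simp: N_def)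
  define \<tau> where "\<tau> z = y0 j0 * (z / z0) powr (1 / of_nat k)" for z
  have \<tau>k: "\<tau> z ^ k = z" for z
    unfolding \<tau>_def power_mult_distrib y0 powr_kth using z0nz by (simp add: c0)
  have \<tau>dom: "\<tau> z \<in> branch_dom j0 y0" if "z \<in> N" for z
    unfolding branch_dom_def using Nz[OF that] by (simp add: \<tau>k c0 y0)
  have \<tau>hol: "\<tau> holomorphic_on N"
  proof -
    have "z / z0 \<notin> \<real>\<^sub>\<le>\<^sub>0" if "z \<in> N" for z using Nz[OF that j0] by (auto simp: complex_nonpos_Reals_iff c0)
    then show ?thesis unfolding \<tau>_def using z0nz by (auto intro!: holomorphic_intros)
  qed
  have eq: "coeff_fun f e z = twist_sum f e (branch j0 y0 (\<tau> z)) / monom_at e (branch j0 y0 (\<tau> z))" if z: "z \<in> N" for z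
  proof -
    have nz: "branch j0 y0 (\<tau> z) l \<noteq> 0" if l: "l \<in> I" for l
    proof -
      have "branch j0 y0 (\<tau> z) l ^ k = z - c l" using branch_power[OF \<tau>dom[OF z] l] by (simp add: \<tau>k c0)
      moreover have "z - c l \<noteq> 0" using Nz[OF z l] by auto
      ultimately show ?thesis using k0 by (auto simp: power_0_left)
    qed
    have "branch j0 y0 (\<tau> z) j0 ^ k = z" by (simp add: branch_def \<tau>k)
    with coeff_fun_eq[OF branch_cone[OF \<tau>dom[OF z]] nz] show ?thesis by simp
  qed
  have nzm: "monom_at e (branch j0 y0 (\<tau> z)) \<noteq> 0" if z: "z \<in> N" for z
  proof (rule monom_at_nz)
    fix l assume l: "l \<in> I"
    have "branch j0 y0 (\<tau> z) l ^ k = z - c l" using branch_power[OF \<tau>dom[OF z] l] by (simp add: \<tau>k c0)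
    moreover have "z - c l \<noteq> 0" using Nz[OF z l] by auto
    ultimately show "branch j0 y0 (\<tau> z) l \<noteq> 0" using k0 by (auto simp: power_0_left)
  qed
  have comp: "(\<lambda>z. h (\<tau> z)) holomorphic_on N" if "h holomorphic_on branch_dom j0 y0" for h
    using holomorphic_on_compose_gen[OF \<tau>hol that] \<tau>dom by (auto simp: o_def)
  have "(\<lambda>z. twist_sum f e (branch j0 y0 (\<tau> z)) / monom_at e (branch j0 y0 (\<tau> z))) holomorphic_on N"
  proof (rule holomorphic_on_divide)
    show "(\<lambda>z. twist_sum f e (branch j0 y0 (\<tau> z))) holomorphic_on N"
      by (rule comp) (rule twist_sum_branch_holomorphic[OF off j0])
    show "(\<lambda>z. monom_at e (branch j0 y0 (\<tau> z))) holomorphic_on N"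
      unfolding monom_at_def by (intro holomorphic_intros comp[of "\<lambda>t. branch j0 y0 t _"] branch_holomorphic)
  qed (rule nzm)
  then have "coeff_fun f e holomorphic_on N" by (rule holomorphic_transform) (simp add: eq)
  then have "coeff_fun f e field_differentiable (at z0)"
    using N z0N by (rule holomorphic_on_imp_differentiable_at)
  then show "coeff_fun f e field_differentiable (at z0 within UNIV - c ` I)"
    by (rule field_differentiable_at_within)
qed

text \<open>Near \<open>z = c\<^sub>i\<^sub>1\<close> only the factor \<open>y\<^sub>i\<^sub>1 ^ e\<^sub>i\<^sub>1\<close> of \<open>y ^ e\<close> has a zero, of order \<open>e\<^sub>i\<^sub>1 < k\<close> in
the parameter \<open>\<tau> = y\<^sub>i\<^sub>1\<close>, while \<open>z - c\<^sub>i\<^sub>1 = \<tau> ^ k\<close>.\<close>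

lemma coeff_fun_removable:
  assumes off: "holomorphic_off (local_params n X) centre f" and i1: "i1 \<in> I" and e: "e i1 < k"
  shows "((\<lambda>z. (z - c i1) * coeff_fun f e z) \<longlongrightarrow> 0) (at (c i1))"
proof -
  define y0 where "y0 = kroots (c i1)"
  have y0: "y0 l ^ k = c i1 - c l" for l by (simp add: y0_def kroots_power)
  have cc: "c i1 - c l \<noteq> 0" if "l \<in> I" "l \<noteq> i1" for l using c that i1 by (auto simp: inj_on_def)
  have dom0: "0 \<in> branch_dom i1 y0"
    unfolding branch_dom_def using cc k0 by (auto simp: y0 power_0_left)
  define H where "H t = twist_sum f e (branch i1 y0 t) / (\<Prod>l\<in>I - {i1}. branch i1 y0 t l ^ e l)" for t
  have "H holomorphic_on branch_dom i1 y0"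
    unfolding H_def using branch_nz finI
    by (intro holomorphic_on_divide twist_sum_branch_holomorphic[OF off i1] holomorphic_intros branch_holomorphic) auto
  then have "isCont H 0"
    using dom0 open_branch_dom holomorphic_on_imp_continuous_on continuous_on_eq_continuous_at by blast
  define \<tau> where "\<tau> z = (z - c i1) powr (1 / of_nat k)" for z
  have \<tau>k: "\<tau> z ^ k = z - c i1" for z by (simp add: \<tau>_def)
  have "((\<lambda>z. z - c i1) \<longlongrightarrow> c i1 - c i1) (at (c i1))" by (intro tendsto_intros)
  then have "((\<lambda>z. z - c i1) \<longlongrightarrow> 0) (at (c i1))" by simp
  moreover have "Re (1 / of_nat k) > 0" using k0 by simp
  ultimately have \<tau>lim: "(\<tau> \<longlongrightarrow> 0) (at (c i1))"
    unfolding \<tau>_def by (intro tendsto_powr_complex_0[OF _ tendsto_const]) auto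
  have "((\<lambda>z. H (\<tau> z)) \<longlongrightarrow> H 0) (at (c i1))"
    using \<open>isCont H 0\<close> \<tau>lim by (rule isCont_tendsto_compose)
  then have "((\<lambda>z. \<tau> z ^ (k - e i1) * H (\<tau> z)) \<longlongrightarrow> 0 ^ (k - e i1) * H 0) (at (c i1))"
    by (intro tendsto_intros \<tau>lim)
  then have lim: "((\<lambda>z. \<tau> z ^ (k - e i1) * H (\<tau> z)) \<longlongrightarrow> 0) (at (c i1))"
    using e by (simp add: power_0_left)
  have ev: "eventually (\<lambda>z. \<tau> z \<in> branch_dom i1 y0) (at (c i1))"
    by (rule topological_tendstoD[OF \<tau>lim open_branch_dom dom0])
  have "eventually (\<lambda>z. z \<noteq> c i1) (at (c i1))" by (simp add: eventually_at_filter)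
  with ev have "eventually (\<lambda>z. \<tau> z ^ (k - e i1) * H (\<tau> z) = (z - c i1) * coeff_fun f e z) (at (c i1))"
  proof eventually_elim
    case (elim z)
    let ?Y = "branch i1 y0 (\<tau> z)"
    have \<tau>nz: "\<tau> z \<noteq> 0" using \<tau>k[of z] elim(2) k0 by (auto simp: power_0_left)
    have Yi1: "?Y i1 = \<tau> z" by (simp add: branch_def)
    have nz: "?Y l \<noteq> 0" if "l \<in> I" for l
      using branch_nz[OF elim(1) that] \<tau>nz Yi1 by (cases "l = i1") auto
    have "?Y j0 ^ k = z" using branch_power[OF elim(1) j0] by (simp add: \<tau>k c0)
    with coeff_fun_eq[OF branch_cone[OF elim(1)] nz] have 1: "coeff_fun f e z = twist_sum f e ?Y / monom_at e ?Y" by simp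
    have 2: "monom_at e ?Y = \<tau> z ^ e i1 * (\<Prod>l\<in>I - {i1}. ?Y l ^ e l)"
      unfolding monom_at_def using finI i1 by (simp add: prod.remove Yi1)
    have 3: "z - c i1 = \<tau> z ^ (k - e i1) * \<tau> z ^ e i1"
      unfolding \<tau>k[symmetric] power_add[symmetric] using e by simp
    show ?case unfolding 1 2 H_def unfolding 3 using \<tau>nz by simp
  qed
  with lim show ?thesis by (rule Lim_transform_eventually)
qed

lemma coeff_fun_entire:
  assumes off: "holomorphic_off (local_params n X) centre f" and e: "\<And>i. i \<in> I \<Longrightarrow> e i < k"
  shows "\<exists>G. G holomorphic_on UNIV \<and> (\<forall>z. z \<notin> c ` I \<longrightarrow> G z = coeff_fun f e z)"
proof (rule holomorphic_extend_finite)
  show "finite (c ` I)" using finI by simp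
  show "coeff_fun f e holomorphic_on UNIV - c ` I" by (rule coeff_fun_holomorphic[OF off])
  fix s assume "s \<in> c ` I"
  then obtain i where i: "i \<in> I" "s = c i" by blast
  show "((\<lambda>z. (z - s) * coeff_fun f e z) \<longlongrightarrow> 0) (at s)"
    unfolding i(2) by (rule coeff_fun_removable[where e=e, OF off i(1) e[OF i(1)]])
qed

lemma twist_sum_at_infinity:
  assumes "t \<noteq> 0"
  shows "twist_sum f e (\<lambda>i. kroot i t / t) = (\<Sum>\<omega>\<in>deck. inverse (monom_at e \<omega>) * f (at_infinity_pt \<omega> t))"
proof -
  have "proj_pt (coords 1 (\<lambda>i. \<omega> i * (kroot i t / t))) = at_infinity_pt \<omega> t" for \<omega>
  proof -
    have "coords t (\<lambda>i. \<omega> i * kroot i t) = coords (t * 1) (\<lambda>i. t * (\<omega> i * (kroot i t / t)))"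
      using assms by simp
    also have "\<dots> = (\<lambda>i. t * coords 1 (\<lambda>i. \<omega> i * (kroot i t / t)) i)" by (rule coords_scale)
    finally show ?thesis unfolding at_infinity_pt_def by (simp only: proj_pt_scale[OF assms])
  qed
  then show ?thesis unfolding twist_sum_def by simp
qed

lemma at_infinity_pt_const:
  assumes \<omega>: "\<omega> \<in> deck" "\<And>i. i \<in> I \<Longrightarrow> \<omega> i = \<zeta>"
  shows "at_infinity_pt \<omega> t = at_infinity_pt deck_one (t / \<zeta>)"
proof -
  have \<zeta>: "\<zeta> \<noteq> 0" "\<zeta> ^ k = 1" using \<omega>(2)[OF j0] deck_nz[OF \<omega>(1) j0] deckD[OF \<omega>(1) j0] by auto
  have kr: "kroot i t = kroot i (t / \<zeta>)" for i
    using kroot_twist[OF \<zeta>(2), of i "t / \<zeta>"] \<zeta>(1) by simp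
  have "coords t (\<lambda>i. \<omega> i * kroot i t) = coords (\<zeta> * (t / \<zeta>)) (\<lambda>i. \<zeta> * (deck_one i * kroot i (t / \<zeta>)))"
    using \<zeta>(1) \<omega>(2) deck_one(2) kr by (auto simp: coords_def fun_eq_iff)
  also have "\<dots> = (\<lambda>i. \<zeta> * coords (t / \<zeta>) (\<lambda>i. deck_one i * kroot i (t / \<zeta>)) i)" by (rule coords_scale)
  finally show ?thesis unfolding at_infinity_pt_def by (simp only: proj_pt_scale[OF \<zeta>(1)])
qed

lemma diff_index_exponent:
  assumes "(e, i) \<in> diff_index k I r"
  shows "r + k * i < (\<Sum>l\<in>I. e l)"
proof -
  have "i < ((\<Sum>l\<in>I. e l) - r) div k" using assms by (simp add: diff_index_def num_powers_def)
  then have "Suc i \<le> ((\<Sum>l\<in>I. e l) - r) div k" by simp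
  then have "k * Suc i \<le> k * (((\<Sum>l\<in>I. e l) - r) div k)" by (rule mult_le_mono2)
  also have "\<dots> \<le> (\<Sum>l\<in>I. e l) - r" by (rule times_div_less_eq_dividend)
  finally show ?thesis using k0 by (simp add: algebra_simps)
qed

lemma sum_exps_power:
  assumes "\<zeta> ^ k = (1 :: complex)" "e \<in> residue_exps k I r"
  shows "\<zeta> ^ (\<Sum>l\<in>I. e l) = \<zeta> ^ r"
proof -
  have pm: "\<zeta> ^ m = \<zeta> ^ (m mod k)" for m
  proof -
    have "\<zeta> ^ m = \<zeta> ^ (k * (m div k) + m mod k)" by simp
    then show ?thesis unfolding power_add power_mult assms(1) by simp
  qed
  have "(\<Sum>l\<in>I. e l) mod k = r mod k" using assms(2) by (simp add: residue_exps_def)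
  then show ?thesis using pm by metis
qed

text \<open>The Fourier component at \<open>z = t ^ (- k)\<close> in terms of the values of \<open>f\<close> near all points at infinity.\<close>

lemma coeff_fun_at_infinity:
  assumes t: "t \<in> ball 0 rad" "t \<noteq> 0"
  shows "(1 / t) ^ k \<notin> c ` I"
    and "coeff_fun f e ((1 / t) ^ k) =
      t ^ (\<Sum>l\<in>I. e l) * radical_fun k I c e (t ^ k) * (\<Sum>\<omega>\<in>deck. inverse (monom_at e \<omega>) * f (at_infinity_pt \<omega> t))"
proof -
  show "(1 / t) ^ k \<notin> c ` I"
  proof
    assume "(1 / t) ^ k \<in> c ` I"
    then obtain i where i: "i \<in> I" "(1 / t) ^ k = c i" by auto
    then have "1 - c i * t ^ k = 0" using t(2) by (simp add: power_divide flip: i(2))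
    then show False using one_minus_nz[OF i(1) t(1)] by contradiction
  qed
  have cone: "on_cone 1 (\<lambda>i. kroot i t / t)"
    using t(2) by (intro on_coneI) (simp add: power_divide kroot_power diff_divide_distrib)
  have nz: "kroot i t / t \<noteq> 0" if "i \<in> I" for i using kroot_nz[OF that t(1)] t(2) by simp
  have "coeff_fun f e ((1 / t) ^ k) = twist_sum f e (\<lambda>i. kroot i t / t) / monom_at e (\<lambda>i. kroot i t / t)"
    using coeff_fun_eq[OF cone nz] by simp
  also have "\<dots> = t ^ (\<Sum>l\<in>I. e l) * inverse (monom_at e (\<lambda>i. kroot i t)) * twist_sum f e (\<lambda>i. kroot i t / t)"
    unfolding monom_at_divide using t(2) by (simp add: field_simps)
  also have "inverse (monom_at e (\<lambda>i. kroot i t)) = radical_fun k I c e (t ^ k)"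
    using radical_fun_monom_at[OF t(1), of e] by (metis inverse_unique mult.commute)
  finally show "coeff_fun f e ((1 / t) ^ k) =
      t ^ (\<Sum>l\<in>I. e l) * radical_fun k I c e (t ^ k) * (\<Sum>\<omega>\<in>deck. inverse (monom_at e \<omega>) * f (at_infinity_pt \<omega> t))"
    unfolding twist_sum_at_infinity[OF t(2)] .
qed

text \<open>Suppose that \<open>f\<close> has its only pole, of order \<open>r + k m\<close>, at \<open>p\<close>, and let \<open>\<Phi> = \<Sum>\<^sub>e p\<^sub>e R\<^sub>e\<close> have order \<open>m\<close>, with
polynomials \<open>p\<^sub>e\<close>. The entire coefficient functions \<open>G\<^sub>e\<close> of \<open>f\<close> are combined to the entire function
\<open>U(u) = \<Sum>\<^sub>e u ^ (\<Sum> e - r) p\<^sub>e(u ^ (- k)) G\<^sub>e(u ^ k)\<close>, which vanishes at \<open>0\<close> by the degree bound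
for \<open>p\<^sub>e\<close>. For \<open>u = 1 / t \<rightarrow> \<infinity>\<close>, the points at infinity other than \<open>p\<close> contribute \<open>0\<close> to the limit of
\<open>U\<close>, and \<open>p\<close> contributes the leading coefficient of \<open>f\<close> times that of \<open>\<Phi>\<close>. This limit is not \<open>0\<close>,
which contradicts Liouville's theorem.\<close>

lemma vanishing_order_is_gap:
  assumes r: "r \<in> {1..k}" and m: "m \<in> vanishing_orders (diff_index k I r) (diff_fps k I c)"
    and off: "holomorphic_off (local_params n X) centre f"
    and pole: "has_pole_of_order (local_params n X) f centre (r + k * m)"
  shows False
proof -
  let ?J = "diff_index k I r"
  obtain \<alpha> where \<alpha>: "m = subdegree (lincomb ?J (diff_fps k I c) \<alpha>)" "lincomb ?J (diff_fps k I c) \<alpha> \<noteq> 0"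
    using m unfolding vanishing_orders_def by blast
  define \<Phi> where "\<Phi> = lincomb ?J (diff_fps k I c) \<alpha>"
  have \<Phi>m: "\<Phi> $ m \<noteq> 0" using \<alpha> unfolding \<Phi>_def by simp
  obtain L where L: "L \<noteq> 0" "((\<lambda>t. t ^ (r + k * m) * f (at_infinity_pt deck_one t)) \<longlongrightarrow> L) (at 0)"
    using pole_limit[OF off pole] by blast
  have "\<forall>e\<in>residue_exps k I r. \<exists>G. G holomorphic_on UNIV \<and> (\<forall>z. z \<notin> c ` I \<longrightarrow> G z = coeff_fun f e z)"
    using coeff_fun_entire[OF off] residue_exps_less by blast
  then obtain G where G: "\<And>e. e \<in> residue_exps k I r \<Longrightarrow> G e holomorphic_on UNIV"
    "\<And>e z. e \<in> residue_exps k I r \<Longrightarrow> z \<notin> c ` I \<Longrightarrow> G e z = coeff_fun f e z"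
    by metis
  have Jd: "fst x \<in> residue_exps k I r" "r + k * snd x < (\<Sum>l\<in>I. fst x l)" if "x \<in> ?J" for x
    using that diff_index_exponent[of "fst x" "snd x" r] by (auto simp: diff_index_def)
  \<comment> \<open>The exponent is positive by \<open>diff_index_exponent\<close>.\<close>
  define U where "U u = (\<Sum>x\<in>?J. \<alpha> x * (u ^ ((\<Sum>l\<in>I. fst x l) - (r + k * snd x)) * G (fst x) (u ^ k)))" for u
  have U0: "U 0 = 0"
    unfolding U_def
  proof (intro sum.neutral ballI)
    fix x assume "x \<in> ?J"
    then have "(\<Sum>l\<in>I. fst x l) - (r + k * snd x) > 0" using Jd(2)[of x] by simp
    from zero_power[where 'a = complex, OF this]
    show "\<alpha> x * (0 ^ ((\<Sum>l\<in>I. fst x l) - (r + k * snd x)) * G (fst x) (0 ^ k)) = 0"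
      by (simp only: mult_zero_left mult_zero_right)
  qed
  have Uhol: "U holomorphic_on UNIV"
  proof -
    have "(\<lambda>u. G (fst x) (u ^ k)) holomorphic_on UNIV" if "x \<in> ?J" for x
    proof -
      have "(G (fst x) \<circ> (\<lambda>u. u ^ k)) holomorphic_on UNIV"
        by (rule holomorphic_on_compose_gen[OF _ G(1)[OF Jd(1)[OF that]]]) (auto intro!: holomorphic_intros)
      then show ?thesis by (simp add: o_def)
    qed
    then show ?thesis unfolding U_def by (intro holomorphic_intros)
  qed
  define V where "V \<omega> s = (\<Sum>x\<in>?J. \<alpha> x * (inverse (monom_at (fst x) \<omega>) * (s ^ snd x * radical_fun k I c (fst x) s)))" for \<omega> s
  define W where "W s = (\<Sum>x\<in>?J. \<alpha> x * (s ^ snd x * radical_fun k I c (fst x) s))" for s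
  have Uinf: "U (1 / t) = (\<Sum>\<omega>\<in>deck. t ^ r * f (at_infinity_pt \<omega> t) * V \<omega> (t ^ k))"
    if t: "t \<in> ball 0 rad" "t \<noteq> 0" for t
  proof -
    have "U (1 / t) = (\<Sum>x\<in>?J. \<Sum>\<omega>\<in>deck. t ^ r * f (at_infinity_pt \<omega> t) *
       (\<alpha> x * (inverse (monom_at (fst x) \<omega>) * ((t ^ k) ^ snd x * radical_fun k I c (fst x) (t ^ k)))))"
      unfolding U_def
    proof (rule sum.cong[OF refl])
      fix x assume x: "x \<in> ?J"
      let ?s = "\<Sum>l\<in>I. fst x l" and ?e = "fst x"
      have "(1 / t) ^ (?s - (r + k * snd x)) * t ^ ?s = t ^ (r + k * snd x)"
      proof -
        have "t ^ ?s = t ^ (?s - (r + k * snd x)) * t ^ (r + k * snd x)"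
          using Jd(2)[OF x] by (simp flip: power_add)
        then show ?thesis using t(2) by (simp add: power_divide)
      qed
      then have "(1 / t) ^ (?s - (r + k * snd x)) * G ?e ((1 / t) ^ k) =
         t ^ (r + k * snd x) * (radical_fun k I c ?e (t ^ k) * (\<Sum>\<omega>\<in>deck. inverse (monom_at ?e \<omega>) * f (at_infinity_pt \<omega> t)))"
        unfolding G(2)[OF Jd(1)[OF x] coeff_fun_at_infinity(1)[OF t]] coeff_fun_at_infinity(2)[OF t]
        by (simp only: mult.assoc[symmetric])
      then show "\<alpha> x * ((1 / t) ^ (?s - (r + k * snd x)) * G ?e ((1 / t) ^ k)) = (\<Sum>\<omega>\<in>deck. t ^ r * f (at_infinity_pt \<omega> t) *
       (\<alpha> x * (inverse (monom_at (fst x) \<omega>) * ((t ^ k) ^ snd x * radical_fun k I c (fst x) (t ^ k)))))"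
        by (simp add: sum_distrib_left power_add power_mult mult_ac)
    qed
    also have "\<dots> = (\<Sum>\<omega>\<in>deck. t ^ r * f (at_infinity_pt \<omega> t) * V \<omega> (t ^ k))"
      unfolding V_def sum_distrib_left by (rule sum.swap)
    finally show ?thesis .
  qed
  have rad0: "(0::complex) \<in> ball 0 rad" using rad_pos by simp
  have power_lim: "((\<lambda>t::complex. t ^ d) \<longlongrightarrow> 0) (at 0)" if "d > 0" for d
    using tendsto_power[OF tendsto_ident_at[of "0::complex" UNIV], of d] that by (simp add: power_0_left)
  have Wexp: "W has_fps_expansion \<Phi>"
    unfolding W_def \<Phi>_def lincomb_def diff_fps_def case_prod_beta
    by (intro has_fps_expansion_sum has_fps_expansion_cmult_left has_fps_expansion_mult
        has_fps_expansion_fps_X_power radical_fun_has_fps_expansion)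
  define W' where "W' s = (if s = 0 then \<Phi> $ m else W s / s ^ m)" for s
  have "W' has_fps_expansion fps_shift m \<Phi>"
    unfolding W'_def using \<alpha>(1) by (intro has_fps_expansion_shift Wexp) (simp_all add: \<Phi>_def)
  then have "isCont W' 0" by (rule has_fps_expansion_imp_continuous)
  then have "((\<lambda>t. W' (t ^ k)) \<longlongrightarrow> W' 0) (at 0)"
    by (rule isCont_tendsto_compose[OF _ power_lim[OF k0]])
  moreover have "W' 0 = \<Phi> $ m" by (simp add: W'_def)
  ultimately have W'lim: "((\<lambda>t. W' (t ^ k)) \<longlongrightarrow> \<Phi> $ m) (at 0)" by simp
  define diagonal where "diagonal \<omega> \<longleftrightarrow> (\<forall>i\<in>I. \<omega> i = \<omega> j0)" for \<omega> :: "nat \<Rightarrow> complex"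
  have lim: "((\<lambda>t. t ^ r * f (at_infinity_pt \<omega> t) * V \<omega> (t ^ k)) \<longlongrightarrow> (if diagonal \<omega> then L * \<Phi> $ m else 0)) (at 0)"
    if \<omega>: "\<omega> \<in> deck" for \<omega>
  proof (cases "diagonal \<omega>")
    case True
    define \<zeta> where "\<zeta> = \<omega> j0"
    have \<omega>c: "\<omega> i = \<zeta>" if "i \<in> I" for i using True that by (simp add: diagonal_def \<zeta>_def)
    have \<zeta>: "\<zeta> \<noteq> 0" "\<zeta> ^ k = 1" using deck_nz[OF \<omega> j0] deckD[OF \<omega> j0] by (auto simp: \<zeta>_def)
    have "monom_at (fst x) \<omega> = \<zeta> ^ r" if "x \<in> ?J" for x
    proof -
      have "monom_at (fst x) \<omega> = monom_at (fst x) (\<lambda>_. \<zeta>)" by (rule monom_at_cong) (rule \<omega>c)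
      then show ?thesis unfolding monom_at_const sum_exps_power[OF \<zeta>(2) Jd(1)[OF that]] .
    qed
    then have V: "V \<omega> s = inverse (\<zeta> ^ r) * W s" for s
      unfolding V_def W_def sum_distrib_left by (intro sum.cong refl) (simp add: mult_ac)
    have l0: "((\<lambda>t. t / \<zeta>) \<longlongrightarrow> 0 / \<zeta>) (at 0)" using \<zeta> by (intro tendsto_intros)
    have fl: "filterlim (\<lambda>t. t / \<zeta>) (at 0) (at 0)"
      unfolding filterlim_at using l0 \<zeta>(1) by (auto simp: eventually_at_filter)
    have "((\<lambda>t. ((t / \<zeta>) ^ (r + k * m) * f (at_infinity_pt deck_one (t / \<zeta>))) * W' (t ^ k)) \<longlongrightarrow> L * \<Phi> $ m) (at 0)"
      by (intro tendsto_mult W'lim filterlim_compose[OF L(2) fl])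
    moreover have "eventually (\<lambda>t. ((t / \<zeta>) ^ (r + k * m) * f (at_infinity_pt deck_one (t / \<zeta>))) * W' (t ^ k)
        = t ^ r * f (at_infinity_pt \<omega> t) * V \<omega> (t ^ k)) (at 0)"
    proof -
      have "((t / \<zeta>) ^ (r + k * m) * f (at_infinity_pt deck_one (t / \<zeta>))) * W' (t ^ k)
        = t ^ r * f (at_infinity_pt \<omega> t) * V \<omega> (t ^ k)" if t: "t \<noteq> 0" for t
      proof -
        have A1: "(t / \<zeta>) ^ (r + k * m) = t ^ r * inverse (\<zeta> ^ r) * (t ^ k) ^ m"
          using \<zeta> by (simp add: power_add power_divide power_mult field_simps)
        have A2: "W (t ^ k) = (t ^ k) ^ m * W' (t ^ k)" using t by (simp add: W'_def)
        have A3: "at_infinity_pt \<omega> t = at_infinity_pt deck_one (t / \<zeta>)"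
          by (rule at_infinity_pt_const[OF \<omega>]) (rule \<omega>c)
        show ?thesis
          unfolding V A3 A2 A1 by (simp only: mult_ac)
      qed
      then show ?thesis by (simp add: eventually_at_filter)
    qed
    ultimately have "((\<lambda>t. t ^ r * f (at_infinity_pt \<omega> t) * V \<omega> (t ^ k)) \<longlongrightarrow> L * \<Phi> $ m) (at 0)"
      by (rule Lim_transform_eventually)
    then show ?thesis using True by simp
  next
    case False
    have "at_infinity_pt \<omega> t \<noteq> centre" if "t \<in> ball 0 rad" for t
      using at_infinity_eq_centre_iff[OF \<omega> that] False by (auto simp: diagonal_def)
    then have "{z \<in> ball 0 rad. at_infinity_pt \<omega> z \<noteq> centre} = ball 0 rad" by blast
    moreover have "(f \<circ> at_infinity_pt \<omega>) holomorphic_on {z \<in> ball 0 rad. at_infinity_pt \<omega> z \<noteq> centre}"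
      using off at_infinity_local_params[OF \<omega>] unfolding holomorphic_off_def by blast
    ultimately have "(f \<circ> at_infinity_pt \<omega>) holomorphic_on ball 0 rad" by simp
    then have "isCont (f \<circ> at_infinity_pt \<omega>) 0"
      using rad0 holomorphic_on_imp_continuous_on continuous_on_eq_continuous_at open_ball by blast
    then have c1: "((\<lambda>t. f (at_infinity_pt \<omega> t)) \<longlongrightarrow> f (at_infinity_pt \<omega> 0)) (at 0)"
      by (simp add: isCont_def o_def)
    have "isCont (radical_fun k I c e) 0" for e
      using has_fps_expansion_imp_continuous[OF radical_fun_has_fps_expansion] .
    then have "isCont (V \<omega>) 0" unfolding V_def by (intro continuous_intros)
    then have c2: "((\<lambda>t. V \<omega> (t ^ k)) \<longlongrightarrow> V \<omega> 0) (at 0)"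
      using isCont_tendsto_compose[OF _ power_lim[OF k0]] by blast
    have "((\<lambda>t. t ^ r * f (at_infinity_pt \<omega> t) * V \<omega> (t ^ k)) \<longlongrightarrow> 0 * f (at_infinity_pt \<omega> 0) * V \<omega> 0) (at 0)"
      using r by (intro tendsto_mult c1 c2 power_lim) simp
    then show ?thesis using False by simp
  qed
  define tot where "tot = (\<Sum>\<omega>\<in>deck. if diagonal \<omega> then L * \<Phi> $ m else 0)"
  have limU: "((\<lambda>t. \<Sum>\<omega>\<in>deck. t ^ r * f (at_infinity_pt \<omega> t) * V \<omega> (t ^ k)) \<longlongrightarrow> tot) (at 0)"
    unfolding tot_def by (intro tendsto_sum lim)
  have "eventually (\<lambda>t. (\<Sum>\<omega>\<in>deck. t ^ r * f (at_infinity_pt \<omega> t) * V \<omega> (t ^ k)) = (U \<circ> inverse) t) (at 0)"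
    unfolding eventually_at_filter using eventually_nhds_in_open[OF open_ball rad0]
    by eventually_elim (use Uinf in \<open>auto simp: inverse_eq_divide\<close>)
  then have "((U \<circ> inverse) \<longlongrightarrow> tot) (at 0)" by (rule Lim_transform_eventually[OF limU])
  then have "(U \<longlongrightarrow> tot) at_infinity" by (simp add: lim_at_infinity_0)
  from Liouville_weak[OF Uhol this, of 0] have "tot = 0" using U0 by simp
  moreover have "tot = of_nat (card {\<omega> \<in> deck. diagonal \<omega>}) * (L * \<Phi> $ m)"
    unfolding tot_def using finite_deck by (simp add: sum.If_cases Int_def)
  moreover have "card {\<omega> \<in> deck. diagonal \<omega>} \<noteq> 0"
  proof -
    have "deck_one \<in> {\<omega> \<in> deck. diagonal \<omega>}" using deck_one j0 by (simp add: diagonal_def)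
    then show ?thesis using finite_deck by auto
  qed
  ultimately show False using L(1) \<Phi>m by simp
qed

end

section \<open>Construction of functions with a prescribed pole\<close>

context fermat_cover
begin

lemma character_sum_deck:
  assumes \<omega>: "\<omega> \<in> deck" and nc: "\<not> (\<forall>i\<in>I. \<omega> i = \<omega> j0)"
  shows "(\<Sum>e\<in>residue_exps k I r. monom_at e \<omega>) = 0"
proof -
  obtain i where i: "i \<in> I" "\<omega> i \<noteq> \<omega> j0" using nc by blast
  show ?thesis unfolding monom_at_def by (rule character_sum_residue_exps[OF finI i(1) j0 i(2) k0 deckD[OF \<omega>]])
qed

text \<open>If \<open>m\<close> is not a vanishing order, there is a Laurent tail
\<open>h(t) = \<Sum>\<^sub>l g\<^sub>l t ^ (- r - k l)\<close>, \<open>g\<^sub>m \<noteq> 0\<close>, annihilated by all \<open>s ^ i R\<^sub>e\<close>. Put \<open>\<beta>\<^sub>e = R\<^sub>e \<Gamma>\<close>, where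
\<open>h = t ^ (- r - k m) \<Gamma>(t ^ k)\<close>. The annihilation says that exactly those coefficients of \<open>\<beta>\<^sub>e\<close> vanish that
would require negative powers of \<open>z\<close>, so the first \<open>m + 1\<close> terms of \<open>\<beta>\<^sub>e\<close> define a polynomial
\<open>P\<^sub>e\<close> for which \<open>y ^ e P\<^sub>e(z)\<close> and \<open>h\<close> differ by a holomorphic function of \<open>t\<close>. At the point at
infinity given by \<open>\<omega>\<close>, the sum of the \<open>y ^ e P\<^sub>e(z)\<close> has the principal part \<open>(\<Sum>\<^sub>e \<omega> ^ e) h\<close>, and the character
sum vanishes except at \<open>p\<close>.\<close>

lemma nongap_exists:
  assumes r: "r \<in> {1..k}" and m: "m \<notin> vanishing_orders (diff_index k I r) (diff_fps k I c)"
  shows "\<exists>f. holomorphic_off (local_params n X) centre f \<and> has_pole_of_order (local_params n X) f centre (r + k * m)"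
proof -
  define E where "E = residue_exps k I r"
  define N where "N e = (\<Sum>l\<in>I. e l)" for e :: "nat \<Rightarrow> nat"
  have finE: "finite E" unfolding E_def by (rule finite_residue_exps[OF finI])
  obtain g where g: "\<And>x. x \<in> diff_index k I r \<Longrightarrow> (\<Sum>l\<le>m. g l * diff_fps k I c x $ l) = 0" "g m \<noteq> 0"
    using vanishing_order_or_annihilator[OF finite_diff_index[OF finI] m] by metis
  define \<Gamma> where "\<Gamma> = (\<Sum>l\<le>m. fps_const (g l) * fps_X ^ (m - l))"
  define \<Gamma>f where "\<Gamma>f s = (\<Sum>l\<le>m. g l * s ^ (m - l))" for s
  have \<Gamma>f: "\<Gamma>f has_fps_expansion \<Gamma>"
    unfolding \<Gamma>f_def \<Gamma>_def by (intro has_fps_expansion_sum has_fps_expansion_cmult_left has_fps_expansion_fps_X_power)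
  have \<Gamma>f0: "\<Gamma>f 0 = g m"
    unfolding \<Gamma>f_def by (subst sum.remove[of _ m]) (auto simp: power_0_left intro!: sum.neutral)
  define \<beta> where "\<beta> e = radical_fps k I c e * \<Gamma>" for e
  have \<beta>: "(\<lambda>s. radical_fun k I c e s * \<Gamma>f s) has_fps_expansion \<beta> e" for e
    unfolding \<beta>_def by (intro has_fps_expansion_mult radical_fun_has_fps_expansion \<Gamma>f)
  have modN: "N e mod k = r mod k" if "e \<in> E" for e using that by (simp add: E_def residue_exps_def N_def)
  have \<beta>0: "\<beta> e $ (m - l) = 0" if e: "e \<in> E" and l: "l \<le> m" "r + k * l < N e" for e l
  proof -
    have "k dvd N e - r" using modN[OF e] l(2) by (simp add: mod_eq_dvd_iff_nat)
    then obtain q where q: "N e - r = k * q" by blast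
    have "k * l < k * q" using l(2) q by linarith
    then have "l < num_powers k I r e" using k0 q by (simp add: num_powers_def N_def)
    then have "(e, l) \<in> diff_index k I r" using e by (simp add: diff_index_def E_def)
    from g(1)[OF this] have z: "(\<Sum>l'\<le>m. g l' * (fps_X ^ l * radical_fps k I c e) $ l') = 0" by (simp add: diff_fps_def)
    have "\<beta> e $ (m - l) = (\<Sum>l'\<le>m. g l' * (fps_X ^ (m - l') * radical_fps k I c e) $ (m - l))"
      unfolding \<beta>_def \<Gamma>_def sum_distrib_left fps_sum_nth
    proof (intro sum.cong refl)
      fix l'
      have "radical_fps k I c e * (fps_const (g l') * fps_X ^ (m - l')) = fps_const (g l') * (fps_X ^ (m - l') * radical_fps k I c e)"
        by (simp only: mult_ac)
      then show "(radical_fps k I c e * (fps_const (g l') * fps_X ^ (m - l'))) $ (m - l) =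
          g l' * (fps_X ^ (m - l') * radical_fps k I c e) $ (m - l)"
        by (simp only: fps_mult_left_const_nth)
    qed
    also have "\<dots> = (\<Sum>l'\<le>m. g l' * (fps_X ^ l * radical_fps k I c e) $ l')"
      using l(1) by (intro sum.cong refl) (auto simp: fps_X_power_mult_nth)
    finally show ?thesis using z by simp
  qed
  define P where "P e u = (\<Sum>l\<le>m. if N e \<le> r + k * l then \<beta> e $ (m - l) * u ^ ((r + k * l - N e) div k) else 0)" for e u
  have P_at: "P e ((1 / t) ^ k) * t ^ (r + k * m) = t ^ N e * (\<Sum>l\<le>m. \<beta> e $ l * (t ^ k) ^ l)"
    if e: "e \<in> E" and t: "t \<noteq> 0" for e t
  proof -
    have "P e ((1 / t) ^ k) * t ^ (r + k * m) = (\<Sum>l\<le>m. t ^ N e * (\<beta> e $ (m - l) * (t ^ k) ^ (m - l)))"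
      unfolding P_def sum_distrib_right
    proof (intro sum.cong refl)
      fix l assume "l \<in> {..m}"
      then have l: "l \<le> m" by simp
      show "(if N e \<le> r + k * l then \<beta> e $ (m - l) * ((1 / t) ^ k) ^ ((r + k * l - N e) div k) else 0) * t ^ (r + k * m)
          = t ^ N e * (\<beta> e $ (m - l) * (t ^ k) ^ (m - l))"
      proof (cases "N e \<le> r + k * l")
        case False
        then show ?thesis using \<beta>0[OF e l] by simp
      next
        case True
        have "(r + k * l) mod k = N e mod k" using modN[OF e] by simp
        then have "k dvd r + k * l - N e" using mod_eq_dvd_iff_nat[OF True, of k] by blast
        then have "((1 / t) ^ k) ^ ((r + k * l - N e) div k) = (1 / t) ^ (r + k * l - N e)"
          by (simp flip: power_mult)
        moreover have "t ^ (r + k * m) = t ^ (r + k * l - N e) * (t ^ N e * (t ^ k) ^ (m - l))"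
        proof -
          have "k * m = k * l + k * (m - l)" using l by (simp flip: distrib_left)
          then have "r + k * m = (r + k * l - N e) + (N e + k * (m - l))" using True by linarith
          then show ?thesis by (simp only: power_add power_mult)
        qed
        ultimately show ?thesis using True t by (simp add: power_divide)
      qed
    qed
    also have "\<dots> = t ^ N e * (\<Sum>l\<le>m. \<beta> e $ (m - l) * (t ^ k) ^ (m - l))" by (simp only: sum_distrib_left)
    also have "(\<Sum>l\<le>m. \<beta> e $ (m - l) * (t ^ k) ^ (m - l)) = (\<Sum>l\<le>m. \<beta> e $ l * (t ^ k) ^ l)"
      by (rule sum.reindex_bij_witness[of _ "\<lambda>l. m - l" "\<lambda>l. m - l"]) auto
    finally show ?thesis .
  qed
  define C where "C e = eval_fps (fps_shift (Suc m) (\<beta> e))" for e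
  have Crad: "fps_conv_radius (\<beta> e) > 0" for e using \<beta>[of e] by (simp add: has_fps_expansion_def)
  have Chol: "C e holomorphic_on eball 0 (fps_conv_radius (\<beta> e))" for e
    unfolding C_def by (intro holomorphic_on_eval_fps) simp
  have Cev: "eventually (\<lambda>s. radical_fun k I c e s * \<Gamma>f s = (\<Sum>l\<le>m. \<beta> e $ l * s ^ l) + s ^ Suc m * C e s) (nhds 0)" for e
  proof -
    have "(\<lambda>s. (\<Sum>l\<le>m. \<beta> e $ l * s ^ l) + s ^ Suc m * C e s) has_fps_expansion
      (\<Sum>l\<le>m. fps_const (\<beta> e $ l) * fps_X ^ l) + fps_X ^ Suc m * fps_shift (Suc m) (\<beta> e)"
      unfolding C_def using Crad[of e]
      by (intro has_fps_expansion_add has_fps_expansion_sum has_fps_expansion_cmult_left has_fps_expansion_mult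
          has_fps_expansion_fps_X_power eval_fps_has_fps_expansion) simp
    also have "(\<Sum>l\<le>m. fps_const (\<beta> e $ l) * fps_X ^ l) = fps_cutoff (Suc m) (\<beta> e)"
      by (rule fps_ext) (simp add: fps_sum_nth if_distrib[of "\<lambda>x. _ * x"] less_Suc_eq_le cong: if_cong)
    also have "fps_cutoff (Suc m) (\<beta> e) + fps_X ^ Suc m * fps_shift (Suc m) (\<beta> e) = \<beta> e"
      using fps_shift_cutoff'[of "Suc m" "\<beta> e"] by (simp only: add.commute)
    finally have "eventually (\<lambda>s. eval_fps (\<beta> e) s = (\<Sum>l\<le>m. \<beta> e $ l * s ^ l) + s ^ Suc m * C e s) (nhds 0)"
      unfolding has_fps_expansion_def by blast
    moreover have "eventually (\<lambda>s. eval_fps (\<beta> e) s = radical_fun k I c e s * \<Gamma>f s) (nhds 0)"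
      using \<beta>[of e] unfolding has_fps_expansion_def by blast
    ultimately show ?thesis by eventually_elim (simp only:)
  qed
  have "eventually (\<lambda>s. \<forall>e\<in>E. s \<in> eball 0 (fps_conv_radius (\<beta> e)) \<and>
      radical_fun k I c e s * \<Gamma>f s = (\<Sum>l\<le>m. \<beta> e $ l * s ^ l) + s ^ Suc m * C e s) (nhds 0)"
  proof (intro eventually_ball_finite[OF finE] ballI eventually_conj Cev)
    fix e show "eventually (\<lambda>s. s \<in> eball 0 (fps_conv_radius (\<beta> e))) (nhds 0)"
      using Crad[of e] by (intro eventually_nhds_in_open) (auto simp: zero_ereal_def)
  qed
  then obtain \<delta>0 where \<delta>0: "\<delta>0 > 0" "\<And>s e. norm s < \<delta>0 \<Longrightarrow> e \<in> E \<Longrightarrow> s \<in> eball 0 (fps_conv_radius (\<beta> e)) \<and>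
      radical_fun k I c e s * \<Gamma>f s = (\<Sum>l\<le>m. \<beta> e $ l * s ^ l) + s ^ Suc m * C e s"
    unfolding eventually_nhds_metric by (auto simp: dist_norm)
  define \<delta> where "\<delta> = min rad (min 1 \<delta>0)"
  have \<delta>: "\<delta> > 0" using rad_pos \<delta>0 by (simp add: \<delta>_def)
  have \<delta>rad: "t \<in> ball 0 rad" and \<delta>pow: "norm (t ^ k) < \<delta>0" if "t \<in> ball 0 \<delta>" for t :: complex
  proof -
    have t: "norm t < rad" "norm t < 1" "norm t < \<delta>0" using that by (auto simp: \<delta>_def)
    show "t \<in> ball 0 rad" using t by simp
    have "norm t ^ k \<le> norm t ^ 1" using t k0 by (intro power_decreasing) auto
    then show "norm (t ^ k) < \<delta>0" using t by (simp add: norm_power)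
  qed
  define D where "D e t = C e (t ^ k) * monom_at e (\<lambda>i. kroot i t)" for e t
  have Dhol: "D e holomorphic_on ball 0 \<delta>" if e: "e \<in> E" for e
  proof -
    have "(C e \<circ> (\<lambda>t. t ^ k)) holomorphic_on ball 0 \<delta>"
      by (intro holomorphic_on_compose_gen[OF _ Chol] holomorphic_intros) (use \<delta>0(2)[OF \<delta>pow e] in blast)
    moreover have "kroot i holomorphic_on ball 0 \<delta>" if "i \<in> I" for i
      using kroot_holomorphic[OF that] by (rule holomorphic_on_subset) (use \<delta>rad in blast)
    ultimately show ?thesis unfolding D_def monom_at_def by (intro holomorphic_intros) (auto simp: o_def)
  qed
  have key: "monom_at e (\<lambda>i. kroot i t / t) * P e ((1 / t) ^ k) = \<Gamma>f (t ^ k) / t ^ (r + k * m) - t ^ (k - r) * D e t"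
    if e: "e \<in> E" and t: "t \<in> ball 0 \<delta>" "t \<noteq> 0" for e t
  proof -
    let ?M = "monom_at e (\<lambda>i. kroot i t)" and ?R = "radical_fun k I c e (t ^ k)"
    have RM: "?R * ?M = 1" by (rule radical_fun_monom_at[OF \<delta>rad[OF t(1)]])
    have B: "(\<Sum>l\<le>m. \<beta> e $ l * (t ^ k) ^ l) = ?R * \<Gamma>f (t ^ k) - (t ^ k) ^ Suc m * C e (t ^ k)"
      using \<delta>0(2)[OF \<delta>pow[OF t(1)] e] by simp
    have kk: "(t ^ k) ^ Suc m = t ^ (k - r) * t ^ (r + k * m)"
    proof -
      have "k * Suc m = (k - r) + (r + k * m)" using r by simp
      then show ?thesis by (simp only: power_mult[symmetric] power_add)
    qed
    have "monom_at e (\<lambda>i. kroot i t / t) * P e ((1 / t) ^ k) * t ^ (r + k * m) =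
        ?M / t ^ N e * (t ^ N e * (?R * \<Gamma>f (t ^ k) - (t ^ k) ^ Suc m * C e (t ^ k)))"
      unfolding monom_at_divide N_def[symmetric] mult.assoc P_at[OF e t(2)] B ..
    also have "\<dots> = ?M * (?R * \<Gamma>f (t ^ k) - (t ^ k) ^ Suc m * C e (t ^ k))" using t(2) by simp
    also have "\<dots> = (?R * ?M) * \<Gamma>f (t ^ k) - (t ^ k) ^ Suc m * D e t" by (simp add: D_def algebra_simps)
    also have "\<dots> = (\<Gamma>f (t ^ k) / t ^ (r + k * m) - t ^ (k - r) * D e t) * t ^ (r + k * m)"
      unfolding RM kk using t(2) by (simp add: algebra_simps)
    finally show ?thesis using t(2) by simp
  qed
  \<comment> \<open>The second branch is the limit at a point at infinity other than \<open>p\<close>. The power \<open>0 ^ (k - r)\<close> is \<open>1\<close> for \<open>r = k\<close>.\<close>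
  define F where "F x = (if x j \<noteq> 0 then \<Sum>e\<in>E. monom_at e (\<lambda>i. x i / (b i * x j)) * P e ((x j0 / x j) ^ k)
     else - (\<Sum>e\<in>E. monom_at e (\<lambda>i. x i / (b i * x j0)) * (0 ^ (k - r) * D e 0)))" for x
  have F_scale: "F (\<lambda>i. a * x i) = F x" if "a \<noteq> 0" for a x
  proof -
    have "a * x i / (b i * (a * x l)) = x i / (b i * x l)" for i l using that by simp
    moreover have "a * x j0 / (a * x j) = x j0 / x j" using that by simp
    ultimately show ?thesis using that by (simp only: F_def mult_eq_0_iff simp_thms)
  qed
  define f where "f Q = F (SOME x. x \<in> Q)" for Q :: "(nat \<Rightarrow> complex) set"
  have f_pt: "f (proj_pt x) = F x" for x
  proof -
    have "(SOME y. y \<in> proj_pt x) \<in> proj_pt x" by (rule someI[of _ x]) (rule mem_proj_pt_self)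
    then obtain a where a: "a \<noteq> 0" "(SOME y. y \<in> proj_pt x) = (\<lambda>i. a * x i)" using mem_proj_ptD by blast
    show ?thesis unfolding f_def a(2) by (rule F_scale[OF a(1)])
  qed
  have f_inf: "f (at_infinity_pt \<omega> t) = \<Gamma>f (t ^ k) / t ^ (r + k * m) * (\<Sum>e\<in>E. monom_at e \<omega>) - (\<Sum>e\<in>E. monom_at e \<omega> * (t ^ (k - r) * D e t))"
    if \<omega>: "\<omega> \<in> deck" "\<omega> j0 = 1" and t: "t \<in> ball 0 \<delta>" "t \<noteq> 0" for \<omega> t
  proof -
    have "f (at_infinity_pt \<omega> t) = (\<Sum>e\<in>E. monom_at e (\<lambda>i. coords t (\<lambda>i. \<omega> i * kroot i t) i / (b i * t)) * P e ((1 / t) ^ k))"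
      unfolding at_infinity_pt_def f_pt F_def using t(2) j0 \<omega>(2) b0 by simp
    also have "\<dots> = (\<Sum>e\<in>E. monom_at e \<omega> * (\<Gamma>f (t ^ k) / t ^ (r + k * m) - t ^ (k - r) * D e t))"
    proof (rule sum.cong[OF refl])
      fix e assume e: "e \<in> E"
      have M: "monom_at e (\<lambda>i. coords t (\<lambda>i. \<omega> i * kroot i t) i / (b i * t)) = monom_at e \<omega> * monom_at e (\<lambda>i. kroot i t / t)"
        unfolding monom_at_mult[symmetric] by (rule monom_at_cong) (simp add: b)
      show "monom_at e (\<lambda>i. coords t (\<lambda>i. \<omega> i * kroot i t) i / (b i * t)) * P e ((1 / t) ^ k)
         = monom_at e \<omega> * (\<Gamma>f (t ^ k) / t ^ (r + k * m) - t ^ (k - r) * D e t)"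
        unfolding key[OF e t, symmetric] M by (rule mult.assoc)
    qed
    also have "\<dots> = \<Gamma>f (t ^ k) / t ^ (r + k * m) * (\<Sum>e\<in>E. monom_at e \<omega>) - (\<Sum>e\<in>E. monom_at e \<omega> * (t ^ (k - r) * D e t))"
      unfolding right_diff_distrib sum_subtractf sum_distrib_right[symmetric]
        mult.commute[of "\<Gamma>f (t ^ k) / t ^ (r + k * m)" "\<Sum>e\<in>E. monom_at e \<omega>"] ..
    finally show ?thesis .
  qed
  have f_inf_other: "f (at_infinity_pt \<omega> t) = - (\<Sum>e\<in>E. monom_at e \<omega> * (t ^ (k - r) * D e t))"
    if \<omega>: "\<omega> \<in> deck" "\<omega> j0 = 1" and nc: "\<not> (\<forall>i\<in>I. \<omega> i = \<omega> j0)" and t: "t \<in> ball 0 \<delta>" for \<omega> t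
  proof (cases "t = 0")
    case False
    then show ?thesis using f_inf[OF \<omega> t False] character_sum_deck[OF \<omega>(1) nc, of r] by (simp add: E_def)
  next
    case True
    have F0: "f (at_infinity_pt \<omega> 0) = - (\<Sum>e\<in>E. monom_at e (\<lambda>i. coords 0 (\<lambda>i. \<omega> i * kroot i 0) i / (b i * 1)) * (0 ^ (k - r) * D e 0))"
      unfolding at_infinity_pt_def f_pt F_def using j0 \<omega>(2) b0 by simp
    have "monom_at e (\<lambda>i. coords 0 (\<lambda>i. \<omega> i * kroot i 0) i / (b i * 1)) = monom_at e \<omega>" for e
      by (rule monom_at_cong) (simp add: b)
    then show ?thesis unfolding True F0 by (simp only:)
  qed
  have off: "holomorphic_off (local_params n X) centre f"
    unfolding holomorphic_off_def
  proof (intro ballI, clarify)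
    fix D' \<psi> assume \<Phi>: "(D', \<psi>) \<in> local_params n X"
    obtain \<Psi> where D': "open D'" and "inj_on \<psi> D'" and \<psi>X: "\<psi> ` D' \<subseteq> X" and \<Psi>: "\<And>z. z \<in> D' \<Longrightarrow> \<Psi> z \<in> hom_coords n"
      "\<And>z. z \<in> D' \<Longrightarrow> \<psi> z = proj_pt (\<Psi> z)" and hol: "\<And>i. i \<le> n \<Longrightarrow> (\<lambda>z. \<Psi> z i) holomorphic_on D'"
      by (rule local_paramsE[OF \<Phi>]) (rule that)
    show "(f \<circ> \<psi>) holomorphic_on {z \<in> D'. \<psi> z \<noteq> centre}"
    proof (rule holomorphic_onI)
      fix z0 assume "z0 \<in> {z \<in> D'. \<psi> z \<noteq> centre}"
      then have z0: "z0 \<in> D'" "\<psi> z0 \<noteq> centre" by auto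
      have "\<exists>S. open S \<and> z0 \<in> S \<and> (f \<circ> \<psi>) holomorphic_on S"
      proof (cases "\<Psi> z0 j = 0")
        case False
        define S where "S = D' \<inter> (\<lambda>z. \<Psi> z j) -` (- {0})"
        have "open S" unfolding S_def
          using holomorphic_on_imp_continuous_on[OF hol[OF j]] D' by (intro continuous_open_preimage) auto
        moreover have "z0 \<in> S" using z0 False by (simp add: S_def)
        moreover have "(f \<circ> \<psi>) holomorphic_on S"
        proof -
          have hS: "(\<lambda>z. \<Psi> z i) holomorphic_on S" if "i \<le> n" for i
            using hol[OF that] by (rule holomorphic_on_subset) (auto simp: S_def)
          have nz: "\<Psi> z j \<noteq> 0" if "z \<in> S" for z using that by (simp add: S_def)
          have "(\<lambda>z. \<Sum>e\<in>E. monom_at e (\<lambda>i. \<Psi> z i / (b i * \<Psi> z j)) * P e ((\<Psi> z j0 / \<Psi> z j) ^ k)) holomorphic_on S"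
          proof (intro holomorphic_on_sum holomorphic_on_mult)
            fix e
            show "(\<lambda>z. monom_at e (\<lambda>i. \<Psi> z i / (b i * \<Psi> z j))) holomorphic_on S"
              unfolding monom_at_def using nz b j I_le by (intro holomorphic_intros hS) auto
            have q: "(\<lambda>z. (\<Psi> z j0 / \<Psi> z j) ^ k) holomorphic_on S"
              using nz j I_le[OF j0] by (intro holomorphic_intros hS) auto
            show "(\<lambda>z. P e ((\<Psi> z j0 / \<Psi> z j) ^ k)) holomorphic_on S"
              unfolding P_def
            proof (rule holomorphic_on_sum)
              fix l
              show "(\<lambda>z. if N e \<le> r + k * l then \<beta> e $ (m - l) * ((\<Psi> z j0 / \<Psi> z j) ^ k) ^ ((r + k * l - N e) div k) else 0) holomorphic_on S"
                by (cases "N e \<le> r + k * l") (simp_all add: holomorphic_on_mult holomorphic_on_power[OF q])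
            qed
          qed
          then show ?thesis
            by (rule holomorphic_transform) (use \<Psi>(2) nz in \<open>auto simp: f_pt F_def S_def\<close>)
        qed
        ultimately show ?thesis by blast
      next
        case True
        have X0: "proj_pt (\<Psi> z0) \<in> X" using \<psi>X \<Psi>(2)[OF z0(1)] z0(1) by auto
        define y where "y i = \<Psi> z0 i / b i" for i
        have \<Psi>0: "\<Psi> z0 = coords 0 y" and cone: "on_cone 0 y"
          using point_coords[OF \<Psi>(1)[OF z0(1)] X0] True unfolding y_def by simp_all
        have yk: "y i ^ k = y j0 ^ k" if "i \<in> I" for i using on_coneD[OF cone that] k0 by (simp add: power_0_left)
        have yj0: "y j0 \<noteq> 0"
        proof
          assume "y j0 = 0"
          then have y0: "y i = 0" if "i \<in> I" for i using yk[OF that] k0 by (simp add: power_0_left)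
          have "\<Psi> z0 i = 0" for i unfolding \<Psi>0 coords_def using y0 by simp
          then show False using \<Psi>(1)[OF z0(1)] by (simp add: hom_coords_def)
        qed
        define \<omega> where "\<omega> = (\<lambda>i\<in>I. y i / y j0)"
        have "(y i / y j0) ^ k = 1" if "i \<in> I" for i
          unfolding power_divide yk[OF that] using yj0 by simp
        then have \<omega>: "\<omega> \<in> deck" "\<omega> j0 = 1"
          using yj0 j0 by (auto simp: \<omega>_def deck_def roots_def)
        have "coords 0 y = coords (y j0 * 0) (\<lambda>i. y j0 * (\<omega> i * kroot i 0))"
          using yj0 by (auto simp: coords_def \<omega>_def fun_eq_iff)
        also have "\<dots> = (\<lambda>i. y j0 * coords 0 (\<lambda>i. \<omega> i * kroot i 0) i)" by (rule coords_scale)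
        finally have at: "\<psi> z0 = at_infinity_pt \<omega> 0"
          unfolding \<Psi>(2)[OF z0(1)] \<Psi>0 at_infinity_pt_def by (simp only: proj_pt_scale[OF yj0])
        have nc: "\<not> (\<forall>i\<in>I. \<omega> i = \<omega> j0)"
          using z0(2) at at_infinity_eq_centre_iff[OF \<omega>(1), of 0] rad_pos by auto
        obtain T \<theta> where T: "open T" "z0 \<in> T" "T \<subseteq> D'" and \<theta>: "\<theta> holomorphic_on T" "\<theta> z0 = 0"
          and eq: "\<And>z. z \<in> T \<Longrightarrow> \<psi> z = at_infinity_pt \<omega> (\<theta> z)"
          using local_param_at_infinity[OF \<Phi> z0(1) \<omega> at] by metis
        define S where "S = T \<inter> \<theta> -` ball 0 \<delta>"
        have "open S" unfolding S_def
          using holomorphic_on_imp_continuous_on[OF \<theta>(1)] T(1) by (intro continuous_open_preimage) auto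
        moreover have "z0 \<in> S" using T(2) \<theta>(2) \<delta> by (simp add: S_def)
        moreover have "(f \<circ> \<psi>) holomorphic_on S"
        proof -
          have "(\<lambda>t. - (\<Sum>e\<in>E. monom_at e \<omega> * (t ^ (k - r) * D e t))) holomorphic_on ball 0 \<delta>"
            by (intro holomorphic_intros Dhol)
          moreover have "\<theta> holomorphic_on S" using \<theta>(1) by (rule holomorphic_on_subset) (auto simp: S_def)
          ultimately have "((\<lambda>t. - (\<Sum>e\<in>E. monom_at e \<omega> * (t ^ (k - r) * D e t))) \<circ> \<theta>) holomorphic_on S"
            by (intro holomorphic_on_compose_gen[of \<theta> S _ "ball 0 \<delta>"]) (auto simp: S_def)
          then show ?thesis
          proof (rule holomorphic_transform)
            fix z assume "z \<in> S"
            then have z: "z \<in> T" "\<theta> z \<in> ball 0 \<delta>" by (auto simp: S_def)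
            show "((\<lambda>t. - (\<Sum>e\<in>E. monom_at e \<omega> * (t ^ (k - r) * D e t))) \<circ> \<theta>) z = (f \<circ> \<psi>) z"
              unfolding o_def eq[OF z(1)] f_inf_other[OF \<omega> nc z(2)] ..
          qed
        qed
        ultimately show ?thesis by blast
      qed
      then obtain S where "open S" "z0 \<in> S" "(f \<circ> \<psi>) holomorphic_on S" by blast
      then have "(f \<circ> \<psi>) field_differentiable (at z0)" using holomorphic_on_imp_differentiable_at by blast
      then show "(f \<circ> \<psi>) field_differentiable (at z0 within {z \<in> D'. \<psi> z \<noteq> centre})"
        by (rule field_differentiable_at_within)
    qed
  qed
  have pole: "has_pole_of_order (local_params n X) f centre (r + k * m)"
  proof -
    let ?a = "r + k * m"
    define q where "q t = \<Gamma>f (t ^ k) * (\<Sum>e\<in>E. monom_at e deck_one) - t ^ ?a * (\<Sum>e\<in>E. monom_at e deck_one * (t ^ (k - r) * D e t))" for t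
    have qhol: "q holomorphic_on ball 0 \<delta>"
      unfolding q_def \<Gamma>f_def by (intro holomorphic_intros Dhol)
    have one: "monom_at e deck_one = 1" for e
      using monom_at_cong[of deck_one "\<lambda>_. 1" e] deck_one(2) by (simp add: monom_at_const)
    have "I \<noteq> {}" using j0 by blast
    from card_residue_exps[OF finI this k0, of r] have "card E \<noteq> 0"
      unfolding E_def using k0 by simp
    then have q0: "q 0 \<noteq> 0"
      using g(2) r k0 unfolding q_def one by (simp add: power_0_left \<Gamma>f0)
    have feq: "(f \<circ> at_infinity_pt deck_one) t = q t / t ^ ?a" if "t \<in> ball 0 \<delta>" "t \<noteq> 0" for t
      unfolding o_def f_inf[OF deck_one(1) deck_one(2)[OF j0] that] q_def using that(2) by (simp add: field_simps)
    have \<delta>0': "(0::complex) \<in> ball 0 \<delta>" using \<delta> by simp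
    have z: "zorder (f \<circ> at_infinity_pt deck_one) 0 = - int ?a"
    proof (rule zorder_eqI[OF open_ball \<delta>0' qhol q0])
      fix w :: complex assume w: "w \<in> ball 0 \<delta>" "w \<noteq> 0"
      have "(w - 0) powi (- int ?a) = inverse (w ^ ?a)"
        by (simp only: diff_zero power_int_minus power_int_of_nat)
      then show "(f \<circ> at_infinity_pt deck_one) w = q w * (w - 0) powi (- int ?a)"
        unfolding feq[OF w] by (simp only: divide_inverse)
    qed
    have "isCont q 0" using qhol \<delta>0' holomorphic_on_imp_continuous_on continuous_on_eq_continuous_at open_ball by blast
    moreover have "filterlim (\<lambda>t::complex. t ^ ?a) (at 0) (at 0)"
    proof -
      have "((\<lambda>t::complex. t ^ ?a) \<longlongrightarrow> 0 ^ ?a) (at 0)" by (intro tendsto_intros)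
      then have "((\<lambda>t::complex. t ^ ?a) \<longlongrightarrow> 0) (at 0)" using r by (simp add: power_0_left)
      moreover have "eventually (\<lambda>t::complex. t ^ ?a \<in> UNIV \<and> t ^ ?a \<noteq> 0) (at 0)"
        unfolding eventually_at_filter by (rule always_eventually) simp
      ultimately show ?thesis unfolding filterlim_at by blast
    qed
    ultimately have "is_pole (\<lambda>t. q t / t ^ ?a) 0" using q0 by (rule is_pole_divide)
    moreover have "eventually (\<lambda>t. q t / t ^ ?a = (f \<circ> at_infinity_pt deck_one) t) (at 0)"
      unfolding eventually_at_filter using eventually_nhds_in_open[OF open_ball \<delta>0']
      by eventually_elim (simp add: feq[symmetric])
    ultimately have p: "is_pole (f \<circ> at_infinity_pt deck_one) 0" using is_pole_transform by blast
    show ?thesis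
      unfolding has_pole_of_order_def
      using at_infinity_local_params[OF deck_one(1)] rad_pos centre_eq p z
      by (intro bexI[of _ "(ball 0 rad, at_infinity_pt deck_one)"]) (auto intro!: bexI[of _ 0])
  qed
  from off pole show ?thesis by blast
qed

text \<open>Every \<open>a > 0\<close> is \<open>r + k m\<close> for a unique \<open>r\<close> between \<open>1\<close> and \<open>k\<close>, so the two preceding lemmas decide
all cases.\<close>

theorem weierstrass_gaps_centre: "weierstrass_gaps (local_params n X) centre = gap_set k I c"
proof
  show "gap_set k I c \<subseteq> weierstrass_gaps (local_params n X) centre"
  proof
    fix a assume "a \<in> gap_set k I c"
    then obtain r m where r: "r \<in> {1..k}" "m \<in> vanishing_orders (diff_index k I r) (diff_fps k I c)" "a = r + k * m"
      unfolding gap_set_def by blast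
    have "a > 0" using r(1,3) by simp
    moreover have "\<not> (\<exists>f. holomorphic_off (local_params n X) centre f \<and> has_pole_of_order (local_params n X) f centre a)"
      unfolding r(3) using vanishing_order_is_gap[OF r(1,2)] by blast
    ultimately show "a \<in> weierstrass_gaps (local_params n X) centre" unfolding weierstrass_gaps_def by blast
  qed
  show "weierstrass_gaps (local_params n X) centre \<subseteq> gap_set k I c"
  proof
    fix a assume a: "a \<in> weierstrass_gaps (local_params n X) centre"
    then have a0: "a > 0" by (simp add: weierstrass_gaps_def)
    define r where "r = (a - 1) mod k + 1"
    define m where "m = (a - 1) div k"
    have r: "r \<in> {1..k}" using k0 by (simp add: r_def Suc_leI)
    have am: "a = r + k * m" using a0 unfolding r_def m_def by simp
    have "m \<in> vanishing_orders (diff_index k I r) (diff_fps k I c)"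
      using nongap_exists[OF r, of m] a unfolding weierstrass_gaps_def am[symmetric] by blast
    then show "a \<in> gap_set k I c" using r am unfolding gap_set_def by blast
  qed
qed

end

section \<open>Configurations of branch points and their moduli\<close>

text \<open>Branch points are represented by vectors in \<open>\<complex>\<^sup>2\<close>, which removes the special role of \<open>\<infinity>\<close>; two of them
are distinct iff their bracket is not \<open>0\<close>, and Moebius maps scale all brackets.\<close>

definition bracket :: "complex \<times> complex \<Rightarrow> complex \<times> complex \<Rightarrow> complex" where
  "bracket u v = fst u * snd v - fst v * snd u"

definition branch_vec :: "(nat \<Rightarrow> complex) \<Rightarrow> nat \<Rightarrow> complex \<times> complex" where
  "branch_vec l i = (if i = 0 then (1, 0) else if i = 1 then (0, 1) else if i = 2 then (1, 1) else (l (i - 2), 1))"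

definition in_general_position :: "nat \<Rightarrow> (nat \<Rightarrow> complex \<times> complex) \<Rightarrow> bool" where
  "in_general_position n v \<longleftrightarrow> (\<forall>i\<le>n. \<forall>i'\<le>n. i \<noteq> i' \<longrightarrow> bracket (v i) (v i') \<noteq> 0)"

text \<open>The cross ratios: the parameters after moving the first three points to \<open>\<infinity>, 0, 1\<close>.\<close>

definition norm_param :: "nat \<Rightarrow> (nat \<Rightarrow> complex \<times> complex) \<Rightarrow> nat \<Rightarrow> complex" where
  "norm_param n v = (\<lambda>i\<in>{1..n - 2}.
     bracket (v (i + 2)) (v 1) * bracket (v 2) (v 0) / (bracket (v (i + 2)) (v 0) * bracket (v 2) (v 1)))"

text \<open>The coordinate on the sphere that is \<open>\<infinity>\<close> at the \<open>j\<close>-th and \<open>0\<close> at the \<open>j0\<close>-th point. It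
depends on the representing vectors only through a common factor.\<close>

definition ratio_coord :: "(nat \<Rightarrow> complex \<times> complex) \<Rightarrow> nat \<Rightarrow> nat \<Rightarrow> nat \<Rightarrow> complex" where
  "ratio_coord v j j0 i = bracket (v i) (v j0) / bracket (v i) (v j)"

lemma bracket_self [simp]: "bracket u u = 0" by (simp add: bracket_def)

lemma bracket_anti: "bracket u v = - bracket v u" by (simp add: bracket_def)

lemma bracket_pluecker: "bracket a b * bracket c d - bracket a c * bracket b d + bracket a d * bracket b c = 0"
  by (simp add: bracket_def algebra_simps)

lemma in_general_positionD: "in_general_position n v \<Longrightarrow> i \<le> n \<Longrightarrow> i' \<le> n \<Longrightarrow> i \<noteq> i' \<Longrightarrow> bracket (v i) (v i') \<noteq> 0"
  unfolding in_general_position_def by blast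

lemma branch_vec_general:
  assumes l: "l \<in> param_space n"
  shows "in_general_position n (branch_vec l)"
proof -
  have l01: "l i \<noteq> 0" "l i \<noteq> 1" if "i \<in> {1..n - 2}" for i
    using l that by (auto simp: param_space_def PiE_def Pi_def)
  have inj: "l i \<noteq> l i'" if "i \<in> {1..n - 2}" "i' \<in> {1..n - 2}" "i \<noteq> i'" for i i'
    using l that unfolding param_space_def by (auto dest: inj_onD)
  have main: "bracket (branch_vec l i) (branch_vec l i') \<noteq> 0" if less: "i < i'" and le: "i' \<le> n" for i i'
  proof -
    consider (1) "i = 0" "i' = 1" | (2) "i = 0" "i' = 2" | (3) "i = 0" "i' \<ge> 3" | (4) "i = 1" "i' = 2" | (5) "i = 1" "i' \<ge> 3" | (6) "i = 2" "i' \<ge> 3" | (7) "i \<ge> 3"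
    proof -
      have "i = 0 \<and> i' = 1 \<or> i = 0 \<and> i' = 2 \<or> i = 0 \<and> i' \<ge> 3 \<or> i = 1 \<and> i' = 2 \<or> i = 1 \<and> i' \<ge> 3 \<or> i = 2 \<and> i' \<ge> 3 \<or> i \<ge> 3"
        using less by presburger
      then show thesis using that by blast
    qed
    then show ?thesis
    proof cases
      case 7
      then have "i - 2 \<in> {1..n - 2}" "i' - 2 \<in> {1..n - 2}" "i - 2 \<noteq> i' - 2" using less le by auto
      then show ?thesis using inj 7 less le by (simp add: bracket_def branch_vec_def)
    next
      case 5
      then have "i' - 2 \<in> {1..n - 2}" using less le by auto
      then show ?thesis using l01 5 by (simp add: bracket_def branch_vec_def)
    next
      case 6
      then have "i' - 2 \<in> {1..n - 2}" using less le by auto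
      then show ?thesis using l01(2)[of "i' - 2"] 6 by (simp add: bracket_def branch_vec_def)
    qed (simp_all add: bracket_def branch_vec_def)
  qed
  have "bracket (branch_vec l i) (branch_vec l i') \<noteq> 0" if "i \<le> n" "i' \<le> n" "i \<noteq> i'" for i i'
  proof (cases "i < i'")
    case False
    then have "bracket (branch_vec l i') (branch_vec l i) \<noteq> 0" using main[of i' i] that by simp
    then show ?thesis using bracket_anti[of "branch_vec l i"] by simp
  qed (use main that in auto)
  then show ?thesis unfolding in_general_position_def by blast
qed

lemma norm_param_branch_vec:
  assumes "l \<in> param_space n"
  shows "norm_param n (branch_vec l) = l"
proof
  fix i show "norm_param n (branch_vec l) i = l i"
  proof (cases "i \<in> {1..n - 2}")
    case True
    then show ?thesis by (simp add: norm_param_def bracket_def branch_vec_def)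
  next
    case False
    then show ?thesis using assms by (auto simp: norm_param_def param_space_def PiE_def extensional_def)
  qed
qed

text \<open>Normalization applies a linear map to all vectors and rescales them individually.\<close>

lemma branch_vec_norm_param:
  assumes v: "in_general_position n v" and n: "n \<ge> 2"
  obtains \<mu> \<kappa> where "\<kappa> \<noteq> 0" "\<And>i. i \<le> n \<Longrightarrow> \<mu> i \<noteq> 0"
    "\<And>i i'. i \<le> n \<Longrightarrow> i' \<le> n \<Longrightarrow>
       bracket (branch_vec (norm_param n v) i) (branch_vec (norm_param n v) i') = \<kappa> * \<mu> i * \<mu> i' * bracket (v i) (v i')"
proof -
  define \<alpha> where "\<alpha> = bracket (v 2) (v 0)"
  define \<beta> where "\<beta> = bracket (v 2) (v 1)"
  define A where "A u = (bracket u (v 1) * \<alpha>, bracket u (v 0) * \<beta>)" for u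
  define \<kappa> where "\<kappa> = \<alpha> * \<beta> * bracket (v 1) (v 0)"
  define \<mu> where "\<mu> i = (if i = 0 then inverse (bracket (v 0) (v 1) * \<alpha>) else inverse (bracket (v i) (v 0) * \<beta>))" for i :: nat
  have nz: "\<alpha> \<noteq> 0" "\<beta> \<noteq> 0" "bracket (v 1) (v 0) \<noteq> 0" "bracket (v 0) (v 1) \<noteq> 0"
    using in_general_positionD[OF v, of 2 0] in_general_positionD[OF v, of 2 1]
      in_general_positionD[OF v, of 1 0] in_general_positionD[OF v, of 0 1] n by (simp_all add: \<alpha>_def \<beta>_def)
  have A: "bracket (A u) (A w) = \<kappa> * bracket u w" for u w
  proof -
    have "bracket u (v 1) * bracket w (v 0) - bracket w (v 1) * bracket u (v 0) = bracket u w * bracket (v 1) (v 0)"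
      by (simp add: bracket_def algebra_simps)
    moreover have "bracket (A u) (A w) = \<alpha> * \<beta> * (bracket u (v 1) * bracket w (v 0) - bracket w (v 1) * bracket u (v 0))"
      by (simp add: A_def bracket_def[of "(_, _)"] algebra_simps)
    ultimately have "bracket (A u) (A w) = \<alpha> * \<beta> * (bracket u w * bracket (v 1) (v 0))" by simp
    then show ?thesis unfolding \<kappa>_def by (simp add: mult_ac)
  qed
  have vec: "branch_vec (norm_param n v) i = (\<mu> i * fst (A (v i)), \<mu> i * snd (A (v i)))" if i: "i \<le> n" for i
  proof -
    have vi: "bracket (v i) (v 0) \<noteq> 0" if "i \<noteq> 0" using in_general_positionD[OF v i _ that] by simp
    consider "i = 0" | "i = 1" | "i = 2" | "i \<ge> 3" by linarith
    then show ?thesis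
    proof cases
      case 4
      then have i2: "i - 2 \<in> {1..n - 2}" "Suc (Suc (i - 2)) = i" using i by auto
      then have e: "norm_param n v (i - 2) = bracket (v i) (v 1) * \<alpha> / (bracket (v i) (v 0) * \<beta>)"
        by (simp add: norm_param_def \<alpha>_def \<beta>_def)
      show ?thesis
        using 4 vi nz unfolding branch_vec_def e A_def \<mu>_def by (simp add: field_simps)
    next
      case 3
      have ab: "bracket (v 2) (v (Suc 0)) = \<beta>" "bracket (v 2) (v 0) = \<alpha>" by (simp_all add: \<alpha>_def \<beta>_def)
      show ?thesis using 3 nz by (simp add: branch_vec_def A_def \<mu>_def ab field_simps)
    qed (use vi nz in \<open>simp_all add: branch_vec_def A_def \<mu>_def field_simps\<close>)
  qed
  show ?thesis
  proof (rule that[of \<kappa> \<mu>])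
    show "\<kappa> \<noteq> 0" using nz by (simp add: \<kappa>_def)
    show "\<mu> i \<noteq> 0" if "i \<le> n" for i
      using nz in_general_positionD[OF v that, of 0] by (auto simp: \<mu>_def)
    fix i i' assume i: "i \<le> n" "i' \<le> n"
    have "bracket (branch_vec (norm_param n v) i) (branch_vec (norm_param n v) i') = \<mu> i * \<mu> i' * bracket (A (v i)) (A (v i'))"
      unfolding vec[OF i(1)] vec[OF i(2)] by (simp add: bracket_def algebra_simps)
    then show "bracket (branch_vec (norm_param n v) i) (branch_vec (norm_param n v) i') = \<kappa> * \<mu> i * \<mu> i' * bracket (v i) (v i')"
      unfolding A by (simp add: mult_ac)
  qed
qed

lemma norm_param_in_param_space:
  assumes v: "in_general_position n v" and n: "n \<ge> 2"
  shows "norm_param n v \<in> param_space n"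
proof -
  obtain \<mu> \<kappa> where \<mu>: "\<kappa> \<noteq> 0" "\<And>i. i \<le> n \<Longrightarrow> \<mu> i \<noteq> 0"
    "\<And>i i'. i \<le> n \<Longrightarrow> i' \<le> n \<Longrightarrow>
       bracket (branch_vec (norm_param n v) i) (branch_vec (norm_param n v) i') = \<kappa> * \<mu> i * \<mu> i' * bracket (v i) (v i')"
    using branch_vec_norm_param[OF v n] by metis
  let ?l = "norm_param n v"
  have gen: "bracket (branch_vec ?l i) (branch_vec ?l i') \<noteq> 0" if "i \<le> n" "i' \<le> n" "i \<noteq> i'" for i i'
    unfolding \<mu>(3)[OF that(1,2)] using \<mu>(1,2) that in_general_positionD[OF v that] by simp
  have vec: "branch_vec ?l (i + 2) = (?l i, 1)" if "i \<in> {1..n - 2}" for i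
    using that by (simp add: branch_vec_def)
  have "?l i \<noteq> 0 \<and> ?l i \<noteq> 1" if i: "i \<in> {1..n - 2}" for i
  proof -
    have "i + 2 \<le> n" "i + 2 \<noteq> 1" "i + 2 \<noteq> 2" using i by auto
    then have "bracket (branch_vec ?l (i + 2)) (branch_vec ?l 1) \<noteq> 0" "bracket (branch_vec ?l (i + 2)) (branch_vec ?l 2) \<noteq> 0"
      using gen n by auto
    then show ?thesis unfolding vec[OF i] by (simp add: bracket_def branch_vec_def)
  qed
  moreover have "inj_on ?l {1..n - 2}"
  proof (rule inj_onI, rule ccontr)
    fix i i' assume i: "i \<in> {1..n - 2}" "i' \<in> {1..n - 2}" "?l i = ?l i'" "i \<noteq> i'"
    then have "bracket (branch_vec ?l (i + 2)) (branch_vec ?l (i' + 2)) \<noteq> 0" by (intro gen) auto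
    then show False unfolding vec[OF i(1)] vec[OF i(2)] using i(3) by simp
  qed
  moreover have "?l i = undefined" if "i \<notin> {1..n - 2}" for i
    using that by (simp only: norm_param_def restrict_apply if_False)
  ultimately show ?thesis
    unfolding param_space_def by (intro CollectI conjI PiE_I) auto
qed

lemma ratio_coord_norm_param:
  assumes v: "in_general_position n v" and n: "n \<ge> 2"
  obtains \<mu> where "\<And>i. i \<le> n \<Longrightarrow> \<mu> i \<noteq> 0"
    "\<And>\<tau> j j0 i. \<tau> permutes {..n} \<Longrightarrow> j \<le> n \<Longrightarrow> j0 \<le> n \<Longrightarrow> i \<le> n \<Longrightarrow>
       ratio_coord (branch_vec (norm_param n v) \<circ> \<tau>) j j0 i = \<mu> (\<tau> j0) / \<mu> (\<tau> j) * ratio_coord (v \<circ> \<tau>) j j0 i"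
proof -
  obtain \<mu> \<kappa> where \<mu>: "\<kappa> \<noteq> 0" "\<And>i. i \<le> n \<Longrightarrow> \<mu> i \<noteq> 0"
    "\<And>i i'. i \<le> n \<Longrightarrow> i' \<le> n \<Longrightarrow>
       bracket (branch_vec (norm_param n v) i) (branch_vec (norm_param n v) i') = \<kappa> * \<mu> i * \<mu> i' * bracket (v i) (v i')"
    using branch_vec_norm_param[OF v n] by metis
  show ?thesis
  proof (rule that[of \<mu>])
    fix \<tau> j j0 i assume \<tau>: "\<tau> permutes {..n}" and le: "j \<le> n" "j0 \<le> n" "i \<le> n"
    have le': "\<tau> j \<le> n" "\<tau> j0 \<le> n" "\<tau> i \<le> n" using permutes_in_image[OF \<tau>] le by auto
    show "ratio_coord (branch_vec (norm_param n v) \<circ> \<tau>) j j0 i = \<mu> (\<tau> j0) / \<mu> (\<tau> j) * ratio_coord (v \<circ> \<tau>) j j0 i"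
      unfolding ratio_coord_def o_def \<mu>(3)[OF le'(3,2)] \<mu>(3)[OF le'(3,1)]
      using \<mu>(1) \<mu>(2)[OF le'(1)] \<mu>(2)[OF le'(2)] \<mu>(2)[OF le'(3)] by simp
  qed (rule \<mu>(2))
qed

lemma diff_fps_cong: "(\<And>i. i \<in> I \<Longrightarrow> c i = c' i) \<Longrightarrow> diff_fps k I c = diff_fps k I c'"
proof -
  assume "\<And>i. i \<in> I \<Longrightarrow> c i = c' i"
  then have "radical_fps k I c e = radical_fps k I c' e" for e
    unfolding radical_fps_def by (intro prod.cong refl) simp
  then show ?thesis by (simp add: diff_fps_def)
qed

text \<open>The condition for equality in the class \<open>r\<close>, for the branch points in the order given by \<open>\<tau>\<close>. Admitting
every order \<open>\<tau>\<close> makes the resulting locus invariant under the symmetric group by definition.\<close>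

definition ordinary_at :: "nat \<Rightarrow> nat \<Rightarrow> (nat \<Rightarrow> complex \<times> complex) \<Rightarrow> (nat \<Rightarrow> nat) \<times> nat \<times> nat \<times> nat \<Rightarrow> bool" where
  "ordinary_at k n v = (\<lambda>(\<tau>, j, j0, r). j \<noteq> j0 \<longrightarrow>
     uninflected (diff_index k ({..n} - {j}) r) (diff_fps k ({..n} - {j}) (ratio_coord (v \<circ> \<tau>) j j0)))"

definition conditions :: "nat \<Rightarrow> nat \<Rightarrow> ((nat \<Rightarrow> nat) \<times> nat \<times> nat \<times> nat) set" where
  "conditions k n = {\<tau>. \<tau> permutes {..n}} \<times> {..n} \<times> {..n} \<times> {1..k}"

definition ordinary_locus :: "nat \<Rightarrow> nat \<Rightarrow> (nat \<Rightarrow> complex) set" where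
  "ordinary_locus k n = {l \<in> param_space n. \<forall>q\<in>conditions k n. ordinary_at k n (branch_vec l) q}"

lemma finite_conditions: "finite (conditions k n)"
  unfolding conditions_def by (intro finite_cartesian_product finite_permutations) auto

lemma ordinary_at_norm_param:
  assumes v: "in_general_position n v" and n: "n \<ge> 2" and q: "q \<in> conditions k n" and ord: "ordinary_at k n v q"
  shows "ordinary_at k n (branch_vec (norm_param n v)) q"
proof -
  obtain \<tau> j j0 r where q': "q = (\<tau>, j, j0, r)" "\<tau> permutes {..n}" "j \<le> n" "j0 \<le> n"
    using q by (auto simp: conditions_def)
  obtain \<mu> where \<mu>: "\<And>i. i \<le> n \<Longrightarrow> \<mu> i \<noteq> 0"
    "\<And>\<tau> j j0 i. \<tau> permutes {..n} \<Longrightarrow> j \<le> n \<Longrightarrow> j0 \<le> n \<Longrightarrow> i \<le> n \<Longrightarrow>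
       ratio_coord (branch_vec (norm_param n v) \<circ> \<tau>) j j0 i = \<mu> (\<tau> j0) / \<mu> (\<tau> j) * ratio_coord (v \<circ> \<tau>) j j0 i"
    using ratio_coord_norm_param[OF v n] by metis
  have le: "\<tau> j \<le> n" "\<tau> j0 \<le> n" using permutes_in_image[OF q'(2)] q' by auto
  have eq: "diff_fps k ({..n} - {j}) (ratio_coord (branch_vec (norm_param n v) \<circ> \<tau>) j j0) =
      diff_fps k ({..n} - {j}) (\<lambda>i. \<mu> (\<tau> j0) / \<mu> (\<tau> j) * ratio_coord (v \<circ> \<tau>) j j0 i)"
    by (rule diff_fps_cong) (use \<mu>(2)[OF q'(2-4)] in simp)
  have "\<mu> (\<tau> j0) / \<mu> (\<tau> j) \<noteq> 0" using \<mu>(1) le by simp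
  then show ?thesis using ord unfolding ordinary_at_def q'(1) case_prod_conv eq
    using uninflected_diff_fps_scale by blast
qed

lemma topspace_param_topology: "topspace (param_topology n) = param_space n"
  by (auto simp: param_topology_def param_space_def PiE_def)

lemma tendsto_param_coordinate:
  assumes "l \<in> param_space n" "i \<in> {1..n - 2}"
  shows "((\<lambda>x. x i) \<longlongrightarrow> l i) (atin (param_topology n) l)"
proof -
  have "continuous_map (param_topology n) euclidean (\<lambda>x. x i)"
    unfolding param_topology_def
    by (intro continuous_map_from_subtopology continuous_map_product_projection assms)
  then show ?thesis
    using assms(1) by (simp add: continuous_map_atin topspace_param_topology)
qed

lemma open_ordinary_at:
  assumes n: "n \<ge> 2" and q: "q \<in> conditions k n"
  shows "openin (param_topology n) {l \<in> param_space n. ordinary_at k n (branch_vec l) q}"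
proof (subst openin_subopen, intro ballI)
  fix l assume "l \<in> {l \<in> param_space n. ordinary_at k n (branch_vec l) q}"
  then have l: "l \<in> param_space n" "ordinary_at k n (branch_vec l) q" by auto
  obtain \<tau> j j0 r where q': "q = (\<tau>, j, j0, r)" "\<tau> permutes {..n}" "j \<le> n" "j0 \<le> n"
    using q by (auto simp: conditions_def)
  have ev: "eventually (\<lambda>x. ordinary_at k n (branch_vec x) q) (atin (param_topology n) l)"
  proof (cases "j = j0")
    case False
    have comp: "((\<lambda>x. fst (branch_vec x i)) \<longlongrightarrow> fst (branch_vec l i)) (atin (param_topology n) l)"
      "((\<lambda>x. snd (branch_vec x i)) \<longlongrightarrow> snd (branch_vec l i)) (atin (param_topology n) l)" if "i \<le> n" for i
    proof -
      have "((\<lambda>x. x (i - 2)) \<longlongrightarrow> l (i - 2)) (atin (param_topology n) l)" if "i \<ge> 3"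
        using that \<open>i \<le> n\<close> by (intro tendsto_param_coordinate l(1)) auto
      then show "((\<lambda>x. fst (branch_vec x i)) \<longlongrightarrow> fst (branch_vec l i)) (atin (param_topology n) l)"
        by (cases "i \<ge> 3") (auto simp: branch_vec_def)
      show "((\<lambda>x. snd (branch_vec x i)) \<longlongrightarrow> snd (branch_vec l i)) (atin (param_topology n) l)"
        by (auto simp: branch_vec_def)
    qed
    have lim: "((\<lambda>x. ratio_coord (branch_vec x \<circ> \<tau>) j j0 i) \<longlongrightarrow> ratio_coord (branch_vec l \<circ> \<tau>) j j0 i) (atin (param_topology n) l)"
      if i: "i \<in> {..n} - {j}" for i
    proof -
      have le: "\<tau> i \<le> n" "\<tau> j \<le> n" "\<tau> j0 \<le> n" using permutes_in_image[OF q'(2)] q' i by auto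
      have "\<tau> i \<noteq> \<tau> j" using permutes_inj[OF q'(2)] i by (auto dest: injD)
      then have "bracket (branch_vec l (\<tau> i)) (branch_vec l (\<tau> j)) \<noteq> 0"
        using in_general_positionD[OF branch_vec_general[OF l(1)]] le by blast
      then show ?thesis unfolding ratio_coord_def o_def
        unfolding bracket_def by (intro tendsto_intros comp le)
    qed
    have "eventually (\<lambda>x. uninflected (diff_index k ({..n} - {j}) r) (diff_fps k ({..n} - {j}) (ratio_coord (branch_vec x \<circ> \<tau>) j j0))) (atin (param_topology n) l)"
    proof (rule eventually_uninflected)
      show "uninflected (diff_index k ({..n} - {j}) r) (diff_fps k ({..n} - {j}) (ratio_coord (branch_vec l \<circ> \<tau>) j j0))"
        using l(2) False by (simp add: ordinary_at_def q'(1))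
    qed (intro finite_diff_index tendsto_diff_fps_nth lim; simp)+
    then show ?thesis by (simp add: ordinary_at_def q'(1))
  qed (simp add: ordinary_at_def q'(1))
  then obtain U where U: "openin (param_topology n) U" "l \<in> U" "\<forall>x\<in>U - {l}. ordinary_at k n (branch_vec x) q"
    using l(1) unfolding eventually_atin topspace_param_topology by blast
  have "U \<subseteq> param_space n" using openin_subset[OF U(1)] by (simp add: topspace_param_topology)
  then have "U \<subseteq> {l \<in> param_space n. ordinary_at k n (branch_vec l) q}" using U(3) l by blast
  then show "\<exists>T. openin (param_topology n) T \<and> l \<in> T \<and> T \<subseteq> {l \<in> param_space n. ordinary_at k n (branch_vec l) q}"
    using U(1,2) by blast
qed

text \<open>Adding a small multiple of the vector \<open>v (\<tau> j0)\<close> to \<open>v (\<tau> j)\<close> replaces the coordinates \<open>c\<close> by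
\<open>c / (1 - c s)\<close>, which is the deformation that removes inflections. Normalizing the new configuration
gives a parameter close to the given one.\<close>

lemma dense_ordinary_at:
  assumes n: "n \<ge> 2" and k: "k > 0" and q: "q \<in> conditions k n"
    and V: "openin (param_topology n) V" "V \<noteq> {}"
  shows "\<exists>l\<in>V. ordinary_at k n (branch_vec l) q"
proof -
  obtain \<tau> j j0 r where q': "q = (\<tau>, j, j0, r)" "\<tau> permutes {..n}" "j \<le> n" "j0 \<le> n"
    using q by (auto simp: conditions_def)
  obtain l where l: "l \<in> V" using V(2) by blast
  have lp: "l \<in> param_space n" using openin_subset[OF V(1)] l by (auto simp: topspace_param_topology)
  show ?thesis
  proof (cases "j = j0")
    case True
    then show ?thesis using l by (auto simp: ordinary_at_def q'(1))
  next
    case False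
    let ?I = "{..n} - {j}"
    define v where "v = branch_vec l"
    have v: "in_general_position n v" unfolding v_def by (rule branch_vec_general[OF lp])
    have \<tau>le: "\<tau> i \<le> n" if "i \<le> n" for i using permutes_in_image[OF q'(2)] that by simp
    have \<tau>inj: "\<tau> i = \<tau> i' \<longleftrightarrow> i = i'" for i i' using permutes_inj[OF q'(2)] by (auto dest: injD)
    define c where "c = ratio_coord (v \<circ> \<tau>) j j0"
    \<comment> \<open>The sign is chosen to match \<open>exists_deformation_uninflected\<close>.\<close>
    define w where "w s = v(\<tau> j := (fst (v (\<tau> j)) - s * fst (v (\<tau> j0)), snd (v (\<tau> j)) - s * snd (v (\<tau> j0))))" for s
    have w_other: "w s (\<tau> i) = v (\<tau> i)" if "i \<noteq> j" for s i using that \<tau>inj by (simp add: w_def)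
    have dt_w: "bracket (w s (\<tau> i)) (w s (\<tau> j)) = bracket (v (\<tau> i)) (v (\<tau> j)) * (1 - c i * s)" if i: "i \<in> ?I" for i s
    proof -
      have "bracket (v (\<tau> i)) (v (\<tau> j)) \<noteq> 0" using in_general_positionD[OF v \<tau>le \<tau>le] i q'(3) \<tau>inj by auto
      then have "bracket (v (\<tau> i)) (v (\<tau> j)) * (1 - c i * s) = bracket (v (\<tau> i)) (v (\<tau> j)) - s * bracket (v (\<tau> i)) (v (\<tau> j0))"
        by (simp add: c_def ratio_coord_def algebra_simps)
      also have "\<dots> = bracket (v (\<tau> i)) (w s (\<tau> j))" by (simp add: w_def bracket_def algebra_simps)
      finally show ?thesis using w_other i by simp
    qed
    have cinj: "inj_on c ?I"
    proof (rule inj_onI, rule ccontr)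
      fix i i' assume i: "i \<in> ?I" "i' \<in> ?I" "c i = c i'" "i \<noteq> i'"
      have nz: "bracket (v (\<tau> i)) (v (\<tau> j)) \<noteq> 0" "bracket (v (\<tau> i')) (v (\<tau> j)) \<noteq> 0" "bracket (v (\<tau> i)) (v (\<tau> i')) \<noteq> 0" "bracket (v (\<tau> j0)) (v (\<tau> j)) \<noteq> 0"
        using in_general_positionD[OF v \<tau>le \<tau>le] i q' \<tau>inj False by auto
      have "bracket (v (\<tau> i)) (v (\<tau> j0)) * bracket (v (\<tau> i')) (v (\<tau> j)) = bracket (v (\<tau> i')) (v (\<tau> j0)) * bracket (v (\<tau> i)) (v (\<tau> j))"
        using i(3) nz by (simp add: c_def ratio_coord_def field_simps)
      then have "bracket (v (\<tau> i)) (v (\<tau> i')) * bracket (v (\<tau> j0)) (v (\<tau> j)) = 0"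
        using bracket_pluecker[of "v (\<tau> i)" "v (\<tau> i')" "v (\<tau> j0)" "v (\<tau> j)"] by (simp add: algebra_simps)
      then show False using nz by simp
    qed
    have lim: "((\<lambda>s. norm_param n (w s) i) \<longlongrightarrow> l i) (nhds 0)" if i: "i \<in> {1..n - 2}" for i
    proof -
      have comp: "((\<lambda>s. fst (w s x)) \<longlongrightarrow> fst (v x)) (nhds 0)" "((\<lambda>s. snd (w s x)) \<longlongrightarrow> snd (v x)) (nhds 0)" for x
      proof -
        have "((\<lambda>s. fst (v (\<tau> j)) - s * fst (v (\<tau> j0))) \<longlongrightarrow> fst (v (\<tau> j)) - 0 * fst (v (\<tau> j0))) (nhds 0)"
          "((\<lambda>s. snd (v (\<tau> j)) - s * snd (v (\<tau> j0))) \<longlongrightarrow> snd (v (\<tau> j)) - 0 * snd (v (\<tau> j0))) (nhds 0)"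
          by (intro tendsto_intros filterlim_ident)+
        then show "((\<lambda>s. fst (w s x)) \<longlongrightarrow> fst (v x)) (nhds 0)" "((\<lambda>s. snd (w s x)) \<longlongrightarrow> snd (v x)) (nhds 0)"
          by (cases "x = \<tau> j"; simp add: w_def)+
      qed
      have le: "i + 2 \<le> n" using i by auto
      have "bracket (v (i + 2)) (v 0) * bracket (v 2) (v 1) \<noteq> 0"
        using in_general_positionD[OF v, of "i + 2" 0] in_general_positionD[OF v, of 2 1] le n by simp
      then have "((\<lambda>s. norm_param n (w s) i) \<longlongrightarrow> norm_param n v i) (nhds 0)"
        using i unfolding norm_param_def by (simp only: restrict_apply if_True)
          (unfold bracket_def, intro tendsto_intros comp)
      then show ?thesis unfolding v_def norm_param_branch_vec[OF lp] .
    qed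
    obtain W where W: "openin (product_topology (\<lambda>_. euclidean) {1..n - 2}) W" "V = W \<inter> param_space n"
      using V(1) unfolding param_topology_def openin_subtopology by blast
    have "\<exists>U. (\<forall>i\<in>{1..n - 2}. open (U i)) \<and> l \<in> PiE {1..n - 2} U \<and> PiE {1..n - 2} U \<subseteq> W"
      using W l by (simp add: openin_product_topology_alt)
    then obtain O' where O': "\<And>i. i \<in> {1..n - 2} \<Longrightarrow> open (O' i)" "l \<in> PiE {1..n - 2} O'" "PiE {1..n - 2} O' \<subseteq> W"
      by blast
    have "eventually (\<lambda>s. \<forall>i\<in>{1..n - 2}. norm_param n (w s) i \<in> O' i) (nhds 0)"
    proof (intro eventually_ball_finite ballI)
      fix i assume i: "i \<in> {1..n - 2}"
      show "eventually (\<lambda>s. norm_param n (w s) i \<in> O' i) (nhds 0)"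
        using topological_tendstoD[OF lim[OF i] O'(1)[OF i]] O'(2) i by blast
    qed simp
    then obtain \<epsilon> where \<epsilon>: "\<epsilon> > 0" "\<And>s i. norm s < \<epsilon> \<Longrightarrow> i \<in> {1..n - 2} \<Longrightarrow> norm_param n (w s) i \<in> O' i"
      unfolding eventually_nhds_metric by (auto simp: dist_norm)
    obtain s where s: "norm s < \<epsilon>" "\<forall>i\<in>?I. 1 - c i * s \<noteq> 0"
      "uninflected (diff_index k ?I r) (diff_fps k ?I (\<lambda>i. c i / (1 - c i * s)))"
      using exists_deformation_uninflected[OF k _ cinj \<epsilon>(1), of r] by auto
    have wgen: "in_general_position n (w s)"
      unfolding in_general_position_def
    proof (intro allI impI)
      fix a a' assume a: "a \<le> n" "a' \<le> n" "a \<noteq> a'"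
      obtain i where i: "a = \<tau> i" "i \<le> n" using a(1) permutes_image[OF q'(2)] by (metis atMost_iff imageE)
      obtain i' where i': "a' = \<tau> i'" "i' \<le> n" using a(2) permutes_image[OF q'(2)] by (metis atMost_iff imageE)
      have ii: "i \<noteq> i'" using a i i' by auto
      have A: "bracket (w s (\<tau> x)) (w s (\<tau> j)) \<noteq> 0" if "x \<in> ?I" for x
        unfolding dt_w[OF that] using s(2) that in_general_positionD[OF v \<tau>le \<tau>le] q'(3) \<tau>inj by auto
      consider "i' = j" | "i = j" | "i \<noteq> j" "i' \<noteq> j" by blast
      then show "bracket (w s a) (w s a') \<noteq> 0"
      proof cases
        case 1 then show ?thesis using A[of i] i i' ii by simp
      next
        case 2 then show ?thesis using A[of i'] bracket_anti[of "w s a" "w s a'"] i i' ii by simp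
      next
        case 3
        then show ?thesis unfolding i i' w_other[OF 3(1)] w_other[OF 3(2)]
          using in_general_positionD[OF v \<tau>le[OF i(2)] \<tau>le[OF i'(2)]] ii \<tau>inj by simp
      qed
    qed
    have "ordinary_at k n (w s) q"
    proof -
      have "diff_fps k ?I (ratio_coord (w s \<circ> \<tau>) j j0) = diff_fps k ?I (\<lambda>i. c i / (1 - c i * s))"
      proof (rule diff_fps_cong)
        fix i assume i: "i \<in> ?I"
        show "ratio_coord (w s \<circ> \<tau>) j j0 i = c i / (1 - c i * s)"
          unfolding ratio_coord_def o_def dt_w[OF i] using w_other[of i s] w_other[of j0 s] i False
          by (simp add: c_def ratio_coord_def)
      qed
      then show ?thesis using s(3) by (simp add: ordinary_at_def q'(1))
    qed
    then have "ordinary_at k n (branch_vec (norm_param n (w s))) q"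
      by (rule ordinary_at_norm_param[OF wgen n q])
    moreover have "norm_param n (w s) \<in> V"
    proof -
      have "norm_param n (w s) \<in> PiE {1..n - 2} O'" using \<epsilon>(2)[OF s(1)] by (auto simp: norm_param_def)
      then show ?thesis using O'(3) W(2) norm_param_in_param_space[OF wgen n] by blast
    qed
    ultimately show ?thesis by blast
  qed
qed

lemma finite_Inter_open_dense:
  assumes "finite Q" and "\<And>q. q \<in> Q \<Longrightarrow> openin X {x \<in> topspace X. P q x}"
    and "\<And>q V. q \<in> Q \<Longrightarrow> openin X V \<Longrightarrow> V \<noteq> {} \<Longrightarrow> \<exists>x\<in>V. P q x"
  shows "openin X {x \<in> topspace X. \<forall>q\<in>Q. P q x} \<and> (\<forall>V. openin X V \<longrightarrow> V \<noteq> {} \<longrightarrow> (\<exists>x\<in>V. \<forall>q\<in>Q. P q x))"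
  using assms
proof (induction Q rule: finite_induct)
  case (insert q Q)
  have IH: "openin X {x \<in> topspace X. \<forall>q\<in>Q. P q x}" "\<And>V. openin X V \<Longrightarrow> V \<noteq> {} \<Longrightarrow> \<exists>x\<in>V. \<forall>q\<in>Q. P q x"
    using insert by blast+
  have eq: "{x \<in> topspace X. \<forall>q\<in>insert q Q. P q x} = {x \<in> topspace X. P q x} \<inter> {x \<in> topspace X. \<forall>q\<in>Q. P q x}" by auto
  have "\<exists>x\<in>V. \<forall>q\<in>insert q Q. P q x" if V: "openin X V" "V \<noteq> {}" for V
  proof -
    have "openin X (V \<inter> {x \<in> topspace X. \<forall>q\<in>Q. P q x})" by (intro openin_Int V IH)
    moreover have "V \<inter> {x \<in> topspace X. \<forall>q\<in>Q. P q x} \<noteq> {}"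
      using IH(2)[OF V] openin_subset[OF V(1)] by blast
    ultimately obtain x where "x \<in> V \<inter> {x \<in> topspace X. \<forall>q\<in>Q. P q x}" "P q x"
      using insert.prems(2)[of q] by blast
    then show ?thesis by blast
  qed
  moreover have "openin X {x \<in> topspace X. \<forall>q\<in>insert q Q. P q x}"
    unfolding eq by (intro openin_Int IH insert.prems) simp
  ultimately show ?case by blast
qed auto

lemma ordinary_locus_open_dense:
  assumes "n \<ge> 2" "k > 0"
  shows "openin (param_topology n) (ordinary_locus k n)"
    and "\<And>V. openin (param_topology n) V \<Longrightarrow> V \<noteq> {} \<Longrightarrow> \<exists>l\<in>V. l \<in> ordinary_locus k n"
proof -
  have *: "openin (param_topology n) {l \<in> topspace (param_topology n). \<forall>q\<in>conditions k n. ordinary_at k n (branch_vec l) q} \<and>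
     (\<forall>V. openin (param_topology n) V \<longrightarrow> V \<noteq> {} \<longrightarrow> (\<exists>l\<in>V. \<forall>q\<in>conditions k n. ordinary_at k n (branch_vec l) q))"
  proof (rule finite_Inter_open_dense[OF finite_conditions, where P="\<lambda>q l. ordinary_at k n (branch_vec l) q"])
    show "openin (param_topology n) {l \<in> topspace (param_topology n). ordinary_at k n (branch_vec l) q}"
      if "q \<in> conditions k n" for q
      unfolding topspace_param_topology by (rule open_ordinary_at[OF assms(1) that])
    show "\<exists>l\<in>V. ordinary_at k n (branch_vec l) q"
      if "q \<in> conditions k n" "openin (param_topology n) V" "V \<noteq> {}" for q V
      by (rule dense_ordinary_at[OF assms that])
  qed
  then show "openin (param_topology n) (ordinary_locus k n)"
    by (simp add: ordinary_locus_def topspace_param_topology)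
  fix V assume V: "openin (param_topology n) V" "V \<noteq> {}"
  then obtain l where "l \<in> V" "\<forall>q\<in>conditions k n. ordinary_at k n (branch_vec l) q" using * by blast
  moreover have "l \<in> param_space n"
    using openin_subset[OF V(1)] \<open>l \<in> V\<close> by (auto simp: topspace_param_topology)
  ultimately show "\<exists>l\<in>V. l \<in> ordinary_locus k n" by (auto simp: ordinary_locus_def)
qed

definition sphere_pt :: "complex \<times> complex \<Rightarrow> complex option" where
  "sphere_pt u = (if snd u = 0 then None else Some (fst u / snd u))"

lemma branch_pt_eq: "branch_pt l (i + 1) = sphere_pt (branch_vec l i)"
  by (auto simp: branch_pt_def branch_vec_def sphere_pt_def)

lemma moebius_map_sphere_pt:
  assumes "u \<noteq> (0, 0)" "a * d - b * c \<noteq> 0"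
  shows "moebius_map a b c d (sphere_pt u) = sphere_pt (a * fst u + b * snd u, c * fst u + d * snd u)"
proof (cases "snd u = 0")
  case True
  then have "fst u \<noteq> 0" using assms(1) by (cases u) auto
  then show ?thesis using True by (simp add: moebius_map_def sphere_pt_def)
next
  case False
  have "c * (fst u / snd u) + d = (c * fst u + d * snd u) / snd u" "a * (fst u / snd u) + b = (a * fst u + b * snd u) / snd u"
    using False by (simp_all add: field_simps)
  then show ?thesis using False by (simp add: moebius_map_def sphere_pt_def)
qed

lemma moebius_map_scale: "\<kappa> \<noteq> 0 \<Longrightarrow> moebius_map (\<kappa> * a) (\<kappa> * b) (\<kappa> * c) (\<kappa> * d) = moebius_map a b c d"
proof
  fix z assume \<kappa>: "\<kappa> \<noteq> 0"
  have 1: "\<kappa> * c * w + \<kappa> * d = \<kappa> * (c * w + d)" "\<kappa> * a * w + \<kappa> * b = \<kappa> * (a * w + b)" for w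
    by (simp_all add: algebra_simps)
  show "moebius_map (\<kappa> * a) (\<kappa> * b) (\<kappa> * c) (\<kappa> * d) z = moebius_map a b c d z"
    unfolding moebius_map_def 1 using \<kappa> by (simp split: option.split)
qed

lemma proportional_to_kernel:
  assumes "c * fst u + d * snd u = 0" "u \<noteq> (0, 0 :: complex)"
  obtains e where "c = e * snd u" "d = - e * fst u"
proof (cases "snd u = 0")
  case True
  then have "fst u \<noteq> 0" using assms(2) by (cases u) auto
  then show ?thesis using assms True by (intro that[of "- d / fst u"]) simp_all
next
  case False
  have "d = - (c / snd u) * fst u" using assms(1) False by (simp add: field_simps eq_neg_iff_add_eq_0)
  then show ?thesis using False by (intro that[of "c / snd u"]) simp_all
qed

text \<open>A Moebius map with the prescribed values at three points is determined up to a factor of its matrix: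
the rows are multiples of the brackets with \<open>w1\<close> and \<open>w2\<close>, and the third value fixes their
ratio.\<close>

lemma normalizing_map_value:
  assumes nz: "bracket w1 w2 \<noteq> 0" "bracket w3 w1 \<noteq> 0" "bracket w3 w2 \<noteq> 0" and u: "u \<noteq> (0, 0)"
  shows "(THE T. is_moebius T \<and> T (sphere_pt w1) = None \<and> T (sphere_pt w2) = Some 0 \<and> T (sphere_pt w3) = Some 1) (sphere_pt u)
    = sphere_pt (bracket u w2 * bracket w3 w1, bracket u w1 * bracket w3 w2)"
proof -
  define \<alpha> where "\<alpha> = bracket w3 w1"
  define \<beta> where "\<beta> = bracket w3 w2"
  have w: "w1 \<noteq> (0, 0)" "w2 \<noteq> (0, 0)" "w3 \<noteq> (0, 0)" using nz by (auto simp: bracket_def)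
  define T0 where "T0 = moebius_map (\<alpha> * snd w2) (\<alpha> * - fst w2) (\<beta> * snd w1) (\<beta> * - fst w1)"
  have det: "(\<alpha> * snd w2) * (\<beta> * - fst w1) - (\<alpha> * - fst w2) * (\<beta> * snd w1) \<noteq> 0"
  proof -
    have "(\<alpha> * snd w2) * (\<beta> * - fst w1) - (\<alpha> * - fst w2) * (\<beta> * snd w1) = - \<alpha> * \<beta> * bracket w1 w2"
      by (simp add: bracket_def algebra_simps)
    then show ?thesis using nz by (simp add: \<alpha>_def \<beta>_def)
  qed
  have T0: "T0 (sphere_pt x) = sphere_pt (bracket x w2 * \<alpha>, bracket x w1 * \<beta>)" if "x \<noteq> (0, 0)" for x
    unfolding T0_def moebius_map_sphere_pt[OF that det]
    by (rule arg_cong[of _ _ sphere_pt]) (simp add: bracket_def algebra_simps)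
  have "(THE T. is_moebius T \<and> T (sphere_pt w1) = None \<and> T (sphere_pt w2) = Some 0 \<and> T (sphere_pt w3) = Some 1) = T0"
  proof (rule the_equality)
    have "T0 (sphere_pt w1) = None" unfolding T0[OF w(1)] by (simp add: sphere_pt_def)
    moreover have "T0 (sphere_pt w2) = Some 0" unfolding T0[OF w(2)] using nz bracket_anti[of w2 w1] by (simp add: sphere_pt_def \<beta>_def)
    moreover have "T0 (sphere_pt w3) = Some 1" unfolding T0[OF w(3)] using nz by (simp add: sphere_pt_def \<alpha>_def \<beta>_def)
    moreover have "is_moebius T0" unfolding is_moebius_def T0_def using det by blast
    ultimately show "is_moebius T0 \<and> T0 (sphere_pt w1) = None \<and> T0 (sphere_pt w2) = Some 0 \<and> T0 (sphere_pt w3) = Some 1" by blast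
    fix T assume T: "is_moebius T \<and> T (sphere_pt w1) = None \<and> T (sphere_pt w2) = Some 0 \<and> T (sphere_pt w3) = Some 1"
    then obtain a b c d where abcd: "a * d - b * c \<noteq> 0" "T = moebius_map a b c d" unfolding is_moebius_def by blast
    note val = moebius_map_sphere_pt[OF _ abcd(1), folded abcd(2)]
    have "c * fst w1 + d * snd w1 = 0"
      using T unfolding val[OF w(1)] by (auto simp: sphere_pt_def split: if_splits)
    then obtain e where e: "c = e * snd w1" "d = - e * fst w1" using proportional_to_kernel[OF _ w(1)] by metis
    have "a * fst w2 + b * snd w2 = 0"
      using T unfolding val[OF w(2)] by (auto simp: sphere_pt_def split: if_splits)
    then obtain h where h: "a = h * snd w2" "b = - h * fst w2" using proportional_to_kernel[OF _ w(2)] by metis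
    have "a * fst w3 + b * snd w3 = c * fst w3 + d * snd w3"
      using T unfolding val[OF w(3)] by (auto simp: sphere_pt_def split: if_splits)
    then have eh: "h * \<beta> = e * \<alpha>" unfolding e h \<alpha>_def \<beta>_def bracket_def by (simp add: algebra_simps)
    define \<nu> where "\<nu> = h / \<alpha>"
    have \<alpha>\<beta>: "\<alpha> \<noteq> 0" "\<beta> \<noteq> 0" using nz by (auto simp: \<alpha>_def \<beta>_def)
    have hl: "h = \<nu> * \<alpha>" "e = \<nu> * \<beta>" using \<alpha>\<beta> eh by (simp_all add: \<nu>_def field_simps)
    have "\<nu> \<noteq> 0"
    proof
      assume "\<nu> = 0"
      then show False using abcd(1) hl e h by simp
    qed
    then have "moebius_map (\<nu> * (\<alpha> * snd w2)) (\<nu> * (\<alpha> * - fst w2)) (\<nu> * (\<beta> * snd w1)) (\<nu> * (\<beta> * - fst w1)) = T0"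
      unfolding T0_def by (rule moebius_map_scale)
    then show "T = T0" unfolding abcd(2) e h hl by (simp add: mult.assoc)
  qed
  then show ?thesis using T0[OF u] by (simp add: \<alpha>_def \<beta>_def)
qed

definition index_perm :: "nat \<Rightarrow> (nat \<Rightarrow> nat) \<Rightarrow> nat \<Rightarrow> nat" where
  "index_perm n \<sigma> i = (if i \<le> n then inv' \<sigma> (i + 1) - 1 else i)"

text \<open>The index shift relates the punctures \<open>1, \<dots>, n + 1\<close> to the coordinates \<open>0, \<dots>, n\<close>.\<close>

lemma sym_act_eq_norm_param:
  assumes l: "l \<in> param_space n" and n: "n \<ge> 2" and \<sigma>: "\<sigma> \<in> carrier (sym_group (n + 1))"
  shows "index_perm n \<sigma> permutes {..n}" and "sym_act n \<sigma> l = norm_param n (branch_vec l \<circ> index_perm n \<sigma>)"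
proof -
  have \<sigma>p: "inv' \<sigma> permutes {1..n + 1}" using \<sigma> by (simp add: sym_group_def permutes_inv)
  define \<rho> where "\<rho> = index_perm n \<sigma>"
  note \<rho>_eq = \<rho>_def
  note \<rho>_def = \<rho>_def index_perm_def
  have mem: "inv' \<sigma> (i + 1) \<in> {1..n + 1}" if "i \<le> n" for i
    using permutes_in_image[OF \<sigma>p, of "i + 1"] that by simp
  have suc: "inv' \<sigma> (i + 1) = \<rho> i + 1" if "i \<le> n" for i using mem[OF that] that by (simp add: \<rho>_def)
  have \<rho>le: "\<rho> i \<le> n" if "i \<le> n" for i using mem[OF that] that by (simp add: \<rho>_def) linarith
  have inj: "inj_on \<rho> {..n}"
  proof (rule inj_onI)
    fix x y assume xy: "x \<in> {..n}" "y \<in> {..n}" "\<rho> x = \<rho> y"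
    then have "inv' \<sigma> (x + 1) = inv' \<sigma> (y + 1)" using suc by simp
    then show "x = y" using permutes_inj[OF \<sigma>p] by (auto dest: injD)
  qed
  have "\<rho> ` {..n} = {..n}" using \<rho>le inj by (intro endo_inj_surj) auto
  then have \<rho>p: "\<rho> permutes {..n}"
    using inj by (intro bij_imp_permutes) (auto simp: bij_betw_def \<rho>_def)
  have gen: "in_general_position n (branch_vec l)" by (rule branch_vec_general[OF l])
  define v where "v = branch_vec l \<circ> \<rho>"
  have vnz: "bracket (v i) (v i') \<noteq> 0" if "i \<le> n" "i' \<le> n" "i \<noteq> i'" for i i'
    unfolding v_def o_def using in_general_positionD[OF gen \<rho>le[OF that(1)] \<rho>le[OF that(2)]] inj that
    by (auto simp: inj_on_def)
  have bp: "branch_pt l (inv' \<sigma> (i + 1)) = sphere_pt (v i)" if "i \<le> n" for i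
    unfolding suc[OF that] v_def by (simp only: branch_pt_eq o_apply)
  have bp123: "branch_pt l (inv' \<sigma> 1) = sphere_pt (v 0)" "branch_pt l (inv' \<sigma> 2) = sphere_pt (v 1)" "branch_pt l (inv' \<sigma> 3) = sphere_pt (v 2)"
    using bp[of 0] bp[of 1] bp[of 2] n by (simp_all add: numeral_3_eq_3 numeral_2_eq_2)
  have "sym_act n \<sigma> l = norm_param n v"
    unfolding sym_act_def norm_param_def
  proof (rule restrict_ext)
    fix i assume i: "i \<in> {1..n - 2}"
    have le: "i + 2 \<le> n" using i by auto
    have "v (i + 2) \<noteq> (0, 0)" using vnz[of "i + 2" 0] le by (auto simp: bracket_def)
    moreover have "branch_pt l (inv' \<sigma> (i + 3)) = sphere_pt (v (i + 2))" using bp[OF le] by (simp add: add.commute numeral_3_eq_3)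
    ultimately have "normalizing_map \<sigma> l (branch_pt l (inv' \<sigma> (i + 3))) =
       sphere_pt (bracket (v (i + 2)) (v 1) * bracket (v 2) (v 0), bracket (v (i + 2)) (v 0) * bracket (v 2) (v 1))"
      unfolding normalizing_map_def bp123 using normalizing_map_value[of "v 0" "v 1" "v 2" "v (i + 2)"] vnz n by simp
    then show "the (normalizing_map \<sigma> l (branch_pt l (inv' \<sigma> (i + 3)))) =
        bracket (v (i + 2)) (v 1) * bracket (v 2) (v 0) / (bracket (v (i + 2)) (v 0) * bracket (v 2) (v 1))"
      using vnz[of "i + 2" 0] vnz[of 2 1] le n by (simp add: sphere_pt_def)
  qed
  then show "sym_act n \<sigma> l = norm_param n (branch_vec l \<circ> index_perm n \<sigma>)"
    unfolding v_def \<rho>_eq .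
  show "index_perm n \<sigma> permutes {..n}" using \<rho>p unfolding \<rho>_eq .
qed

lemma sym_act_ordinary_locus:
  assumes n: "n \<ge> 2" and l: "l \<in> ordinary_locus k n" and \<sigma>: "\<sigma> \<in> carrier (sym_group (n + 1))"
  shows "sym_act n \<sigma> l \<in> ordinary_locus k n"
proof -
  have lp: "l \<in> param_space n" using l by (simp add: ordinary_locus_def)
  define \<rho> where "\<rho> = index_perm n \<sigma>"
  have \<rho>: "\<rho> permutes {..n}" "sym_act n \<sigma> l = norm_param n (branch_vec l \<circ> \<rho>)"
    unfolding \<rho>_def by (rule sym_act_eq_norm_param[OF lp n \<sigma>])+
  let ?v = "branch_vec l \<circ> \<rho>"
  have v: "in_general_position n ?v"
    unfolding in_general_position_def o_def
    using in_general_positionD[OF branch_vec_general[OF lp]] permutes_in_image[OF \<rho>(1)] permutes_inj[OF \<rho>(1)]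
    by (auto dest: injD)
  have "ordinary_at k n (branch_vec (norm_param n ?v)) q" if q: "q \<in> conditions k n" for q
  proof (rule ordinary_at_norm_param[OF v n q])
    obtain \<tau> j j0 r where q': "q = (\<tau>, j, j0, r)" "\<tau> permutes {..n}" using q by (auto simp: conditions_def)
    have "(\<rho> \<circ> \<tau>, j, j0, r) \<in> conditions k n"
      using q permutes_compose[OF q'(2) \<rho>(1)] by (simp add: conditions_def q'(1))
    then have "ordinary_at k n (branch_vec l) (\<rho> \<circ> \<tau>, j, j0, r)" using l unfolding ordinary_locus_def by blast
    then show "ordinary_at k n ?v q" by (simp add: ordinary_at_def q'(1) o_assoc)
  qed
  then show ?thesis unfolding \<rho>(2) ordinary_locus_def using norm_param_in_param_space[OF v n] by blast
qed

text \<open>Since the identity permutation acts trivially, the quotient map pulls the image of an invariant set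
back to that set; this transfers openness and density to the moduli space.\<close>

lemma mem_moduli_class:
  assumes l: "l \<in> param_space n" and n: "n \<ge> 2"
  shows "l \<in> moduli_class n l"
proof -
  have id: "id \<in> carrier (sym_group (n + 1))" by (simp add: sym_group_def permutes_id)
  have "index_perm n id = id" by (simp add: index_perm_def fun_eq_iff)
  then have "sym_act n id l = l"
    using sym_act_eq_norm_param(2)[OF l n id] by (simp add: norm_param_branch_vec[OF l])
  then show ?thesis unfolding moduli_class_def Group_Action.orbit_def using id by force
qed

section \<open>Fixed points, weights and the dense open locus\<close>

definition diag_act :: "(nat \<Rightarrow> complex) \<Rightarrow> (nat \<Rightarrow> complex) set \<Rightarrow> (nat \<Rightarrow> complex) set" where
  "diag_act d P = (\<lambda>x i. d i * x i) ` P"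

lemma diag_act_proj_pt: "diag_act d (proj_pt x) = proj_pt (\<lambda>i. d i * x i)"
proof -
  have eq: "(\<lambda>i. d i * (a * x i)) = (\<lambda>i. a * (d i * x i))" for a by (simp add: mult.left_commute)
  have "diag_act d (proj_pt x) = (\<lambda>a. (\<lambda>i. d i * (a * x i))) ` (- {0})"
    unfolding diag_act_def proj_pt_def by auto
  also have "\<dots> = proj_pt (\<lambda>i. d i * x i)" unfolding eq proj_pt_def by auto
  finally show ?thesis .
qed

lemma diag_act_compose: "diag_act d (diag_act d' P) = diag_act (\<lambda>i. d i * d' i) P"
  by (simp add: diag_act_def image_image mult.assoc)

lemma diag_act_one: "diag_act (\<lambda>_. 1) P = P"
  by (simp add: diag_act_def)

definition root_diags :: "nat \<Rightarrow> (nat \<Rightarrow> complex) set" where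
  "root_diags k = {d. \<forall>i. d i ^ k = 1}"

lemma root_diags_nz: "k > 0 \<Longrightarrow> d \<in> root_diags k \<Longrightarrow> d i \<noteq> 0"
  by (auto simp: root_diags_def power_0_left dest!: spec[of _ i])

lemma fermat_curveE:
  assumes "P \<in> fermat_curve k n l"
  obtains x where "x \<in> hom_coords n" "P = proj_pt x"
  using assms unfolding fermat_curve_def proj_space_def by blast

lemma diag_act_curve:
  assumes k: "k > 0" and d: "d \<in> root_diags k" and P: "P \<in> fermat_curve k n l"
  shows "diag_act d P \<in> fermat_curve k n l"
proof -
  obtain x where x: "x \<in> hom_coords n" "P = proj_pt x" using fermat_curveE[OF P] by metis
  have dk: "d i ^ k = 1" for i using d by (simp add: root_diags_def)
  have "(\<lambda>i. d i * x i) \<in> hom_coords n"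
    using x(1) root_diags_nz[OF k d] by (simp add: hom_coords_def)
  moreover have eqs: "\<forall>y\<in>P. y 0 ^ k + y 1 ^ k + y 2 ^ k = 0 \<and> (\<forall>i\<in>{1..n - 2}. l i * y 0 ^ k + y 1 ^ k + y (i + 2) ^ k = 0)"
    using P unfolding fermat_curve_def by blast
  have "\<forall>y\<in>diag_act d P. y 0 ^ k + y 1 ^ k + y 2 ^ k = 0 \<and> (\<forall>i\<in>{1..n - 2}. l i * y 0 ^ k + y 1 ^ k + y (i + 2) ^ k = 0)"
  proof
    fix y assume "y \<in> diag_act d P"
    then obtain z where z: "z \<in> P" "y = (\<lambda>i. d i * z i)" unfolding diag_act_def by blast
    show "y 0 ^ k + y 1 ^ k + y 2 ^ k = 0 \<and> (\<forall>i\<in>{1..n - 2}. l i * y 0 ^ k + y 1 ^ k + y (i + 2) ^ k = 0)"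
      unfolding z(2) power_mult_distrib dk mult_1 using eqs z(1) by blast
  qed
  ultimately show ?thesis unfolding fermat_curve_def proj_space_def x(2) diag_act_proj_pt by blast
qed

definition root_maps :: "nat \<Rightarrow> (nat \<Rightarrow> complex) set set \<Rightarrow> ((nat \<Rightarrow> complex) set \<Rightarrow> (nat \<Rightarrow> complex) set) set" where
  "root_maps k X = {restrict (diag_act d) X | d. d \<in> root_diags k}"

lemma diag_act_inverse:
  assumes "k > 0" "d \<in> root_diags k"
  shows "(\<lambda>i. inverse (d i)) \<in> root_diags k"
    and "diag_act d (diag_act (\<lambda>i. inverse (d i)) P) = P" "diag_act (\<lambda>i. inverse (d i)) (diag_act d P) = P"
  using assms root_diags_nz[OF assms]
  by (simp_all add: diag_act_compose diag_act_one) (simp add: root_diags_def power_inverse)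

lemma restrict_diag_act_Bij:
  assumes k: "k > 0" and d: "d \<in> root_diags k"
  shows "restrict (diag_act d) (fermat_curve k n l) \<in> Bij (fermat_curve k n l)"
proof -
  let ?X = "fermat_curve k n l"
  have "bij_betw (diag_act d) ?X ?X"
    by (rule bij_betwI[where g = "diag_act (\<lambda>i. inverse (d i))"])
      (use diag_act_curve[OF k] diag_act_inverse[OF k d] d in auto)
  then show ?thesis unfolding Bij_def by (auto cong: bij_betw_cong)
qed

lemma phi_eq_diag_act: "phi k j = diag_act (\<lambda>i. if i = j then exp (2 * of_real pi * \<i> / of_nat k) else 1)"
proof
  fix P
  have "x(j := exp (2 * of_real pi * \<i> / of_nat k) * x j) = (\<lambda>i. (if i = j then exp (2 * of_real pi * \<i> / of_nat k) else 1) * x i)" for x :: "nat \<Rightarrow> complex"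
    by (auto simp: fun_eq_iff)
  then show "phi k j P = diag_act (\<lambda>i. if i = j then exp (2 * of_real pi * \<i> / of_nat k) else 1) P"
    unfolding phi_def diag_act_def by simp
qed

text \<open>Diagonal maps by \<open>k\<close>-th roots of unity are closed under composition and inverses, so the generated
group consists of such maps.\<close>

lemma fermat_group_subset_root_maps:
  assumes k: "k > 0"
  shows "fermat_group k n l \<subseteq> root_maps k (fermat_curve k n l)"
proof
  let ?X = "fermat_curve k n l"
  have phi: "\<exists>d\<in>root_diags k. phi k j = diag_act d" for j
  proof -
    have "exp (2 * of_real pi * \<i> / of_nat k) ^ k = 1"
      using k by (simp flip: exp_of_nat_mult)
    then have "(\<lambda>i. if i = j then exp (2 * of_real pi * \<i> / of_nat k) else 1) \<in> root_diags k"
      by (simp add: root_diags_def)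
    then show ?thesis using phi_eq_diag_act by blast
  qed
  fix h assume "h \<in> fermat_group k n l"
  then show "h \<in> root_maps k ?X"
    unfolding fermat_group_def
  proof (induction h rule: generate.induct)
    case one
    have "(\<lambda>_. 1) \<in> root_diags k" by (simp add: root_diags_def)
    moreover have "diag_act (\<lambda>_. 1) = (\<lambda>P. P)" by (rule ext) (rule diag_act_one)
    then have "\<one>\<^bsub>BijGroup ?X\<^esub> = restrict (diag_act (\<lambda>_. 1)) ?X"
      by (simp add: BijGroup_def)
    ultimately show ?case unfolding root_maps_def by blast
  next
    case (incl h)
    then show ?case using phi unfolding root_maps_def by (auto simp: image_iff) metis
  next
    case (inv h)
    then obtain j where h0: "h = restrict (phi k j) ?X" by blast
    obtain d where d: "d \<in> root_diags k" "phi k j = diag_act d" using phi by blast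
    have h: "h = restrict (diag_act d) ?X" using h0 d(2) by simp
    have B: "h \<in> Bij ?X" unfolding h by (rule restrict_diag_act_Bij[OF k d(1)])
    have "inv\<^bsub>BijGroup ?X\<^esub> h = restrict (diag_act (\<lambda>i. inverse (d i))) ?X"
      unfolding inv_BijGroup[OF B]
    proof (rule restrict_ext)
      fix P assume P: "P \<in> ?X"
      have Q: "diag_act (\<lambda>i. inverse (d i)) P \<in> ?X" by (rule diag_act_curve[OF k diag_act_inverse(1)[OF k d(1)] P])
      have "inj_on h ?X" using B by (simp add: Bij_def bij_betw_def)
      moreover have "h (diag_act (\<lambda>i. inverse (d i)) P) = P"
        unfolding h using Q by (simp add: diag_act_inverse(2)[OF k d(1)])
      ultimately show "inv_into ?X h P = diag_act (\<lambda>i. inverse (d i)) P" using Q by (metis inv_into_f_f)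
    qed
    then show ?case unfolding root_maps_def using diag_act_inverse(1)[OF k d(1)] by blast
  next
    case (eng h1 h2)
    obtain d1 d2 where d: "d1 \<in> root_diags k" "h1 = restrict (diag_act d1) ?X" "d2 \<in> root_diags k" "h2 = restrict (diag_act d2) ?X"
      using eng.IH unfolding root_maps_def by blast
    have B: "h1 \<in> Bij ?X" "h2 \<in> Bij ?X" unfolding d(2,4) by (rule restrict_diag_act_Bij[OF k d(1)] restrict_diag_act_Bij[OF k d(3)])+
    have "h1 \<otimes>\<^bsub>BijGroup ?X\<^esub> h2 = compose ?X h1 h2" using B by (simp add: BijGroup_def)
    also have "\<dots> = restrict (diag_act (\<lambda>i. d1 i * d2 i)) ?X"
      unfolding compose_def d(2,4)
      by (rule restrict_ext) (simp add: diag_act_curve[OF k d(3)] diag_act_compose)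
    finally have "h1 \<otimes>\<^bsub>BijGroup ?X\<^esub> h2 = restrict (diag_act (\<lambda>i. d1 i * d2 i)) ?X" .
    moreover have "(\<lambda>i. d1 i * d2 i) \<in> root_diags k" using d(1,3) by (simp add: root_diags_def power_mult_distrib)
    ultimately show ?case unfolding root_maps_def by blast
  qed
qed

text \<open>A diagonal map that fixes a point without vanishing coordinates is a scalar, hence acts trivially.\<close>

lemma fixed_pts_coordinate_zero:
  assumes k: "k > 0" and p: "p \<in> fixed_pts k n l"
  obtains x j where "x \<in> hom_coords n" "p = proj_pt x" "p \<in> fermat_curve k n l" "j \<le> n" "x j = 0"
proof -
  let ?X = "fermat_curve k n l"
  obtain h where h: "p \<in> ?X" "h \<in> fermat_group k n l" "h \<noteq> \<one>\<^bsub>BijGroup ?X\<^esub>" "h p = p"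
    using p unfolding fixed_pts_def by blast
  obtain d where d: "d \<in> root_diags k" "h = restrict (diag_act d) ?X"
    using fermat_group_subset_root_maps[OF k] h(2) unfolding root_maps_def by blast
  obtain x where x: "x \<in> hom_coords n" "p = proj_pt x" using fermat_curveE[OF h(1)] by metis
  have "\<exists>j\<le>n. x j = 0"
  proof (rule ccontr)
    assume H: "\<not> (\<exists>j\<le>n. x j = 0)"
    have "proj_pt x = proj_pt (\<lambda>i. d i * x i)" using h(1,4) d(2) unfolding x(2) by (simp add: diag_act_proj_pt)
    then obtain a where a: "a \<noteq> 0" "(\<lambda>i. d i * x i) = (\<lambda>i. a * x i)" using proj_pt_eqD by blast
    have da: "d i = a" if "i \<le> n" for i using fun_cong[OF a(2), of i] H that by auto
    have "diag_act d P = P" if P: "P \<in> ?X" for P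
    proof -
      obtain z where z: "z \<in> hom_coords n" "P = proj_pt z" using fermat_curveE[OF P] by metis
      have "d i * z i = a * z i" for i
        using z(1) da[of i] by (cases "i \<le> n") (auto simp: hom_coords_def)
      then have "(\<lambda>i. d i * z i) = (\<lambda>i. a * z i)" by blast
      then show ?thesis unfolding z(2) diag_act_proj_pt by (simp only: proj_pt_scale[OF a(1)])
    qed
    then have "h = \<one>\<^bsub>BijGroup ?X\<^esub>" unfolding d(2) BijGroup_def by (auto intro!: restrict_ext)
    then show False using h(3) by contradiction
  qed
  then show ?thesis using that x h(1) by blast
qed

text \<open>The equations say \<open>x\<^sub>i ^ k = - (\<gamma>\<^sub>i x\<^sub>0 ^ k + x\<^sub>1 ^ k)\<close> for \<open>i \<ge> 2\<close>, whence the sign.\<close>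

definition curve_sign :: "nat \<Rightarrow> complex" where
  "curve_sign i = (if i \<le> 1 then 1 else - 1)"

text \<open>The curve is the pullback under \<open>x\<^sub>i \<mapsto> x\<^sub>i ^ k\<close> of a line, and the form of the \<open>i\<close>-th coordinate on it
vanishes at the \<open>i\<close>-th branch point. This description is symmetric in all \<open>n + 1\<close> coordinates.\<close>

lemma curve_equations_iff:
  assumes n: "n \<ge> 2"
  shows "(x 0 ^ k + x 1 ^ k + x 2 ^ k = 0 \<and> (\<forall>i\<in>{1..n - 2}. l i * x 0 ^ k + x 1 ^ k + x (i + 2) ^ k = 0)) \<longleftrightarrow>
    (\<exists>w. \<forall>i\<le>n. x i ^ k = curve_sign i * bracket (branch_vec l i) w)" (is "?A \<longleftrightarrow> ?B")
proof
  assume A: ?A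
  show ?B
  proof (intro exI[of _ "(- (x 1 ^ k), x 0 ^ k)"] allI impI)
    fix i assume i: "i \<le> n"
    consider "i = 0" | "i = 1" | "i = 2" | "i \<ge> 3" by linarith
    then show "x i ^ k = curve_sign i * bracket (branch_vec l i) (- (x 1 ^ k), x 0 ^ k)"
    proof cases
      case 3
      have "x 2 ^ k = - (x 0 ^ k + x 1 ^ k)" using A by (simp add: eq_neg_iff_add_eq_0 algebra_simps)
      then show ?thesis using 3 by (simp add: curve_sign_def bracket_def branch_vec_def)
    next
      case 4
      then have m: "i - 2 \<in> {1..n - 2}" "i - 2 + 2 = i" using i by auto
      have "l (i - 2) * x 0 ^ k + x 1 ^ k + x (i - 2 + 2) ^ k = 0" using A m(1) by blast
      then have "x i ^ k = - (l (i - 2) * x 0 ^ k + x 1 ^ k)" unfolding m(2) by (simp add: eq_neg_iff_add_eq_0 algebra_simps)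
      then show ?thesis using 4 by (simp add: curve_sign_def bracket_def branch_vec_def)
    qed (simp_all add: curve_sign_def bracket_def branch_vec_def)
  qed
next
  assume ?B
  then obtain w where w: "\<And>i. i \<le> n \<Longrightarrow> x i ^ k = curve_sign i * bracket (branch_vec l i) w" by blast
  have x01: "x 0 ^ k = snd w" "x 1 ^ k = - fst w"
    using w[of 0] w[of 1] n by (simp_all add: curve_sign_def bracket_def branch_vec_def)
  have "x 2 ^ k = - (snd w - fst w)" using w[of 2] n by (simp add: curve_sign_def bracket_def branch_vec_def)
  moreover have "l i * x 0 ^ k + x 1 ^ k + x (i + 2) ^ k = 0" if i: "i \<in> {1..n - 2}" for i
  proof -
    have "i + 2 \<le> n" using i by auto
    from w[OF this] show ?thesis unfolding x01 using i by (simp add: curve_sign_def bracket_def branch_vec_def)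
  qed
  ultimately show ?A unfolding x01 by simp
qed

text \<open>Any two of the linear forms generate all of them, by the Pluecker relation.\<close>

lemma pencil_relation:
  assumes nz: "bracket vj0 vj \<noteq> 0" and d: "dj \<noteq> 0" "dj0 \<noteq> 0"
    and x: "xj = dj * bracket vj w" "xj0 = dj0 * bracket vj0 w" and c: "c = bracket vi vj0 / bracket vi vj * (dj0 / dj)" and nzi: "bracket vi vj \<noteq> 0"
  shows "di * bracket vi vj / (dj0 * bracket vj0 vj) * (xj0 - c * xj) = di * bracket vi w"
proof -
  have "bracket vi w * bracket vj0 vj = bracket vi vj * bracket vj0 w - bracket vi vj0 * bracket vj w"
    by (simp add: bracket_def algebra_simps)
  then have P: "bracket vi w = (bracket vi vj * bracket vj0 w - bracket vi vj0 * bracket vj w) / bracket vj0 vj" using nz by (simp add: field_simps)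
  have "c * xj = dj0 * (bracket vi vj0 * bracket vj w / bracket vi vj)" unfolding c x using d by simp
  then have "xj0 - c * xj = dj0 * (bracket vi vj * bracket vj0 w - bracket vi vj0 * bracket vj w) / bracket vi vj"
    unfolding x(2) using nzi by (simp add: field_simps)
  then show ?thesis unfolding P using nz nzi d by simp
qed

lemma bracket_combination:
  "bracket u ((A * fst p - B * fst q) / D, (A * snd p - B * snd q) / D) = (A * bracket u p - B * bracket u q) / D"
  by (cases "D = 0") (simp_all add: bracket_def field_simps)

text \<open>Expressing all \<open>x\<^sub>i ^ k\<close> by \<open>x\<^sub>j ^ k\<close> and \<open>x\<^sub>j\<^sub>0 ^ k\<close> brings the curve into the form of \<open>fermat_cover\<close>, with
parameters \<open>c\<close> proportional to \<open>ratio_coord\<close>; the coordinates of the point itself serve as the roots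
\<open>b\<close>.\<close>

theorem weierstrass_gaps_at_coordinate_zero:
  assumes k: "k \<ge> 2" and n: "n \<ge> 2" and l: "l \<in> param_space n"
    and x: "x \<in> hom_coords n" "proj_pt x \<in> fermat_curve k n l" "x j = 0" and j: "j \<le> n" and j0: "j0 \<le> n" "j0 \<noteq> j"
  shows "weierstrass_gaps (local_params n (fermat_curve k n l)) (proj_pt x) =
    gap_set k ({..n} - {j}) (ratio_coord (branch_vec l) j j0)"
proof -
  let ?I = "{..n} - {j}" and ?v = "branch_vec l" and ?d = curve_sign
  have k0: "k > 0" using k by simp
  have gen: "bracket (?v i) (?v i') \<noteq> 0" if "i \<le> n" "i' \<le> n" "i \<noteq> i'" for i i'
    by (rule in_general_positionD[OF branch_vec_general[OF l] that])
  have d: "?d i \<noteq> 0" for i by (simp add: curve_sign_def)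
  \<comment> \<open>the factor between the parameters of the cover and \<open>ratio_coord\<close>, due to the signs\<close>
  define \<kappa> where "\<kappa> = ?d j0 / ?d j"
  have \<kappa>: "\<kappa> \<noteq> 0" using d by (simp add: \<kappa>_def)
  define c where "c i = \<kappa> * ratio_coord ?v j j0 i" for i
  have curve_iff: "P \<in> fermat_curve k n l \<longleftrightarrow> P \<in> proj_space n \<and> (\<forall>y\<in>P. \<exists>w. \<forall>i\<le>n. y i ^ k = ?d i * bracket (?v i) w)" for P
    unfolding fermat_curve_def mem_Collect_eq curve_equations_iff[OF n] ..
  have lead: "?d i * bracket (?v i) (?v j) / (?d j0 * bracket (?v j0) (?v j)) \<noteq> 0" if "i \<in> ?I" for i
    using gen[of i j] gen[of j0 j] d that j j0 by simp
  have rel: "(\<exists>w. \<forall>i\<le>n. y i ^ k = ?d i * bracket (?v i) w) \<longleftrightarrow>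
     (\<forall>i\<in>?I. y i ^ k = ?d i * bracket (?v i) (?v j) / (?d j0 * bracket (?v j0) (?v j)) * (y j0 ^ k - c i * y j ^ k))" for y
  proof
    assume "\<exists>w. \<forall>i\<le>n. y i ^ k = ?d i * bracket (?v i) w"
    then obtain w where w: "\<And>i. i \<le> n \<Longrightarrow> y i ^ k = ?d i * bracket (?v i) w" by blast
    show "\<forall>i\<in>?I. y i ^ k = ?d i * bracket (?v i) (?v j) / (?d j0 * bracket (?v j0) (?v j)) * (y j0 ^ k - c i * y j ^ k)"
    proof
      fix i assume i: "i \<in> ?I"
      have "?d i * bracket (?v i) (?v j) / (?d j0 * bracket (?v j0) (?v j)) * (y j0 ^ k - c i * y j ^ k) = ?d i * bracket (?v i) w"
        by (rule pencil_relation[OF gen[OF j0(1) j j0(2)] d d w[OF j] w[OF j0(1)]])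
          (use i j gen in \<open>auto simp: c_def \<kappa>_def ratio_coord_def mult.commute\<close>)
      then show "y i ^ k = ?d i * bracket (?v i) (?v j) / (?d j0 * bracket (?v j0) (?v j)) * (y j0 ^ k - c i * y j ^ k)"
        using w[of i] i by simp
    qed
  next
    assume R: "\<forall>i\<in>?I. y i ^ k = ?d i * bracket (?v i) (?v j) / (?d j0 * bracket (?v j0) (?v j)) * (y j0 ^ k - c i * y j ^ k)"
    let ?D = "bracket (?v j0) (?v j)"
    define w where "w = ((y j0 ^ k / ?d j0 * fst (?v j) - y j ^ k / ?d j * fst (?v j0)) / ?D,
      (y j0 ^ k / ?d j0 * snd (?v j) - y j ^ k / ?d j * snd (?v j0)) / ?D)"
    have dtw: "bracket u w = (y j0 ^ k / ?d j0 * bracket u (?v j) - y j ^ k / ?d j * bracket u (?v j0)) / ?D" for u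
      unfolding w_def by (rule bracket_combination)
    have D: "?D \<noteq> 0" by (rule gen[OF j0(1) j j0(2)])
    have wj0: "y j0 ^ k = ?d j0 * bracket (?v j0) w" unfolding dtw using D d by simp
    have wj: "y j ^ k = ?d j * bracket (?v j) w" unfolding dtw bracket_anti[of "?v j" "?v j0"] using D d by simp
    show "\<exists>w. \<forall>i\<le>n. y i ^ k = ?d i * bracket (?v i) w"
    proof (intro exI[of _ w] allI impI)
      fix i assume i: "i \<le> n"
      show "y i ^ k = ?d i * bracket (?v i) w"
      proof (cases "i = j")
        case False
        have "?d i * bracket (?v i) (?v j) / (?d j0 * ?D) * (y j0 ^ k - c i * y j ^ k) = ?d i * bracket (?v i) w"
          by (rule pencil_relation[OF D d d wj wj0])
            (use i j gen False in \<open>auto simp: c_def \<kappa>_def ratio_coord_def mult.commute\<close>)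
        then show ?thesis using R i False by simp
      qed (use wj in simp)
    qed
  qed
  have xR: "x i ^ k = ?d i * bracket (?v i) (?v j) / (?d j0 * bracket (?v j0) (?v j)) * x j0 ^ k" if i: "i \<in> ?I" for i
  proof -
    have "\<exists>w. \<forall>i\<le>n. x i ^ k = ?d i * bracket (?v i) w"
      using x(2) mem_proj_pt_self[of x] unfolding curve_iff by blast
    then have "x i ^ k = ?d i * bracket (?v i) (?v j) / (?d j0 * bracket (?v j0) (?v j)) * (x j0 ^ k - c i * x j ^ k)"
      unfolding rel using i by blast
    then show ?thesis unfolding x(3) using k0 by (simp add: power_0_left)
  qed
  have xj0: "x j0 \<noteq> 0"
  proof
    assume "x j0 = 0"
    then have "x i = 0" if "i \<in> ?I" for i using xR[OF that] k0 by (simp add: power_0_left)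
    then have "x i = 0" if "i \<le> n" for i using x(3) that by (cases "i = j") auto
    then show False using x(1) by (auto simp: hom_coords_def)
  qed
  define b where "b i = (if i \<in> ?I then x i / x j0 else 1)" for i
  have bk: "b i ^ k = ?d i * bracket (?v i) (?v j) / (?d j0 * bracket (?v j0) (?v j))" if "i \<in> ?I" for i
    using that xj0 unfolding b_def by (simp only: if_True power_divide xR[OF that]) simp
  have bnz: "b i \<noteq> 0" for i
  proof (cases "i \<in> ?I")
    case True
    then show ?thesis using bk[OF True] lead[OF True] k0 by (metis power_0_left not_gr_zero)
  next
    case False
    then have "b i = 1" unfolding b_def by (simp only: if_False)
    then show ?thesis by simp
  qed
  have I0: "j0 \<in> ?I" using j0 by simp
  interpret fermat_cover k n j j0 b c "fermat_curve k n l" ?I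
  proof
    show "2 \<le> k" "j \<le> n" "j0 \<in> ?I" "?I = {..n} - {j}" using k j I0 by auto
    show "c j0 = 0" by (simp add: c_def ratio_coord_def)
    show "b j0 = 1" using I0 xj0 by (simp add: b_def)
    show "b i \<noteq> 0" for i by (rule bnz)
    show "inj_on c ?I"
    proof (rule inj_onI, rule ccontr)
      fix i i' assume i: "i \<in> ?I" "i' \<in> ?I" "c i = c i'" "i \<noteq> i'"
      have nz: "bracket (?v i) (?v j) \<noteq> 0" "bracket (?v i') (?v j) \<noteq> 0" "bracket (?v i) (?v i') \<noteq> 0" "bracket (?v j0) (?v j) \<noteq> 0"
        using gen i j j0 by auto
      have "ratio_coord ?v j j0 i = ratio_coord ?v j j0 i'" using i(3) \<kappa> by (simp add: c_def)
      then have "bracket (?v i) (?v j0) * bracket (?v i') (?v j) = bracket (?v i') (?v j0) * bracket (?v i) (?v j)"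
        using nz by (simp add: ratio_coord_def field_simps)
      then have "bracket (?v i) (?v i') * bracket (?v j0) (?v j) = 0"
        using bracket_pluecker[of "?v i" "?v i'" "?v j0" "?v j"] by (simp add: algebra_simps)
      then show False using nz by simp
    qed
    have rel_b: "(\<forall>i\<in>?I. y i ^ k = ?d i * bracket (?v i) (?v j) / (?d j0 * bracket (?v j0) (?v j)) * (y j0 ^ k - c i * y j ^ k)) =
        (\<forall>i\<in>?I. y i ^ k = b i ^ k * (y j0 ^ k - c i * y j ^ k))" for y
      by (rule ball_cong[OF refl]) (simp only: bk)
    show "fermat_curve k n l = {P \<in> proj_space n. \<forall>x\<in>P. \<forall>i\<in>?I. x i ^ k = b i ^ k * (x j0 ^ k - c i * x j ^ k)}"
    proof (rule Set.set_eqI)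
      fix P
      show "P \<in> fermat_curve k n l \<longleftrightarrow> P \<in> {P \<in> proj_space n. \<forall>x\<in>P. \<forall>i\<in>?I. x i ^ k = b i ^ k * (x j0 ^ k - c i * x j ^ k)}"
        unfolding curve_iff rel mem_Collect_eq rel_b ..
    qed
  qed
  have "centre = proj_pt x"
  proof -
    have "(\<lambda>i. x j0 * coords 0 (\<lambda>_. 1) i) = x"
    proof
      fix i
      consider "i = j" | "i \<in> ?I" | "i > n" by (cases "i \<le> n") auto
      then show "x j0 * coords 0 (\<lambda>_. 1) i = x i"
      proof cases
        case 2
        then show ?thesis using xj0 by (simp add: coords_def b_def)
      next
        case 3
        then show ?thesis using x(1) j by (simp add: coords_def hom_coords_def)
      qed (simp add: coords_def x(3))
    qed
    then show ?thesis unfolding centre_def using proj_pt_scale[OF xj0] by metis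
  qed
  then have "weierstrass_gaps (local_params n (fermat_curve k n l)) (proj_pt x) = gap_set k ?I c"
    using weierstrass_gaps_centre by simp
  also have "gap_set k ?I c = gap_set k ?I (ratio_coord ?v j j0)"
    unfolding gap_set_def c_def by (simp only: vanishing_orders_diff_fps_scale[OF \<kappa>])
  finally show ?thesis .
qed

lemma fixed_pt_weight:
  assumes k: "k \<ge> 2" and n: "n \<ge> 2" and l: "l \<in> param_space n" and p: "p \<in> fixed_pts k n l"
  shows "weight_bound k n \<le> real_of_int (fermat_weight k n l p)"
    and "l \<in> ordinary_locus k n \<Longrightarrow> real_of_int (fermat_weight k n l p) = weight_bound k n"
proof -
  have k0: "k > 0" using k by simp
  obtain x j where x: "x \<in> hom_coords n" "p = proj_pt x" "p \<in> fermat_curve k n l" and j: "j \<le> n" and xj: "x j = 0"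
    using fixed_pts_coordinate_zero[OF k0 p] by metis
  obtain j0 where j0: "j0 \<le> n" "j0 \<noteq> j" using n that[of 0] that[of 1] by (cases "j = 0") auto
  let ?I = "{..n} - {j}" and ?c = "ratio_coord (branch_vec l) j j0"
  have gaps: "weierstrass_gaps (local_params n (fermat_curve k n l)) p = gap_set k ?I ?c"
    unfolding x(2) by (rule weierstrass_gaps_at_coordinate_zero[OF k n l x(1) x(3)[unfolded x(2)] xj j j0])
  have gen: "bracket (branch_vec l i) (branch_vec l i') \<noteq> 0" if "i \<le> n" "i' \<le> n" "i \<noteq> i'" for i i'
    by (rule in_general_positionD[OF branch_vec_general[OF l] that])
  have inj: "inj_on ?c ?I"
  proof (rule inj_onI, rule ccontr)
    let ?v = "branch_vec l"
    fix i i' assume i: "i \<in> ?I" "i' \<in> ?I" "?c i = ?c i'" "i \<noteq> i'"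
    have nz: "bracket (?v i) (?v j) \<noteq> 0" "bracket (?v i') (?v j) \<noteq> 0" "bracket (?v i) (?v i') \<noteq> 0" "bracket (?v j0) (?v j) \<noteq> 0"
      using gen i j j0 by auto
    then have "bracket (?v i) (?v j0) * bracket (?v i') (?v j) = bracket (?v i') (?v j0) * bracket (?v i) (?v j)"
      using i(3) by (simp add: ratio_coord_def field_simps)
    then have "bracket (?v i) (?v i') * bracket (?v j0) (?v j) = 0"
      using bracket_pluecker[of "?v i" "?v i'" "?v j0" "?v j"] by (simp add: algebra_simps)
    then show False using nz by simp
  qed
  have card: "card ?I = n" using j by simp
  note w = gap_set_weight[OF _ card n k inj gaps, folded fermat_weight_def]
  show "weight_bound k n \<le> real_of_int (fermat_weight k n l p)" by (rule w(1)) simp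
  assume good: "l \<in> ordinary_locus k n"
  show "real_of_int (fermat_weight k n l p) = weight_bound k n"
  proof (rule w(2))
    fix r assume "r \<in> {1..k}"
    then have "(id, j, j0, r) \<in> conditions k n" using j j0 by (simp add: conditions_def permutes_id)
    then have "ordinary_at k n (branch_vec l) (id, j, j0, r)" using good unfolding ordinary_locus_def by blast
    then show "uninflected (diff_index k ?I r) (diff_fps k ?I ?c)" using j0 by (simp add: ordinary_at_def)
  qed simp
qed

theorem theorem11:
  fixes k n :: nat
  assumes "k \<ge> 2" and "n \<ge> 3" and "(k - 1) * (n - 1) > 2"
  shows "(\<forall>l\<in>param_space n. \<forall>p\<in>fixed_pts k n l.
            weight_bound k n \<le> real_of_int (fermat_weight k n l p)) \<and>
    (\<exists>U. openin (fermat_moduli n) U \<and>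
         fermat_moduli n closure_of U = topspace (fermat_moduli n) \<and>
         (\<forall>l\<in>param_space n. moduli_class n l \<in> U \<longrightarrow>
            (\<forall>p\<in>fixed_pts k n l. real_of_int (fermat_weight k n l p) = weight_bound k n)))"
proof -
  have n: "n \<ge> 2" and k: "k > 0" using assms by auto
  let ?G = "ordinary_locus k n"
  define U where "U = moduli_class n ` ?G"
  have GP: "?G \<subseteq> param_space n" by (auto simp: ordinary_locus_def)
  have saturated: "l \<in> ?G" if l: "l \<in> param_space n" "moduli_class n l \<in> U" for l
  proof -
    obtain l' where l': "l' \<in> ?G" "moduli_class n l = moduli_class n l'" using l(2) by (auto simp: U_def)
    have "l \<in> moduli_class n l'" using mem_moduli_class[OF l(1) n] l'(2) by simp
    then obtain \<sigma> where "\<sigma> \<in> carrier (sym_group (n + 1))" "l = sym_act n \<sigma> l'"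
      unfolding moduli_class_def Group_Action.orbit_def by auto
    then show ?thesis using sym_act_ordinary_locus[OF n l'(1)] by simp
  qed
  have pre: "{l \<in> topspace (param_topology n). moduli_class n l \<in> U} = ?G"
    using saturated GP by (auto simp: topspace_param_topology U_def)
  have "openin (fermat_moduli n) U"
    unfolding fermat_moduli_def openin_quotient_topology pre
    using ordinary_locus_open_dense(1)[OF n k] GP by (auto simp: U_def topspace_param_topology)
  moreover have "fermat_moduli n closure_of U = topspace (fermat_moduli n)"
    unfolding dense_intersects_open
  proof (intro allI impI)
    fix T assume T: "openin (fermat_moduli n) T \<and> T \<noteq> {}"
    then have T': "T \<subseteq> moduli_class n ` topspace (param_topology n)"
      "openin (param_topology n) {l \<in> topspace (param_topology n). moduli_class n l \<in> T}"
      unfolding fermat_moduli_def openin_quotient_topology by auto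
    moreover have "{l \<in> topspace (param_topology n). moduli_class n l \<in> T} \<noteq> {}" using T T'(1) by blast
    ultimately obtain l where "moduli_class n l \<in> T" "l \<in> ?G"
      using ordinary_locus_open_dense(2)[OF n k] by blast
    then show "U \<inter> T \<noteq> {}" by (auto simp: U_def)
  qed
  moreover have "\<forall>l\<in>param_space n. moduli_class n l \<in> U \<longrightarrow>
      (\<forall>p\<in>fixed_pts k n l. real_of_int (fermat_weight k n l p) = weight_bound k n)"
    using fixed_pt_weight(2)[OF assms(1) n] saturated by blast
  ultimately show ?thesis using fixed_pt_weight(1)[OF assms(1) n] by blast
qed

end
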